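(* Let $A$ be a separable recursive subhomogeneous algebra, and let $I \subset A$ be an ideal. Then the unitization $I^+$ is a recursive subhomogeneous algebra, with topological dimension and maximum matrix size no larger than for $A$ (that is, $I^+$ has a recursive subhomogeneous decomposition whose topological dimension and maximum matrix size are no larger than those of $A$).
   Context: Homomorphisms of C*-algebras are *-homomorphisms, ideals are closed and two-sided, and $M_n = M_n(\mathbf{C})$. The unitization $I^+$ is the C*-algebra obtained by adjoining a new identity to $I$ (even if $I$ is already unital), so $I^+/I \cong \mathbf{C}$. Recursive subhomogeneous algebras. The class is defined recursively: (i) if $X$ is a compact Hausdorff space and $n \geq 1$, then $C(X, M_n)$ is a recursive subhomogeneous algebra; (ii) if $A$ is a recursive subhomogeneous algebra, $X$ is compact Hausdorff, $X^{(0)} \subset X$ is closed (possibly empty), $\varphi \colon A \to C(X^{(0)}, M_n)$ is any unital homomorphism and $\rho \colon C(X, M_n) \to C(X^{(0)}, M_n)$ is restriction, then the pullback $A \oplus_{C(X^{(0)}, M_n)} C(X, M_n) = \{(a,f) \in A \oplus C(X, M_n) : \varphi(a) = \rho(f)\}$ is a recursive subhomogeneous algebra. A recursive subhomogeneous decomposition of $R$ is an expression (isomorphism) of $R$ as such an iterated pullback: compact Hausdorff spaces $X_0, \dots, X_l$, positive integers $n(0), \dots, n(l)$, closed subsets $X_k^{(0)} \subset X_k$ ($1 \leq k \leq l$), $C_k = C(X_k, M_{n(k)})$, $C_k^{(0)} = C(X_k^{(0)}, M_{n(k)})$, with $R^{(0)} = C_0$, $R^{(k)} = R^{(k-1)}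 \oplus_{C_k^{(0)}} C_k$ formed using a unital homomorphism $R^{(k-1)} \to C_k^{(0)}$ and the restriction map $C_k \to C_k^{(0)}$, and $R = R^{(l)}$. Its maximum matrix size is $\max_k n(k)$, and its topological dimension is $\max_k \dim(X_k)$, where $\dim$ is covering dimension. Decompositions are not unique; a recursive subhomogeneous algebra is always assumed to come with a given decomposition, and its topological dimension and maximum matrix size are those of the given decomposition. *)

theory Defs
  imports
    "HOL-Analysis.Analysis"
    "HOL-Library.Extended_Nat"
    "HOL-Algebra.Ideal"
    "HOL-Algebra.Module"
    "Jordan_Normal_Form.Schur_Decomposition"
begin

section \<open>Unital C*-algebras with explicit carrier\<close>

record 'a cstar = "(complex, 'a) module" +
  star :: "'a \<Rightarrow> 'a"
  cnorm :: "'a \<Rightarrow> real"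

text \<open>The value outside the carrier is fixed because \<^locale>\<open>Metric_space\<close> asks for
  nonnegativity and symmetry of the distance on the whole type.\<close>

definition cdist :: "'a cstar \<Rightarrow> 'a \<Rightarrow> 'a \<Rightarrow> real" where
  "cdist A x y =
     (if x \<in> carrier A \<and> y \<in> carrier A then cnorm A (x \<ominus>\<^bsub>A\<^esub> y) else 0)"

text \<open>The zero algebra is allowed, so the unit is not required to have norm 1.\<close>

locale unital_cstar_algebra =
  ring A + Module.module "class_ring :: complex ring" A
  for A :: "'a cstar" (structure) +
  assumes smult_mult_left:
      "\<lbrakk>x \<in> carrier A; y \<in> carrier A\<rbrakk> \<Longrightarrow> (c \<odot> x) \<otimes> y = c \<odot> (x \<otimes> y)"
    and smult_mult_right:
      "\<lbrakk>x \<in> carrier A; y \<in> carrier A\<rbrakk> \<Longrightarrow> x \<otimes> (c \<odot> y) = c \<odot> (x \<otimes> y)"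
    and star_closed: "x \<in> carrier A \<Longrightarrow> star A x \<in> carrier A"
    and star_star: "x \<in> carrier A \<Longrightarrow> star A (star A x) = x"
    and star_add:
      "\<lbrakk>x \<in> carrier A; y \<in> carrier A\<rbrakk> \<Longrightarrow> star A (x \<oplus> y) = star A x \<oplus> star A y"
    and star_smult: "x \<in> carrier A \<Longrightarrow> star A (c \<odot> x) = cnj c \<odot> star A x"
    and star_mult:
      "\<lbrakk>x \<in> carrier A; y \<in> carrier A\<rbrakk> \<Longrightarrow> star A (x \<otimes> y) = star A y \<otimes> star A x"
    and cnorm_nonneg: "x \<in> carrier A \<Longrightarrow> 0 \<le> cnorm A x"
    and cnorm_eq_0: "x \<in> carrier A \<Longrightarrow> cnorm A x = 0 \<longleftrightarrow> x = \<zero>"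
    and cnorm_triangle:
      "\<lbrakk>x \<in> carrier A; y \<in> carrier A\<rbrakk> \<Longrightarrow> cnorm A (x \<oplus> y) \<le> cnorm A x + cnorm A y"
    and cnorm_smult: "x \<in> carrier A \<Longrightarrow> cnorm A (c \<odot> x) = cmod c * cnorm A x"
    and cnorm_mult:
      "\<lbrakk>x \<in> carrier A; y \<in> carrier A\<rbrakk> \<Longrightarrow> cnorm A (x \<otimes> y) \<le> cnorm A x * cnorm A y"
    and cstar_identity: "x \<in> carrier A \<Longrightarrow> cnorm A (star A x \<otimes> x) = (cnorm A x)\<^sup>2"
    and complete: "Metric_space.mcomplete (carrier A) (cdist A)"

definition ctopology :: "'a cstar \<Rightarrow> 'a topology" where
  "ctopology A = Metric_space.mtopology (carrier A) (cdist A)"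

definition separable_cstar :: "'a cstar \<Rightarrow> bool" where
  "separable_cstar A \<longleftrightarrow>
     (\<exists>S \<subseteq> carrier A. countable S \<and> ctopology A closure_of S = carrier A)"

text \<open>In a unital algebra every two-sided ring ideal is a complex subspace.\<close>

definition closed_ideal :: "'a set \<Rightarrow> 'a cstar \<Rightarrow> bool" where
  "closed_ideal I A \<longleftrightarrow> ideal I A \<and> closedin (ctopology A) I"

text \<open>Unital *-homomorphisms; \<^const>\<open>Ring.ring_hom\<close> includes preservation of the unit.\<close>

definition star_hom :: "'a cstar \<Rightarrow> 'b cstar \<Rightarrow> ('a \<Rightarrow> 'b) set" where
  "star_hom A B = {h \<in> Ring.ring_hom A B.
     (\<forall>c. \<forall>x \<in> carrier A. h (c \<odot>\<^bsub>A\<^esub> x) = c \<odot>\<^bsub>B\<^esub> h x) \<and>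
     (\<forall>x \<in> carrier A. h (star A x) = star B (h x))}"

definition star_iso :: "'a cstar \<Rightarrow> 'b cstar \<Rightarrow> ('a \<Rightarrow> 'b) set" where
  "star_iso A B = {h \<in> star_hom A B. bij_betw h (carrier A) (carrier B)}"

text \<open>The unitization \<open>I\<^sup>+\<close> of an ideal of \<open>A\<close>: the pair \<open>(x, c)\<close> stands for \<open>x + c 1\<close>
  with a new unit, also when \<open>I\<close> already has one. The second entry of the maximum is the norm of
  left multiplication by \<open>(x, c)\<close> on \<open>I\<close>. If \<open>I\<close> has no unit, that entry is already the
  C*-norm and dominates \<open>\<bar>c\<bar>\<close>; if \<open>I\<close> has a unit \<open>e\<close>, it is the norm of \<open>x + c e\<close>, and the
  maximum is the norm on the direct sum of \<open>I\<close> with the complex numbers.\<close>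

definition unitization :: "'a cstar \<Rightarrow> 'a set \<Rightarrow> ('a \<times> complex) cstar" where
  "unitization A I =
    \<lparr>carrier = I \<times> UNIV,
     mult = (\<lambda>(x, c) (y, d). (x \<otimes>\<^bsub>A\<^esub> y \<oplus>\<^bsub>A\<^esub> d \<odot>\<^bsub>A\<^esub> x \<oplus>\<^bsub>A\<^esub> c \<odot>\<^bsub>A\<^esub> y, c * d)),
     one = (\<zero>\<^bsub>A\<^esub>, 1),
     zero = (\<zero>\<^bsub>A\<^esub>, 0),
     add = (\<lambda>(x, c) (y, d). (x \<oplus>\<^bsub>A\<^esub> y, c + d)),
     smult = (\<lambda>b (x, c). (b \<odot>\<^bsub>A\<^esub> x, b * c)),
     star = (\<lambda>(x, c). (star A x, cnj c)),
     cnorm = (\<lambda>(x, c). max (cmod c)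
       (SUP y \<in> {y \<in> I. cnorm A y \<le> 1}. cnorm A (x \<otimes>\<^bsub>A\<^esub> y \<oplus>\<^bsub>A\<^esub> c \<odot>\<^bsub>A\<^esub> y)))\<rparr>"


section \<open>Matrix-valued continuous functions\<close>

definition vnorm :: "complex vec \<Rightarrow> real" where
  "vnorm v = sqrt (\<Sum>i<dim_vec v. (cmod (vec_index v i))\<^sup>2)"

definition mat_opnorm :: "complex mat \<Rightarrow> real" where
  "mat_opnorm T = (SUP v \<in> {v \<in> carrier_vec (dim_col T). vnorm v \<le> 1}. vnorm (T *\<^sub>v v))"

text \<open>\<open>C(X, M_n)\<close>. Continuity into the finite-dimensional space of matrices is
  continuity of all entries. The supremum is taken over a set containing 0 to cover empty \<open>X\<close>.\<close>

definition C_mat :: "'x topology \<Rightarrow> nat \<Rightarrow> ('x \<Rightarrow> complex mat) cstar" where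
  "C_mat X n =
    \<lparr>carrier = {f \<in> topspace X \<rightarrow>\<^sub>E carrier_mat n n.
       \<forall>i<n. \<forall>j<n. continuous_map X euclidean (\<lambda>x. f x $$ (i, j))},
     mult = (\<lambda>f g. \<lambda>x\<in>topspace X. f x * g x),
     one = (\<lambda>x\<in>topspace X. 1\<^sub>m n),
     zero = (\<lambda>x\<in>topspace X. 0\<^sub>m n n),
     add = (\<lambda>f g. \<lambda>x\<in>topspace X. f x + g x),
     smult = (\<lambda>c f. \<lambda>x\<in>topspace X. c \<cdot>\<^sub>m f x),
     star = (\<lambda>f. \<lambda>x\<in>topspace X. mat_adjoint (f x)),
     cnorm = (\<lambda>f. Sup (insert 0 ((\<lambda>x. mat_opnorm (f x)) ` topspace X)))\<rparr>"


section \<open>Covering dimension\<close>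

definition covering_dim_le :: "'x topology \<Rightarrow> nat \<Rightarrow> bool" where
  "covering_dim_le X d \<longleftrightarrow>
     (\<forall>\<U>. finite \<U> \<and> (\<forall>U\<in>\<U>. openin X U) \<and> \<Union>\<U> = topspace X \<longrightarrow>
       (\<exists>\<V>. finite \<V> \<and> (\<forall>V\<in>\<V>. openin X V) \<and> \<Union>\<V> = topspace X \<and>
            (\<forall>V\<in>\<V>. \<exists>U\<in>\<U>. V \<subseteq> U) \<and>
            (\<forall>x\<in>topspace X. card {V \<in> \<V>. x \<in> V} \<le> d + 1)))"

text \<open>The infimum of the empty set is \<open>\<infinity>\<close>. The empty space gets dimension 0, not -1.\<close>

definition covering_dim :: "'x topology \<Rightarrow> enat" where
  "covering_dim X = Inf (enat ` {d. covering_dim_le X d})"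


section \<open>Recursive subhomogeneous algebras\<close>

text \<open>The data of an iterated pullback: its length \<open>l\<close>, the spaces \<open>X\<^sub>0, \<dots>, X\<^sub>l\<close>, the matrix
  sizes, the closed subsets \<open>X\<^sub>k\<^sup>(\<^sup>0\<^sup>)\<close> and the homomorphisms into \<open>C(X\<^sub>k\<^sup>(\<^sup>0\<^sup>), M\<^sub>n\<^sub>(\<^sub>k\<^sub>))\<close>
  (the last two for \<open>k \<ge> 1\<close>). An element of the \<open>k\<close>-th stage, an iterated pair
  \<open>(\<dots>(f\<^sub>0, f\<^sub>1), \<dots>, f\<^sub>k)\<close>, is encoded as the function \<open>i \<mapsto> f\<^sub>i\<close> on \<open>{..k}\<close>, so that all
  stages have the same element type.\<close>

record 'x rsh_data =
  len :: nat
  space_at :: "nat \<Rightarrow> 'x topology"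
  msize :: "nat \<Rightarrow> nat"
  attach_set :: "nat \<Rightarrow> 'x set"
  attach_hom :: "nat \<Rightarrow> (nat \<Rightarrow> 'x \<Rightarrow> complex mat) \<Rightarrow> ('x \<Rightarrow> complex mat)"

definition C_at :: "'x rsh_data \<Rightarrow> nat \<Rightarrow> ('x \<Rightarrow> complex mat) cstar" where
  "C_at D k = C_mat (space_at D k) (msize D k)"

definition C0_at :: "'x rsh_data \<Rightarrow> nat \<Rightarrow> ('x \<Rightarrow> complex mat) cstar" where
  "C0_at D k = C_mat (subtopology (space_at D k) (attach_set D k)) (msize D k)"

primrec stage_carrier :: "'x rsh_data \<Rightarrow> nat \<Rightarrow> (nat \<Rightarrow> 'x \<Rightarrow> complex mat) set" where
  "stage_carrier D 0 = {a \<in> extensional {..0}. a 0 \<in> carrier (C_at D 0)}"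
| "stage_carrier D (Suc k) = {a \<in> extensional {..Suc k}.
     restrict a {..k} \<in> stage_carrier D k \<and>
     a (Suc k) \<in> carrier (C_at D (Suc k)) \<and>
     attach_hom D (Suc k) (restrict a {..k}) = restrict (a (Suc k)) (attach_set D (Suc k))}"

definition stage :: "'x rsh_data \<Rightarrow> nat \<Rightarrow> (nat \<Rightarrow> 'x \<Rightarrow> complex mat) cstar" where
  "stage D k =
    \<lparr>carrier = stage_carrier D k,
     mult = (\<lambda>a b. \<lambda>i\<in>{..k}. a i \<otimes>\<^bsub>C_at D i\<^esub> b i),
     one = (\<lambda>i\<in>{..k}. \<one>\<^bsub>C_at D i\<^esub>),
     zero = (\<lambda>i\<in>{..k}. \<zero>\<^bsub>C_at D i\<^esub>),
     add = (\<lambda>a b. \<lambda>i\<in>{..k}. a i \<oplus>\<^bsub>C_at D i\<^esub> b i),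
     smult = (\<lambda>c a. \<lambda>i\<in>{..k}. c \<odot>\<^bsub>C_at D i\<^esub> a i),
     star = (\<lambda>a. \<lambda>i\<in>{..k}. star (C_at D i) (a i)),
     cnorm = (\<lambda>a. Max ((\<lambda>i. cnorm (C_at D i) (a i)) ` {..k}))\<rparr>"

definition valid_rsh_data :: "'x rsh_data \<Rightarrow> bool" where
  "valid_rsh_data D \<longleftrightarrow>
     (\<forall>k \<le> len D. compact_space (space_at D k) \<and> Hausdorff_space (space_at D k) \<and>
        1 \<le> msize D k) \<and>
     (\<forall>k \<in> {1..len D}. closedin (space_at D k) (attach_set D k) \<and>
        attach_hom D k \<in> star_hom (stage D (k - 1)) (C0_at D k))"

text \<open>\<open>D\<close> is a recursive subhomogeneous decomposition of the C*-algebra \<open>A\<close>. A *-isomorphism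
  of C*-algebras is automatically isometric.\<close>

definition rsh_decomposition :: "'a cstar \<Rightarrow> 'x rsh_data \<Rightarrow> bool" where
  "rsh_decomposition A D \<longleftrightarrow>
     unital_cstar_algebra A \<and> valid_rsh_data D \<and> star_iso A (stage D (len D)) \<noteq> {}"

definition topological_dim :: "'x rsh_data \<Rightarrow> enat" where
  "topological_dim D = Max ((\<lambda>k. covering_dim (space_at D k)) ` {..len D})"

definition max_matrix_size :: "'x rsh_data \<Rightarrow> nat" where
  "max_matrix_size D = Max (msize D ` {..len D})"

end

theory Submission
  imports Defs
begin

text \<open>Write \<open>R\<close> for the iterated pullback over the spaces \<open>X\<^sub>0, \<dots>, X\<^sub>l\<close> with matrix sizes
\<open>n(k)\<close> and attaching maps \<open>\<phi>\<^sub>k\<close>, and regard \<open>I\<close> as an ideal of \<open>R\<close>. Let \<open>F\<^sub>k\<close> be the set of the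
points of \<open>X\<^sub>k\<close> at which the \<open>k\<close>-th components of all elements of \<open>I\<close> vanish. The key fact
(\<open>ideal_approximation\<close>, \<open>mem_ideal_iff_vanishes_on_zero_sets\<close>) is that a closed ideal is
determined by these sets: \<open>b\<close> lies in \<open>I\<close> as soon as \<open>b\<^sub>k\<close> vanishes on \<open>F\<^sub>k\<close> for all \<open>k\<close>. Hence
\<open>x + c 1 \<mapsto> (c, x + c 1)\<close> identifies \<open>I\<^sup>+\<close> with the pairs of a scalar \<open>c\<close> and an element of \<open>R\<close>
that is equal to \<open>c 1\<close> on every \<open>F\<^sub>k\<close>.

Such pairs form an iterated pullback again. Put a one-point space with matrix size 1 in front; it
records the scalar. Keep the spaces \<open>X\<^sub>k\<close> and the sizes \<open>n(k)\<close>, but attach \<open>X\<^sub>k\<close> along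
\<open>F\<^sub>k \<union> X\<^sub>k\<^sup>(\<^sup>0\<^sup>)\<close> by the map that is \<open>c 1\<close> on \<open>F\<^sub>k\<close> and \<open>\<phi>\<^sub>k\<close> on the rest. Since the sets \<open>F\<^sub>k\<close>
are made part of the attaching sets and are not collapsed to points, the only new space is the
added point, and neither the dimension nor the matrix size grows. That both prescriptions agree on
\<open>F\<^sub>k \<inter> X\<^sub>k\<^sup>(\<^sup>0\<^sup>)\<close>, so that the attaching map takes values in continuous functions, follows from
the approximation as well (\<open>attach_hom_scalar_on_zero_set\<close>).

The approximation is proved level by level. Over the part of \<open>X\<^sub>k\<close> outside \<open>X\<^sub>k\<^sup>(\<^sup>0\<^sup>)\<close> an ideal
behaves like an ideal of \<open>C(X, M\<^sub>n)\<close>: matrix units turn an element that does not vanish at a point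
into a function \<open>\<sigma> 1\<close> with \<open>\<sigma>\<close> positive near this point, and compactness adds up finitely many of
these (\<open>C_mat_ideal_approximation\<close>). Functions on \<open>X\<^sub>k\<close> that vanish on \<open>X\<^sub>k\<^sup>(\<^sup>0\<^sup>)\<close> are the
components of elements of \<open>R\<close> by the Tietze theorem (\<open>stage_lift\<close>), so that they can be used as
multipliers.

All the norm estimates between different algebras come from one theorem, that *-homomorphisms of
C*-algebras are contractive (\<open>star_hom_contractive\<close>). It also shows that the stages are complete,
since the condition \<open>\<phi>(a) = \<rho>(f)\<close> is then closed.\<close>

section \<open>Unital C*-algebras: axioms and limits\<close>

lemma cring_class_complex: "cring (class_ring :: complex ring)"
proof -
  interpret field "class_ring :: complex ring" by (rule class_field)
  show ?thesis by unfold_locales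
qed

lemma Metric_space_cdistI:
  fixes A :: "'a cstar" (structure)
  assumes ag: "abelian_group A"
    and nonneg: "\<And>x. x \<in> carrier A \<Longrightarrow> 0 \<le> cnorm A x"
    and eq_0: "\<And>x. x \<in> carrier A \<Longrightarrow> cnorm A x = 0 \<longleftrightarrow> x = \<zero>"
    and triangle: "\<And>x y. x \<in> carrier A \<Longrightarrow> y \<in> carrier A \<Longrightarrow> cnorm A (x \<oplus> y) \<le> cnorm A x + cnorm A y"
    and minus: "\<And>x. x \<in> carrier A \<Longrightarrow> cnorm A (\<ominus> x) = cnorm A x"
  shows "Metric_space (carrier A) (cdist A)"
proof -
  interpret abelian_group A by (rule ag)
  have sym: "cdist A x y = cdist A y x" for x y
  proof (cases "x \<in> carrier A \<and> y \<in> carrier A")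
    case True
    then have "y \<ominus> x = \<ominus> (x \<ominus> y)"
      by (simp add: a_minus_def minus_add a_comm)
    then show ?thesis using True minus[of "x \<ominus> y"] by (simp add: cdist_def)
  qed (auto simp: cdist_def)
  have tri: "cdist A x z \<le> cdist A x y + cdist A y z"
    if "x \<in> carrier A" "y \<in> carrier A" "z \<in> carrier A" for x y z
  proof -
    have "x \<ominus> z = (x \<ominus> y) \<oplus> (y \<ominus> z)"
      using that by (simp add: a_minus_def a_assoc r_neg1)
    then show ?thesis using that triangle[of "x \<ominus> y" "y \<ominus> z"] by (simp add: cdist_def)
  qed
  have zero_iff: "cdist A x y = 0 \<longleftrightarrow> x = y" if "x \<in> carrier A" "y \<in> carrier A" for x y
    using that by (simp add: cdist_def eq_0)
  show ?thesis
    by standard (use zero_iff sym tri nonneg in \<open>auto simp: cdist_def\<close>)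
qed

text \<open>The conditions are those that have to be checked by computation in a concrete algebra: the
additive inverse is \<open>(-1) x\<close>, and completeness is stated with sequences, so that neither the
derived operation \<open>\<ominus>\<close> nor the metric topology has to be unfolded.\<close>

lemma unital_cstar_algebraI:
  fixes A :: "'a cstar" (structure)
  assumes zero: "\<zero> \<in> carrier A" and one: "\<one> \<in> carrier A"
    and add: "\<And>x y. x \<in> carrier A \<Longrightarrow> y \<in> carrier A \<Longrightarrow> x \<oplus> y \<in> carrier A"
    and mult: "\<And>x y. x \<in> carrier A \<Longrightarrow> y \<in> carrier A \<Longrightarrow> x \<otimes> y \<in> carrier A"
    and smult: "\<And>c x. x \<in> carrier A \<Longrightarrow> c \<odot> x \<in> carrier A"
    and star: "\<And>x. x \<in> carrier A \<Longrightarrow> star A x \<in> carrier A"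
    and add_assoc: "\<And>x y z. x \<in> carrier A \<Longrightarrow> y \<in> carrier A \<Longrightarrow> z \<in> carrier A \<Longrightarrow> (x \<oplus> y) \<oplus> z = x \<oplus> (y \<oplus> z)"
    and add_comm: "\<And>x y. x \<in> carrier A \<Longrightarrow> y \<in> carrier A \<Longrightarrow> x \<oplus> y = y \<oplus> x"
    and add_zero: "\<And>x. x \<in> carrier A \<Longrightarrow> \<zero> \<oplus> x = x"
    and add_inv: "\<And>x. x \<in> carrier A \<Longrightarrow> (-1) \<odot> x \<oplus> x = \<zero>"
    and mult_assoc: "\<And>x y z. x \<in> carrier A \<Longrightarrow> y \<in> carrier A \<Longrightarrow> z \<in> carrier A \<Longrightarrow> (x \<otimes> y) \<otimes> z = x \<otimes> (y \<otimes> z)"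
    and mult_one_left: "\<And>x. x \<in> carrier A \<Longrightarrow> \<one> \<otimes> x = x"
    and mult_one_right: "\<And>x. x \<in> carrier A \<Longrightarrow> x \<otimes> \<one> = x"
    and distr_left: "\<And>x y z. x \<in> carrier A \<Longrightarrow> y \<in> carrier A \<Longrightarrow> z \<in> carrier A \<Longrightarrow> (x \<oplus> y) \<otimes> z = x \<otimes> z \<oplus> y \<otimes> z"
    and distr_right: "\<And>x y z. x \<in> carrier A \<Longrightarrow> y \<in> carrier A \<Longrightarrow> z \<in> carrier A \<Longrightarrow> z \<otimes> (x \<oplus> y) = z \<otimes> x \<oplus> z \<otimes> y"
    and smult_distr_left: "\<And>c d x. x \<in> carrier A \<Longrightarrow> (c + d) \<odot> x = c \<odot> x \<oplus> d \<odot> x"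
    and smult_distr_right: "\<And>c x y. x \<in> carrier A \<Longrightarrow> y \<in> carrier A \<Longrightarrow> c \<odot> (x \<oplus> y) = c \<odot> x \<oplus> c \<odot> y"
    and smult_assoc: "\<And>c d x. x \<in> carrier A \<Longrightarrow> (c * d) \<odot> x = c \<odot> (d \<odot> x)"
    and smult_one: "\<And>x. x \<in> carrier A \<Longrightarrow> 1 \<odot> x = x"
    and smult_mult_left: "\<And>c x y. x \<in> carrier A \<Longrightarrow> y \<in> carrier A \<Longrightarrow> (c \<odot> x) \<otimes> y = c \<odot> (x \<otimes> y)"
    and smult_mult_right: "\<And>c x y. x \<in> carrier A \<Longrightarrow> y \<in> carrier A \<Longrightarrow> x \<otimes> (c \<odot> y) = c \<odot> (x \<otimes> y)"
    and star_star: "\<And>x. x \<in> carrier A \<Longrightarrow> star A (star A x) = x"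
    and star_add: "\<And>x y. x \<in> carrier A \<Longrightarrow> y \<in> carrier A \<Longrightarrow> star A (x \<oplus> y) = star A x \<oplus> star A y"
    and star_smult: "\<And>c x. x \<in> carrier A \<Longrightarrow> star A (c \<odot> x) = cnj c \<odot> star A x"
    and star_mult: "\<And>x y. x \<in> carrier A \<Longrightarrow> y \<in> carrier A \<Longrightarrow> star A (x \<otimes> y) = star A y \<otimes> star A x"
    and norm_nonneg: "\<And>x. x \<in> carrier A \<Longrightarrow> 0 \<le> cnorm A x"
    and norm_eq_0: "\<And>x. x \<in> carrier A \<Longrightarrow> cnorm A x = 0 \<longleftrightarrow> x = \<zero>"
    and norm_triangle: "\<And>x y. x \<in> carrier A \<Longrightarrow> y \<in> carrier A \<Longrightarrow> cnorm A (x \<oplus> y) \<le> cnorm A x + cnorm A y"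
    and norm_smult: "\<And>c x. x \<in> carrier A \<Longrightarrow> cnorm A (c \<odot> x) = cmod c * cnorm A x"
    and norm_mult: "\<And>x y. x \<in> carrier A \<Longrightarrow> y \<in> carrier A \<Longrightarrow> cnorm A (x \<otimes> y) \<le> cnorm A x * cnorm A y"
    and cstar: "\<And>x. x \<in> carrier A \<Longrightarrow> cnorm A (star A x \<otimes> x) = (cnorm A x)\<^sup>2"
    and complete: "\<And>\<sigma> :: nat \<Rightarrow> 'a. \<lbrakk>\<And>n. \<sigma> n \<in> carrier A;
        \<And>e. e > 0 \<Longrightarrow> \<exists>N. \<forall>m\<ge>N. \<forall>n\<ge>N. cnorm A (\<sigma> m \<oplus> (-1) \<odot> \<sigma> n) < e\<rbrakk>
        \<Longrightarrow> \<exists>x\<in>carrier A. \<forall>e>0. \<exists>N. \<forall>n\<ge>N. cnorm A (\<sigma> n \<oplus> (-1) \<odot> x) < e"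
  shows "unital_cstar_algebra A"
proof -
  have ag: "abelian_group A"
  proof (rule abelian_groupI)
    show "\<exists>y\<in>carrier A. y \<oplus> x = \<zero>" if "x \<in> carrier A" for x
      using add_inv[OF that] smult[OF that] by blast
  qed (use zero add add_assoc add_comm add_zero in auto)
  have mon: "Group.monoid A"
    by (rule Group.monoidI) (use one mult mult_assoc mult_one_left mult_one_right in auto)
  have ring: "ring A"
    by (rule ringI[OF ag mon]) (use distr_left distr_right in auto)
  have mod: "Module.module (class_ring :: complex ring) A"
    by (rule Module.moduleI[OF cring_class_complex ag])
       (use smult smult_distr_left smult_distr_right smult_assoc smult_one in auto)
  interpret ring A by (rule ring)
  interpret M: Module.module "class_ring :: complex ring" A by (rule mod)
  have minus: "x \<ominus> y = x \<oplus> (-1) \<odot> y" if "x \<in> carrier A" "y \<in> carrier A" for x y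
    using that by (simp add: a_minus_def add_inv minus_equality smult)
  have dist: "cdist A x y = cnorm A (x \<oplus> (-1) \<odot> y)" if "x \<in> carrier A" "y \<in> carrier A" for x y
    using that by (simp add: cdist_def minus)
  have "cnorm A (\<ominus> x) = cnorm A x" if "x \<in> carrier A" for x
    using minus_equality[OF add_inv[OF that] that smult[OF that]] norm_smult[OF that, of "-1"] by simp
  then have ms: "Metric_space (carrier A) (cdist A)"
    by (intro Metric_space_cdistI ag norm_nonneg norm_eq_0 norm_triangle)
  interpret D: Metric_space "carrier A" "cdist A" by (rule ms)
  have "D.mcomplete"
    unfolding D.mcomplete_def
  proof (intro allI impI)
    fix \<sigma> assume C: "D.MCauchy \<sigma>"
    then have in_c: "\<sigma> n \<in> carrier A" for n by (auto simp: D.MCauchy_def)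
    have "\<exists>N. \<forall>m\<ge>N. \<forall>n\<ge>N. cnorm A (\<sigma> m \<oplus> (-1) \<odot> \<sigma> n) < e" if "e > 0" for e
      using C that unfolding D.MCauchy_def by (metis dist in_c)
    from complete[of \<sigma>, OF in_c this] obtain x where x: "x \<in> carrier A"
      and lim: "\<And>e. e>0 \<Longrightarrow> \<exists>N. \<forall>n\<ge>N. cnorm A (\<sigma> n \<oplus> (-1) \<odot> x) < e" by blast
    have "limitin D.mtopology \<sigma> x sequentially"
      unfolding D.limit_metric_sequentially using x lim in_c dist by simp
    then show "\<exists>x. limitin D.mtopology \<sigma> x sequentially" by blast
  qed
  then show ?thesis
    by (intro unital_cstar_algebra.intro ring mod unital_cstar_algebra_axioms.intro)
       (auto simp: smult_mult_left smult_mult_right star star_star star_add star_smult star_mult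
         norm_nonneg norm_eq_0 norm_triangle norm_smult norm_mult cstar)
qed

context unital_cstar_algebra
begin

lemma is_ring: "ring A"
  by unfold_locales

lemmas ring_simps = ring.ring_simprules[OF is_ring]
lemmas mult_assoc = monoid.m_assoc[OF ring.is_monoid[OF is_ring]]
lemmas add_assoc = ring.ring_simprules(7)[OF is_ring]
lemmas add_comm = ring.ring_simprules(10)[OF is_ring]
lemmas distrib_right = ring.ring_simprules(13)[OF is_ring]
lemmas distrib_left = ring.ring_simprules(23)[OF is_ring]

lemma smult_in [simp, intro]: "x \<in> carrier A \<Longrightarrow> c \<odot> x \<in> carrier A"
  using smult_closed by simp

lemmas star_in [simp, intro] = star_closed

lemma smult_add: "x \<in> carrier A \<Longrightarrow> (c + d) \<odot> x = c \<odot> x \<oplus> d \<odot> x"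
  using smult_l_distr by simp

lemma smult_distrib: "x \<in> carrier A \<Longrightarrow> y \<in> carrier A \<Longrightarrow> c \<odot> (x \<oplus> y) = c \<odot> x \<oplus> c \<odot> y"
  using smult_r_distr by simp

lemma smult_smult: "x \<in> carrier A \<Longrightarrow> c \<odot> (d \<odot> x) = (c * d) \<odot> x"
  using smult_assoc1 by simp

lemma one_smult [simp]: "x \<in> carrier A \<Longrightarrow> 1 \<odot> x = x"
  using smult_one by simp

lemma zero_smult [simp]: "x \<in> carrier A \<Longrightarrow> 0 \<odot> x = \<zero>"
  using smult_l_null by simp

lemma minus_eq_smult: "y \<in> carrier A \<Longrightarrow> \<ominus> y = (-1) \<odot> y"
  using smult_add[of y "-1" 1] abelian_group.minus_equality[OF ring.is_abelian_group[OF is_ring], of "(-1) \<odot> y" y] by simp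

lemma diff_eq_smult: "x \<in> carrier A \<Longrightarrow> y \<in> carrier A \<Longrightarrow> x \<ominus> y = x \<oplus> (-1) \<odot> y"
  by (simp add: a_minus_def minus_eq_smult)

lemma star_zero [simp]: "star A \<zero> = \<zero>"
  using star_smult[of \<zero> 0] by simp

lemma star_one [simp]: "star A \<one> = \<one>"
proof -
  have "star A (star A \<one> \<otimes> \<one>) = star A \<one> \<otimes> star A (star A \<one>)"
    by (rule star_mult) auto
  then show ?thesis by (simp add: star_star)
qed

lemma star_diff: "x \<in> carrier A \<Longrightarrow> y \<in> carrier A \<Longrightarrow> star A (x \<ominus> y) = star A x \<ominus> star A y"
  by (simp add: diff_eq_smult star_add star_smult)

lemma cnorm_zero [simp]: "cnorm A \<zero> = 0"
  by (simp add: cnorm_eq_0)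

lemma cnorm_star [simp]:
  assumes x: "x \<in> carrier A" shows "cnorm A (star A x) = cnorm A x"
proof -
  have le: "cnorm A y \<le> cnorm A (star A y)" if y: "y \<in> carrier A" for y
  proof (cases "cnorm A y = 0")
    case False
    have "(cnorm A y)\<^sup>2 \<le> cnorm A (star A y) * cnorm A y"
      using cstar_identity[OF y] cnorm_mult[of "star A y" y] y by simp
    with False show ?thesis
      using cnorm_nonneg[OF y] by (simp add: power2_eq_square)
  qed (use cnorm_nonneg y in simp)
  from le[of x] le[of "star A x"] x show ?thesis by (simp add: star_star)
qed

text \<open>The C*-identity makes the norm of the unit idempotent; the value 0 occurs in the zero algebra.\<close>

lemma cnorm_one_le: "cnorm A \<one> \<le> 1"
proof -
  have "cnorm A \<one> = (cnorm A \<one>)\<^sup>2" using cstar_identity[of \<one>] by simp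
  then have "cnorm A \<one> = 0 \<or> cnorm A \<one> = 1" by (auto simp: power2_eq_square)
  then show ?thesis by auto
qed

lemma Metric_space_cdist: "Metric_space (carrier A) (cdist A)"
  by (intro Metric_space_cdistI ring.is_abelian_group[OF is_ring] cnorm_nonneg cnorm_eq_0 cnorm_triangle)
    (simp_all add: minus_eq_smult cnorm_smult)

lemma cnorm_diff_commute:
  "x \<in> carrier A \<Longrightarrow> y \<in> carrier A \<Longrightarrow> cnorm A (x \<ominus> y) = cnorm A (y \<ominus> x)"
  using Metric_space.commute[OF Metric_space_cdist, of x y] by (simp add: cdist_def)

lemma diff_in [simp, intro]: "x \<in> carrier A \<Longrightarrow> y \<in> carrier A \<Longrightarrow> x \<ominus> y \<in> carrier A"
  by (simp add: diff_eq_smult)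

lemma cnorm_diff_triangle:
  "x \<in> carrier A \<Longrightarrow> y \<in> carrier A \<Longrightarrow> z \<in> carrier A
    \<Longrightarrow> cnorm A (x \<ominus> z) \<le> cnorm A (x \<ominus> y) + cnorm A (y \<ominus> z)"
  using Metric_space.triangle[OF Metric_space_cdist, of x y z] by (simp add: cdist_def)

lemma diff_eq_zero_iff: "x \<in> carrier A \<Longrightarrow> y \<in> carrier A \<Longrightarrow> x \<ominus> y = \<zero> \<longleftrightarrow> x = y"
  using Metric_space.zero[OF Metric_space_cdist, of x y] cnorm_eq_0[of "x \<ominus> y"] by (simp add: cdist_def)

lemma Cauchy_seq_limit:
  assumes \<sigma>: "\<And>n. \<sigma> n \<in> carrier A"
    and Cauchy: "\<And>e. e > 0 \<Longrightarrow> \<exists>N. \<forall>m\<ge>N. \<forall>n\<ge>N. cnorm A (\<sigma> m \<ominus> \<sigma> n) < e"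
  shows "\<exists>x\<in>carrier A. (\<lambda>n. cnorm A (\<sigma> n \<ominus> x)) \<longlonglongrightarrow> 0"
proof -
  interpret D: Metric_space "carrier A" "cdist A" by (rule Metric_space_cdist)
  have "D.MCauchy \<sigma>"
    using \<sigma> Cauchy by (auto simp: D.MCauchy_def cdist_def)
  then obtain x where x: "limitin D.mtopology \<sigma> x sequentially"
    using complete unfolding D.mcomplete_def by blast
  then have "x \<in> carrier A"
    by (simp add: D.limit_metric_sequentially)
  moreover have "(\<lambda>n. cnorm A (\<sigma> n \<ominus> x)) \<longlonglongrightarrow> 0"
    unfolding LIMSEQ_iff
  proof (intro allI impI)
    fix r :: real assume "0 < r"
    then obtain N where "\<And>n. n \<ge> N \<Longrightarrow> cdist A (\<sigma> n) x < r"
      using x unfolding D.limit_metric_sequentially by blast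
    then show "\<exists>no. \<forall>n\<ge>no. norm (cnorm A (\<sigma> n \<ominus> x) - 0) < r"
      using \<sigma> \<open>x \<in> carrier A\<close> by (intro exI[of _ N]) (simp add: cdist_def cnorm_nonneg)
  qed
  ultimately show ?thesis by blast
qed

lemma eq_if_cnorm_le_null_seq:
  assumes "x \<in> carrier A" "y \<in> carrier A" "\<And>n. cnorm A (x \<ominus> y) \<le> b n" "b \<longlonglongrightarrow> 0"
  shows "x = y"
proof -
  have "cnorm A (x \<ominus> y) \<le> 0"
    by (rule LIMSEQ_le_const[OF assms(4)]) (use assms(3) in auto)
  then have "cnorm A (x \<ominus> y) = 0"
    using assms cnorm_nonneg[of "x \<ominus> y"] by simp
  then show ?thesis
    using assms by (simp add: cnorm_eq_0 diff_eq_zero_iff)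
qed

end

section \<open>Square roots and contractivity of *-homomorphisms\<close>

context ring
begin

lemma commuting_diff_squares:
  "\<lbrakk>u \<in> carrier R; v \<in> carrier R; u \<otimes> v = v \<otimes> u\<rbrakk> \<Longrightarrow> (u \<ominus> v) \<otimes> (u \<oplus> v) = u \<otimes> u \<ominus> v \<otimes> v"
  by algebra

lemma mult_diff_right: "\<lbrakk>b \<in> carrier R; u \<in> carrier R; v \<in> carrier R\<rbrakk> \<Longrightarrow> b \<otimes> (u \<ominus> v) = b \<otimes> u \<ominus> b \<otimes> v"
  by algebra

lemma mult_diff_left: "\<lbrakk>b \<in> carrier R; u \<in> carrier R; v \<in> carrier R\<rbrakk> \<Longrightarrow> (u \<ominus> v) \<otimes> b = u \<otimes> b \<ominus> v \<otimes> b"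
  by algebra

lemma add_diff_cancel: "\<lbrakk>b \<in> carrier R; u \<in> carrier R; v \<in> carrier R\<rbrakk> \<Longrightarrow> (b \<oplus> u) \<ominus> (b \<oplus> v) = u \<ominus> v"
  by algebra

lemma mult_sums: "\<lbrakk>a \<in> carrier R; b \<in> carrier R; c \<in> carrier R; d \<in> carrier R\<rbrakk>
    \<Longrightarrow> (a \<oplus> b) \<otimes> (c \<oplus> d) = (a \<otimes> c \<oplus> b \<otimes> c) \<oplus> (a \<otimes> d \<oplus> b \<otimes> d)"
  by algebra

lemma sum_rearrange: "\<lbrakk>a \<in> carrier R; b \<in> carrier R; c \<in> carrier R; d \<in> carrier R\<rbrakk>
    \<Longrightarrow> (a \<oplus> b) \<oplus> (c \<oplus> d) = (b \<oplus> c) \<oplus> (a \<oplus> d)"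
  by algebra

lemma add_diff_cancel_left: "\<lbrakk>u \<in> carrier R; v \<in> carrier R\<rbrakk> \<Longrightarrow> u \<oplus> (v \<ominus> u) = v"
  by algebra

lemma one_minus_square: "y \<in> carrier R \<Longrightarrow> (\<one> \<ominus> y) \<otimes> (\<one> \<ominus> y) = \<one> \<ominus> ((y \<oplus> y) \<ominus> y \<otimes> y)"
proof -
  assume y: "y \<in> carrier R"
  have "(u \<ominus> y) \<ominus> (y \<ominus> z) = u \<ominus> ((y \<oplus> y) \<ominus> z)" if "u \<in> carrier R" "z \<in> carrier R" for u z
    using y that by algebra
  then show ?thesis using y by (simp add: mult_diff_left mult_diff_right)
qed

lemma add_diff_cancel_right: "\<lbrakk>u \<in> carrier R; v \<in> carrier R\<rbrakk> \<Longrightarrow> (u \<oplus> v) \<ominus> v = u"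
  by algebra

end

context unital_cstar_algebra
begin

lemma smult_diff: "x \<in> carrier A \<Longrightarrow> y \<in> carrier A \<Longrightarrow> c \<odot> (x \<ominus> y) = c \<odot> x \<ominus> c \<odot> y"
  by (simp add: diff_eq_smult smult_distrib smult_smult)

text \<open>If \<open>s = 1 - y\<close>, the equation \<open>s\<^sup>2 = 1 - x\<close> becomes \<open>y = (x + y\<^sup>2) / 2\<close>, and the right-hand side is
a contraction on self-adjoint elements of norm at most \<open>\<parallel>x\<parallel> < 1\<close> that commute with each other,
because \<open>y\<^sup>2 - z\<^sup>2 = (y - z) (y + z)\<close> for these. This replaces the functional calculus.\<close>

lemma self_adjoint_sqrt_one_minus:
  assumes x: "x \<in> carrier A" "star A x = x" "cnorm A x < 1"
  obtains s where "s \<in> carrier A" "star A s = s" "s \<otimes> s = \<one> \<ominus> x"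
    "\<And>b. b \<in> carrier A \<Longrightarrow> b \<otimes> x = x \<otimes> b \<Longrightarrow> b \<otimes> s = s \<otimes> b"
proof -
  define r where "r = cnorm A x"
  have r: "0 \<le> r" "r < 1" using x by (simp_all add: r_def cnorm_nonneg)
  define f where "f = (\<lambda>y. (1/2) \<odot> (x \<oplus> y \<otimes> y))"
  \<comment> \<open>Commuting with the whole commutant of \<open>x\<close> passes to limits and makes the elements of \<open>S\<close>
    commute with each other.\<close>
  define S where "S = {y \<in> carrier A. star A y = y \<and> cnorm A y \<le> r \<and>
    (\<forall>b\<in>carrier A. b \<otimes> x = x \<otimes> b \<longrightarrow> b \<otimes> y = y \<otimes> b)}"
  have S_carrier: "y \<in> carrier A" if "y \<in> S" for y using that by (simp add: S_def)
  have S_star: "star A y = y" and S_norm: "cnorm A y \<le> r" if "y \<in> S" for y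
    using that unfolding S_def by blast+
  have S_comm: "b \<otimes> w = w \<otimes> b" if "w \<in> S" "b \<in> carrier A" "b \<otimes> x = x \<otimes> b" for w b
    using that unfolding S_def by blast
  have S_commute: "y \<otimes> z = z \<otimes> y" if "y \<in> S" "z \<in> S" for y z
  proof -
    have "z \<otimes> x = x \<otimes> z" using S_comm[OF that(2) x(1) refl] by (rule sym)
    then show ?thesis
      using S_comm[OF that(1) S_carrier[OF that(2)]] by simp
  qed
  have f_carrier: "f y \<in> carrier A" if "y \<in> carrier A" for y
    using that x by (simp add: f_def)
  have f_S: "f y \<in> S" if y: "y \<in> S" for y
  proof -
    have "cnorm A (f y) \<le> r"
    proof -
      have "cnorm A (f y) = 1/2 * cnorm A (x \<oplus> y \<otimes> y)"
        using y x by (simp add: f_def cnorm_smult S_carrier)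
      also have "\<dots> \<le> 1/2 * (cnorm A x + cnorm A (y \<otimes> y))"
        using y x by (intro mult_left_mono cnorm_triangle) (auto simp: S_carrier)
      also have "cnorm A (y \<otimes> y) \<le> cnorm A y * cnorm A y"
        using y by (intro cnorm_mult) (auto simp: S_carrier)
      also have "\<dots> \<le> r * 1"
        using S_norm[OF y] r cnorm_nonneg[OF S_carrier[OF y]] by (intro mult_mono) auto
      finally show ?thesis by (simp add: r_def)
    qed
    moreover have "star A (f y) = f y"
      using y x by (simp add: f_def star_smult star_add star_mult S_star S_carrier)
    moreover have "b \<otimes> f y = f y \<otimes> b" if b: "b \<in> carrier A" "b \<otimes> x = x \<otimes> b" for b
    proof -
      have bcomm: "b \<otimes> y = y \<otimes> b" using S_comm[OF y b] .
      have "b \<otimes> (y \<otimes> y) = (y \<otimes> b) \<otimes> y"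
        using b(1) S_carrier[OF y] by (simp only: mult_assoc[symmetric] bcomm)
      also have "\<dots> = (y \<otimes> y) \<otimes> b"
        using b(1) S_carrier[OF y] by (simp only: mult_assoc bcomm)
      finally have byy: "b \<otimes> (y \<otimes> y) = (y \<otimes> y) \<otimes> b" .
      have "b \<otimes> f y = (1/2) \<odot> (b \<otimes> x \<oplus> b \<otimes> (y \<otimes> y))"
        using b x S_carrier[OF y] by (simp add: f_def smult_mult_right distrib_left)
      also have "\<dots> = f y \<otimes> b"
        unfolding b(2) byy using b(1) x S_carrier[OF y] by (simp add: f_def smult_mult_left distrib_right)
      finally show ?thesis .
    qed
    ultimately show ?thesis
      unfolding S_def using f_carrier[OF S_carrier[OF y]] by blast
  qed
  have contract: "cnorm A (f y \<ominus> f z) \<le> r * cnorm A (y \<ominus> z)" if yz: "y \<in> S" "z \<in> S" for y z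
  proof -
    have "f y \<ominus> f z = (1/2) \<odot> ((y \<ominus> z) \<otimes> (y \<oplus> z))"
      using yz x S_commute[OF yz]
      by (simp add: f_def smult_diff[symmetric] S_carrier ring.add_diff_cancel[OF is_ring]
          ring.commuting_diff_squares[OF is_ring])
    then have "cnorm A (f y \<ominus> f z) = 1/2 * cnorm A ((y \<ominus> z) \<otimes> (y \<oplus> z))"
      using yz by (simp add: cnorm_smult S_carrier)
    also have "\<dots> \<le> 1/2 * (cnorm A (y \<ominus> z) * cnorm A (y \<oplus> z))"
      using yz by (intro mult_left_mono cnorm_mult) (auto simp: S_carrier)
    also have "\<dots> \<le> 1/2 * (cnorm A (y \<ominus> z) * (r + r))"
    proof (intro mult_left_mono)
      show "cnorm A (y \<oplus> z) \<le> r + r"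
        using cnorm_triangle[of y z] S_norm[OF yz(1)] S_norm[OF yz(2)] yz by (simp add: S_carrier)
    qed (use yz in \<open>auto simp: S_carrier cnorm_nonneg\<close>)
    finally show ?thesis by (simp add: mult.commute)
  qed
  \<comment> \<open>The iterates of \<open>f\<close> converge as in the Banach fixed point theorem, and each condition in \<open>S\<close> is
    closed, so that the limit stays in \<open>S\<close>.\<close>
  define \<sigma> where "\<sigma> = (\<lambda>n. (f ^^ n) \<zero>)"
  have "\<zero> \<in> S" using r x by (auto simp: S_def ring_simps)
  then have \<sigma>S: "\<sigma> n \<in> S" for n
    by (induction n) (simp_all add: \<sigma>_def f_S)
  have step: "cnorm A (\<sigma> (n + k) \<ominus> \<sigma> n) \<le> r ^ n" for n k
  proof (induction n)
    case 0
    have "cnorm A (\<sigma> k \<ominus> \<zero>) = cnorm A (\<sigma> k)"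
      using \<sigma>S S_carrier by (simp add: diff_eq_smult)
    also have "\<dots> \<le> 1" using S_norm[OF \<sigma>S[of k]] r by simp
    finally show ?case by (simp add: \<sigma>_def)
  next
    case (Suc n)
    have "cnorm A (\<sigma> (Suc n + k) \<ominus> \<sigma> (Suc n)) \<le> r * cnorm A (\<sigma> (n + k) \<ominus> \<sigma> n)"
      using contract[OF \<sigma>S \<sigma>S, of "n+k" n] by (simp add: \<sigma>_def)
    also have "\<dots> \<le> r * r ^ n" using Suc r by (intro mult_left_mono) auto
    finally show ?case by simp
  qed
  have "\<exists>y\<in>carrier A. (\<lambda>n. cnorm A (\<sigma> n \<ominus> y)) \<longlonglongrightarrow> 0"
  proof (rule Cauchy_seq_limit)
    show "\<sigma> n \<in> carrier A" for n using \<sigma>S S_carrier by blast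
    show "\<exists>N. \<forall>m\<ge>N. \<forall>n\<ge>N. cnorm A (\<sigma> m \<ominus> \<sigma> n) < e" if e: "e > 0" for e
    proof -
      obtain N where N: "r ^ N < e / 2"
        using r e real_arch_pow_inv[of "e/2" r] by auto
      have "cnorm A (\<sigma> m \<ominus> \<sigma> n) < e" if mn: "m \<ge> N" "n \<ge> N" for m n
      proof -
        have "cnorm A (\<sigma> m \<ominus> \<sigma> n) \<le> cnorm A (\<sigma> m \<ominus> \<sigma> N) + cnorm A (\<sigma> n \<ominus> \<sigma> N)"
          using cnorm_diff_triangle[of "\<sigma> m" "\<sigma> N" "\<sigma> n"] cnorm_diff_commute[of "\<sigma> N" "\<sigma> n"]
            \<sigma>S S_carrier by simp
        also have "\<dots> \<le> r ^ N + r ^ N"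
          using step[of N "m - N"] step[of N "n - N"] mn by (intro add_mono) auto
        finally show ?thesis using N by simp
      qed
      then show ?thesis by blast
    qed
  qed
  then obtain y where y: "y \<in> carrier A" and lim: "(\<lambda>n. cnorm A (\<sigma> n \<ominus> y)) \<longlonglongrightarrow> 0"
    by blast
  have \<sigma>c: "\<sigma> n \<in> carrier A" for n using \<sigma>S S_carrier by blast
  have "star A y = y"
  proof (rule eq_if_cnorm_le_null_seq)
    show "cnorm A (star A y \<ominus> y) \<le> cnorm A (\<sigma> n \<ominus> y) + cnorm A (\<sigma> n \<ominus> y)" for n
    proof -
      have "cnorm A (star A y \<ominus> \<sigma> n) = cnorm A (star A (y \<ominus> \<sigma> n))"
        using \<sigma>c[of n] y by (simp add: star_diff S_star \<sigma>S del: cnorm_star)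
      also have "\<dots> = cnorm A (\<sigma> n \<ominus> y)"
        using y \<sigma>c by (simp add: cnorm_diff_commute)
      finally show ?thesis
        using cnorm_diff_triangle[of "star A y" "\<sigma> n" y] y \<sigma>c by simp
    qed
    show "(\<lambda>n. cnorm A (\<sigma> n \<ominus> y) + cnorm A (\<sigma> n \<ominus> y)) \<longlonglongrightarrow> 0"
      using tendsto_add[OF lim lim] by simp
  qed (use y in auto)
  moreover have "cnorm A y \<le> r"
  proof (rule LIMSEQ_le_const[of "\<lambda>n. cnorm A (\<sigma> n \<ominus> y) + r"])
    show "(\<lambda>n. cnorm A (\<sigma> n \<ominus> y) + r) \<longlonglongrightarrow> r"
      using tendsto_add[OF lim tendsto_const[of r]] by simp
    have "cnorm A y \<le> cnorm A (\<sigma> n \<ominus> y) + r" for n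
    proof -
      have "cnorm A (y \<ominus> \<zero>) \<le> cnorm A (y \<ominus> \<sigma> n) + cnorm A (\<sigma> n \<ominus> \<zero>)"
        using y \<sigma>c by (intro cnorm_diff_triangle) auto
      moreover have "cnorm A (\<sigma> n) \<le> r" using S_norm[OF \<sigma>S[of n]] .
      ultimately show ?thesis
        using y \<sigma>c cnorm_diff_commute[of y "\<sigma> n"] by (simp add: diff_eq_smult)
    qed
    then show "\<exists>N. \<forall>n\<ge>N. cnorm A y \<le> cnorm A (\<sigma> n \<ominus> y) + r" by blast
  qed
  moreover have "b \<otimes> y = y \<otimes> b" if b: "b \<in> carrier A" "b \<otimes> x = x \<otimes> b" for b
  proof (rule eq_if_cnorm_le_null_seq)
    show "cnorm A (b \<otimes> y \<ominus> y \<otimes> b) \<le> 2 * cnorm A b * cnorm A (\<sigma> n \<ominus> y)" for n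
    proof -
      have "b \<otimes> \<sigma> n = \<sigma> n \<otimes> b" using S_comm[OF \<sigma>S[of n] b] .
      moreover have "cnorm A (b \<otimes> y \<ominus> b \<otimes> \<sigma> n) \<le> cnorm A b * cnorm A (\<sigma> n \<ominus> y)"
        using b y \<sigma>c cnorm_mult[of b "y \<ominus> \<sigma> n"] cnorm_diff_commute[of y "\<sigma> n"]
        by (simp add: ring.mult_diff_right[OF is_ring])
      moreover have "cnorm A (\<sigma> n \<otimes> b \<ominus> y \<otimes> b) \<le> cnorm A (\<sigma> n \<ominus> y) * cnorm A b"
        using b y \<sigma>c cnorm_mult[of "\<sigma> n \<ominus> y" b]
        by (simp add: ring.mult_diff_left[OF is_ring])
      ultimately show ?thesis
        using cnorm_diff_triangle[of "b \<otimes> y" "b \<otimes> \<sigma> n" "y \<otimes> b"] b y \<sigma>c by (simp add: mult.commute[of _ "cnorm A b"])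
    qed
    show "(\<lambda>n. 2 * cnorm A b * cnorm A (\<sigma> n \<ominus> y)) \<longlonglongrightarrow> 0"
      using tendsto_mult_left[OF lim, of "2 * cnorm A b"] by simp
  qed (use b y in auto)
  ultimately have yS: "y \<in> S" unfolding S_def using y by blast
  have fix_y: "f y = y"
  proof (rule eq_if_cnorm_le_null_seq)
    show "cnorm A (f y \<ominus> y) \<le> r * cnorm A (\<sigma> n \<ominus> y) + cnorm A (\<sigma> (Suc n) \<ominus> y)" for n
    proof -
      have "cnorm A (f y \<ominus> \<sigma> (Suc n)) \<le> r * cnorm A (\<sigma> n \<ominus> y)"
        using contract[OF yS \<sigma>S[of n]] cnorm_diff_commute[of y "\<sigma> n"] y \<sigma>c by (simp add: \<sigma>_def)
      then show ?thesis
        using cnorm_diff_triangle[of "f y" "\<sigma> (Suc n)" y] y \<sigma>c f_carrier by simp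
    qed
    show "(\<lambda>n. r * cnorm A (\<sigma> n \<ominus> y) + cnorm A (\<sigma> (Suc n) \<ominus> y)) \<longlonglongrightarrow> 0"
      using tendsto_add[OF tendsto_mult_left[OF lim, of r] LIMSEQ_Suc[OF lim]] by simp
  qed (use y f_carrier in auto)
  have "y \<oplus> y = x \<oplus> y \<otimes> y"
  proof -
    have "y \<oplus> y = 2 \<odot> y" using smult_add[of y 1 1] y by simp
    also have "\<dots> = 2 \<odot> f y" by (simp only: fix_y)
    also have "\<dots> = x \<oplus> y \<otimes> y"
      using x y by (simp add: f_def smult_smult)
    finally show ?thesis .
  qed
  then have "(\<one> \<ominus> y) \<otimes> (\<one> \<ominus> y) = \<one> \<ominus> x"
    using x y by (simp add: ring.one_minus_square[OF is_ring] ring.add_diff_cancel_right[OF is_ring])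
  moreover have "star A (\<one> \<ominus> y) = \<one> \<ominus> y"
    using y by (simp add: star_diff S_star yS)
  moreover have "b \<otimes> (\<one> \<ominus> y) = (\<one> \<ominus> y) \<otimes> b" if b: "b \<in> carrier A" "b \<otimes> x = x \<otimes> b" for b
    using S_comm[OF yS b] b(1) y by (simp add: ring.mult_diff_right[OF is_ring] ring.mult_diff_left[OF is_ring])
  ultimately show ?thesis using y that[of "\<one> \<ominus> y"] by simp
qed

end

lemma star_homD:
  assumes "h \<in> star_hom A B"
  shows "\<And>x. x \<in> carrier A \<Longrightarrow> h x \<in> carrier B"
    and "\<And>x y. x \<in> carrier A \<Longrightarrow> y \<in> carrier A \<Longrightarrow> h (x \<oplus>\<^bsub>A\<^esub> y) = h x \<oplus>\<^bsub>B\<^esub> h y"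
    and "\<And>x y. x \<in> carrier A \<Longrightarrow> y \<in> carrier A \<Longrightarrow> h (x \<otimes>\<^bsub>A\<^esub> y) = h x \<otimes>\<^bsub>B\<^esub> h y"
    and "h \<one>\<^bsub>A\<^esub> = \<one>\<^bsub>B\<^esub>"
    and "\<And>c x. x \<in> carrier A \<Longrightarrow> h (c \<odot>\<^bsub>A\<^esub> x) = c \<odot>\<^bsub>B\<^esub> h x"
    and "\<And>x. x \<in> carrier A \<Longrightarrow> h (star A x) = star B (h x)"
  using assms by (auto simp: star_hom_def Ring.ring_hom_def)

lemma star_homI:
  assumes "\<And>x. x \<in> carrier A \<Longrightarrow> h x \<in> carrier B"
    and "\<And>x y. x \<in> carrier A \<Longrightarrow> y \<in> carrier A \<Longrightarrow> h (x \<oplus>\<^bsub>A\<^esub> y) = h x \<oplus>\<^bsub>B\<^esub> h y"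
    and "\<And>x y. x \<in> carrier A \<Longrightarrow> y \<in> carrier A \<Longrightarrow> h (x \<otimes>\<^bsub>A\<^esub> y) = h x \<otimes>\<^bsub>B\<^esub> h y"
    and "h \<one>\<^bsub>A\<^esub> = \<one>\<^bsub>B\<^esub>"
    and "\<And>c x. x \<in> carrier A \<Longrightarrow> h (c \<odot>\<^bsub>A\<^esub> x) = c \<odot>\<^bsub>B\<^esub> h x"
    and "\<And>x. x \<in> carrier A \<Longrightarrow> h (star A x) = star B (h x)"
  shows "h \<in> star_hom A B"
  using assms by (auto simp: star_hom_def Ring.ring_hom_def)

lemma star_hom_comp:
  "f \<in> star_hom A B \<Longrightarrow> g \<in> star_hom B C \<Longrightarrow> (\<lambda>x. g (f x)) \<in> star_hom A C"
  by (rule star_homI) (simp_all add: star_homD)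

lemma star_hom_diff:
  assumes "unital_cstar_algebra A" "unital_cstar_algebra B" "h \<in> star_hom A B"
    and "x \<in> carrier A" "y \<in> carrier A"
  shows "h (x \<ominus>\<^bsub>A\<^esub> y) = h x \<ominus>\<^bsub>B\<^esub> h y"
proof -
  interpret A: unital_cstar_algebra A by fact
  interpret B: unital_cstar_algebra B by fact
  show ?thesis using assms(4,5) star_homD[OF assms(3)]
    by (simp add: A.diff_eq_smult B.diff_eq_smult)
qed

text \<open>A self-adjoint \<open>a\<close> with \<open>\<parallel>a\<parallel> < 1\<close> is the real part of the unitary \<open>u = a + \<i> \<surd>(1 - a\<^sup>2)\<close>. A
unital *-homomorphism maps unitaries to unitaries, which have norm at most 1 by the C*-identity,
and so the real part of the image has norm at most 1.\<close>

lemma star_hom_contractive_self_adjoint: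
  assumes "unital_cstar_algebra A" "unital_cstar_algebra B" and h: "h \<in> star_hom A B"
    and a: "a \<in> carrier A" "star A a = a" "cnorm A a < 1"
  shows "cnorm B (h a) \<le> 1"
proof -
  interpret A: unital_cstar_algebra A by fact
  interpret B: unital_cstar_algebra B by fact
  have "cnorm A (a \<otimes>\<^bsub>A\<^esub> a) \<le> cnorm A a * cnorm A a"
    using a by (simp add: A.cnorm_mult)
  also have "\<dots> \<le> cnorm A a * 1"
    using a A.cnorm_nonneg[of a] by (intro mult_left_mono) auto
  finally have "cnorm A (a \<otimes>\<^bsub>A\<^esub> a) < 1" using a by simp
  then have aa: "a \<otimes>\<^bsub>A\<^esub> a \<in> carrier A" "star A (a \<otimes>\<^bsub>A\<^esub> a) = a \<otimes>\<^bsub>A\<^esub> a" "cnorm A (a \<otimes>\<^bsub>A\<^esub> a) < 1"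
    using a by (simp_all add: A.star_mult)
  obtain s where s: "s \<in> carrier A" "star A s = s" "s \<otimes>\<^bsub>A\<^esub> s = \<one>\<^bsub>A\<^esub> \<ominus>\<^bsub>A\<^esub> a \<otimes>\<^bsub>A\<^esub> a"
    and comm: "\<And>b. b \<in> carrier A \<Longrightarrow> b \<otimes>\<^bsub>A\<^esub> (a \<otimes>\<^bsub>A\<^esub> a) = (a \<otimes>\<^bsub>A\<^esub> a) \<otimes>\<^bsub>A\<^esub> b
      \<Longrightarrow> b \<otimes>\<^bsub>A\<^esub> s = s \<otimes>\<^bsub>A\<^esub> b"
    using A.self_adjoint_sqrt_one_minus[OF aa] by metis
  have as: "s \<otimes>\<^bsub>A\<^esub> a = a \<otimes>\<^bsub>A\<^esub> s"
    by (rule comm[OF a(1), symmetric]) (use a in \<open>simp add: A.mult_assoc\<close>)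
  define u where "u = a \<oplus>\<^bsub>A\<^esub> \<i> \<odot>\<^bsub>A\<^esub> s"
  have u: "u \<in> carrier A" using a s by (simp add: u_def)
  have star_u: "star A u = a \<oplus>\<^bsub>A\<^esub> (- \<i>) \<odot>\<^bsub>A\<^esub> s"
    using a s by (simp add: u_def A.star_add A.star_smult)
  have "star A u \<otimes>\<^bsub>A\<^esub> u = (a \<otimes>\<^bsub>A\<^esub> a \<oplus>\<^bsub>A\<^esub> (- \<i>) \<odot>\<^bsub>A\<^esub> (a \<otimes>\<^bsub>A\<^esub> s)) \<oplus>\<^bsub>A\<^esub>
      (\<i> \<odot>\<^bsub>A\<^esub> (a \<otimes>\<^bsub>A\<^esub> s) \<oplus>\<^bsub>A\<^esub> s \<otimes>\<^bsub>A\<^esub> s)"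
    unfolding star_u unfolding u_def using a(1) s(1)
    by (simp add: ring.mult_sums[OF A.is_ring] A.smult_mult_left A.smult_mult_right A.smult_smult as)
  also have "\<dots> = ((- \<i>) \<odot>\<^bsub>A\<^esub> (a \<otimes>\<^bsub>A\<^esub> s) \<oplus>\<^bsub>A\<^esub> \<i> \<odot>\<^bsub>A\<^esub> (a \<otimes>\<^bsub>A\<^esub> s)) \<oplus>\<^bsub>A\<^esub>
      (a \<otimes>\<^bsub>A\<^esub> a \<oplus>\<^bsub>A\<^esub> s \<otimes>\<^bsub>A\<^esub> s)"
    using a(1) s(1) by (intro ring.sum_rearrange[OF A.is_ring]) auto
  also have "\<dots> = a \<otimes>\<^bsub>A\<^esub> a \<oplus>\<^bsub>A\<^esub> s \<otimes>\<^bsub>A\<^esub> s"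
    using a(1) s(1) by (simp add: A.smult_add[symmetric])
  also have "\<dots> = \<one>\<^bsub>A\<^esub>"
    unfolding s(3) using a(1) by (intro ring.add_diff_cancel_left[OF A.is_ring]) auto
  finally have uu: "star A u \<otimes>\<^bsub>A\<^esub> u = \<one>\<^bsub>A\<^esub>" .
  define v where "v = h u"
  have v: "v \<in> carrier B" using u star_homD[OF h] by (simp add: v_def)
  have "star B v \<otimes>\<^bsub>B\<^esub> v = h (star A u \<otimes>\<^bsub>A\<^esub> u)"
    using u star_homD[OF h] by (simp add: v_def)
  then have "star B v \<otimes>\<^bsub>B\<^esub> v = \<one>\<^bsub>B\<^esub>"
    by (simp add: uu star_homD(4)[OF h])
  then have "(cnorm B v)\<^sup>2 \<le> 1"
    using B.cstar_identity[OF v] B.cnorm_one_le by simp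
  then have norm_v: "cnorm B v \<le> 1"
    using power2_le_imp_le[of "cnorm B v" 1] by simp
  have "u \<oplus>\<^bsub>A\<^esub> star A u = 2 \<odot>\<^bsub>A\<^esub> a"
  proof -
    have "u \<oplus>\<^bsub>A\<^esub> star A u = (\<i> \<odot>\<^bsub>A\<^esub> s \<oplus>\<^bsub>A\<^esub> a) \<oplus>\<^bsub>A\<^esub> (a \<oplus>\<^bsub>A\<^esub> (- \<i>) \<odot>\<^bsub>A\<^esub> s)"
      unfolding star_u unfolding u_def using a(1) s(1) by (simp add: A.add_comm)
    also have "\<dots> = (a \<oplus>\<^bsub>A\<^esub> a) \<oplus>\<^bsub>A\<^esub> (\<i> \<odot>\<^bsub>A\<^esub> s \<oplus>\<^bsub>A\<^esub> (- \<i>) \<odot>\<^bsub>A\<^esub> s)"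
      using a(1) s(1) by (intro ring.sum_rearrange[OF A.is_ring]) auto
    also have "\<dots> = 2 \<odot>\<^bsub>A\<^esub> a"
      using a(1) s(1) A.smult_add[of a 1 1] by (simp add: A.smult_add[symmetric])
    finally show ?thesis .
  qed
  then have "a = (1/2) \<odot>\<^bsub>A\<^esub> (u \<oplus>\<^bsub>A\<^esub> star A u)"
    using a by (simp add: A.smult_smult)
  then have "h a = (1/2) \<odot>\<^bsub>B\<^esub> (v \<oplus>\<^bsub>B\<^esub> star B v)"
    using u star_homD[OF h] by (simp add: v_def)
  then have "cnorm B (h a) \<le> 1/2 * (cnorm B v + cnorm B v)"
    using B.cnorm_triangle[of v "star B v"] v by (simp add: B.cnorm_smult)
  with norm_v show ?thesis by simp
qed

text \<open>Scaling removes the bound on the norm in the self-adjoint case, and the C*-identity reduces the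
general case to the self-adjoint element \<open>x\<^sup>* x\<close>.\<close>

theorem star_hom_contractive:
  assumes A: "unital_cstar_algebra A" and B: "unital_cstar_algebra B" and h: "h \<in> star_hom A B"
    and x: "x \<in> carrier A"
  shows "cnorm B (h x) \<le> cnorm A x"
proof -
  interpret A: unital_cstar_algebra A by fact
  interpret B: unital_cstar_algebra B by fact
  have sa: "cnorm B (h a) \<le> cnorm A a" if a: "a \<in> carrier A" "star A a = a" for a
  proof (rule dense_ge)
    fix t assume t: "cnorm A a < t"
    then have "t > 0" using A.cnorm_nonneg[OF a(1)] by simp
    define b where "b = complex_of_real (1/t) \<odot>\<^bsub>A\<^esub> a"
    have "cnorm A b < 1" "star A b = b" "b \<in> carrier A"
      using a t \<open>t > 0\<close> by (auto simp: b_def A.cnorm_smult A.star_smult field_simps norm_divide)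
    then have "cnorm B (h b) \<le> 1"
      using star_hom_contractive_self_adjoint[OF A B h] by blast
    moreover have "h b = complex_of_real (1/t) \<odot>\<^bsub>B\<^esub> h a"
      using a star_homD[OF h] by (simp add: b_def)
    ultimately show "cnorm B (h a) \<le> t"
      using \<open>t > 0\<close> a star_homD(1)[OF h, of a] by (simp add: B.cnorm_smult field_simps norm_divide)
  qed
  have "(cnorm B (h x))\<^sup>2 = cnorm B (h (star A x \<otimes>\<^bsub>A\<^esub> x))"
    using x star_homD[OF h] by (simp add: B.cstar_identity)
  also have "\<dots> \<le> (cnorm A x)\<^sup>2"
    using sa[of "star A x \<otimes>\<^bsub>A\<^esub> x"] x by (simp add: A.star_mult A.star_star A.cstar_identity)
  finally show ?thesis
    using A.cnorm_nonneg[OF x] by (rule power2_le_imp_le)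
qed

lemma star_iso_inv:
  assumes A: "unital_cstar_algebra A" and h: "h \<in> star_iso A B"
  shows "inv_into (carrier A) h \<in> star_hom B A"
proof -
  interpret A: unital_cstar_algebra A by fact
  have h': "h \<in> star_hom A B" and bij: "bij_betw h (carrier A) (carrier B)"
    using h by (auto simp: star_iso_def)
  note hD = star_homD[OF h']
  let ?g = "inv_into (carrier A) h"
  have gh: "?g (h x) = x" if "x \<in> carrier A" for x
    using bij that by (simp add: bij_betw_inv_into_left)
  have g: "?g y \<in> carrier A" "h (?g y) = y" if "y \<in> carrier B" for y
    using bij that by (auto simp: bij_betw_def inv_into_into bij_betw_inv_into_right f_inv_into_f)
  show ?thesis
  proof (rule star_homI)
    show "?g (x \<oplus>\<^bsub>B\<^esub> y) = ?g x \<oplus>\<^bsub>A\<^esub> ?g y" if "x \<in> carrier B" "y \<in> carrier B" for x y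
      using gh[of "?g x \<oplus>\<^bsub>A\<^esub> ?g y"] g that by (simp add: hD)
    show "?g (x \<otimes>\<^bsub>B\<^esub> y) = ?g x \<otimes>\<^bsub>A\<^esub> ?g y" if "x \<in> carrier B" "y \<in> carrier B" for x y
      using gh[of "?g x \<otimes>\<^bsub>A\<^esub> ?g y"] g that by (simp add: hD)
    show "?g \<one>\<^bsub>B\<^esub> = \<one>\<^bsub>A\<^esub>"
      using gh[of "\<one>\<^bsub>A\<^esub>"] by (simp add: hD)
    show "?g (c \<odot>\<^bsub>B\<^esub> x) = c \<odot>\<^bsub>A\<^esub> ?g x" if "x \<in> carrier B" for c x
      using gh[of "c \<odot>\<^bsub>A\<^esub> ?g x"] g that by (simp add: hD)
    show "?g (star B x) = star A (?g x)" if "x \<in> carrier B" for x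
      using gh[of "star A (?g x)"] g that by (simp add: hD)
  qed (use g in auto)
qed

section \<open>Algebras of families with the supremum norm\<close>

text \<open>The algebras \<open>C(X, M\<^sub>n)\<close> (families over the points of \<open>X\<close>) and the stages of an iterated pullback
(families over the levels) are both unital *-algebras of bounded families with pointwise operations,
closed under uniform limits. All the axioms are inherited from the coordinates; only completeness
uses the closedness, which is the last assumption.\<close>

lemma subproduct_cstar_algebra:
  fixes B :: "'i \<Rightarrow> 'b cstar" and P :: "('i \<Rightarrow> 'b) cstar"
  assumes B: "\<And>i. i \<in> T \<Longrightarrow> unital_cstar_algebra (B i)"
    and in_B: "\<And>a i. a \<in> carrier P \<Longrightarrow> i \<in> T \<Longrightarrow> a i \<in> carrier (B i)"
    and ext: "carrier P \<subseteq> extensional T"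
    and zero: "\<zero>\<^bsub>P\<^esub> = (\<lambda>i\<in>T. \<zero>\<^bsub>B i\<^esub>)" and one: "\<one>\<^bsub>P\<^esub> = (\<lambda>i\<in>T. \<one>\<^bsub>B i\<^esub>)"
    and add: "\<And>a b. a \<oplus>\<^bsub>P\<^esub> b = (\<lambda>i\<in>T. a i \<oplus>\<^bsub>B i\<^esub> b i)"
    and mult: "\<And>a b. a \<otimes>\<^bsub>P\<^esub> b = (\<lambda>i\<in>T. a i \<otimes>\<^bsub>B i\<^esub> b i)"
    and smult: "\<And>c a. c \<odot>\<^bsub>P\<^esub> a = (\<lambda>i\<in>T. c \<odot>\<^bsub>B i\<^esub> a i)"
    and star: "\<And>a. star P a = (\<lambda>i\<in>T. star (B i) (a i))"
    and norm: "\<And>a. a \<in> carrier P \<Longrightarrow> cnorm P a = Sup (insert 0 ((\<lambda>i. cnorm (B i) (a i)) ` T))"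
    and zero_in: "\<zero>\<^bsub>P\<^esub> \<in> carrier P" and one_in: "\<one>\<^bsub>P\<^esub> \<in> carrier P"
    and add_in: "\<And>a b. a \<in> carrier P \<Longrightarrow> b \<in> carrier P \<Longrightarrow> a \<oplus>\<^bsub>P\<^esub> b \<in> carrier P"
    and mult_in: "\<And>a b. a \<in> carrier P \<Longrightarrow> b \<in> carrier P \<Longrightarrow> a \<otimes>\<^bsub>P\<^esub> b \<in> carrier P"
    and smult_in: "\<And>c a. a \<in> carrier P \<Longrightarrow> c \<odot>\<^bsub>P\<^esub> a \<in> carrier P"
    and star_in: "\<And>a. a \<in> carrier P \<Longrightarrow> star P a \<in> carrier P"
    and bdd: "\<And>a. a \<in> carrier P \<Longrightarrow> bdd_above ((\<lambda>i. cnorm (B i) (a i)) ` T)"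
    and lim: "\<And>\<sigma> a. \<lbrakk>\<And>n::nat. \<sigma> n \<in> carrier P; a \<in> (\<Pi>\<^sub>E i\<in>T. carrier (B i));
        \<And>e. e > 0 \<Longrightarrow> \<exists>N. \<forall>n\<ge>N. \<forall>i\<in>T. cnorm (B i) (\<sigma> n i \<ominus>\<^bsub>B i\<^esub> a i) \<le> e\<rbrakk> \<Longrightarrow> a \<in> carrier P"
  shows "unital_cstar_algebra P"
proof -
  note ops = zero one add mult smult star
  have ext': "a \<in> extensional T" if "a \<in> carrier P" for a
    using that ext by blast
  have le: "cnorm (B i) (a i) \<le> cnorm P a" if "a \<in> carrier P" "i \<in> T" for a i
    unfolding norm[OF that(1)] using bdd[OF that(1)] that(2) by (intro cSup_upper) auto
  have nonneg: "0 \<le> cnorm P a" if "a \<in> carrier P" for a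
    unfolding norm[OF that] using bdd[OF that] by (intro cSup_upper) auto
  have leI: "cnorm P a \<le> c" if "a \<in> carrier P" "0 \<le> c" "\<And>i. i \<in> T \<Longrightarrow> cnorm (B i) (a i) \<le> c" for a c
    unfolding norm[OF that(1)] using that by (intro cSup_least) auto
  note BD = unital_cstar_algebra.is_ring[OF B] ring.ring_simprules[OF unital_cstar_algebra.is_ring[OF B]]
  note B' = unital_cstar_algebra.smult_in[OF B] unital_cstar_algebra.star_in[OF B]
  have add_comm: "a \<oplus>\<^bsub>P\<^esub> b = b \<oplus>\<^bsub>P\<^esub> a" if "a \<in> carrier P" "b \<in> carrier P" for a b
    unfolding add by (rule restrict_ext) (use that in_B BD(11) in blast)
  have neg: "(-1) \<odot>\<^bsub>B i\<^esub> x \<oplus>\<^bsub>B i\<^esub> x = \<zero>\<^bsub>B i\<^esub>" if "i \<in> T" "x \<in> carrier (B i)" for i x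
    using unital_cstar_algebra.smult_add[OF B[OF that(1)] that(2), of "-1" 1]
      unital_cstar_algebra.one_smult[OF B[OF that(1)] that(2)] unital_cstar_algebra.zero_smult[OF B[OF that(1)] that(2)] by simp
  have algebra:
    "(a \<oplus>\<^bsub>P\<^esub> b) \<oplus>\<^bsub>P\<^esub> c = a \<oplus>\<^bsub>P\<^esub> (b \<oplus>\<^bsub>P\<^esub> c)"
    "\<zero>\<^bsub>P\<^esub> \<oplus>\<^bsub>P\<^esub> a = a" "(-1) \<odot>\<^bsub>P\<^esub> a \<oplus>\<^bsub>P\<^esub> a = \<zero>\<^bsub>P\<^esub>"
    "(a \<otimes>\<^bsub>P\<^esub> b) \<otimes>\<^bsub>P\<^esub> c = a \<otimes>\<^bsub>P\<^esub> (b \<otimes>\<^bsub>P\<^esub> c)" "\<one>\<^bsub>P\<^esub> \<otimes>\<^bsub>P\<^esub> a = a" "a \<otimes>\<^bsub>P\<^esub> \<one>\<^bsub>P\<^esub> = a"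
    "(a \<oplus>\<^bsub>P\<^esub> b) \<otimes>\<^bsub>P\<^esub> c = a \<otimes>\<^bsub>P\<^esub> c \<oplus>\<^bsub>P\<^esub> b \<otimes>\<^bsub>P\<^esub> c"
    "c \<otimes>\<^bsub>P\<^esub> (a \<oplus>\<^bsub>P\<^esub> b) = c \<otimes>\<^bsub>P\<^esub> a \<oplus>\<^bsub>P\<^esub> c \<otimes>\<^bsub>P\<^esub> b"
    "(s + t) \<odot>\<^bsub>P\<^esub> a = s \<odot>\<^bsub>P\<^esub> a \<oplus>\<^bsub>P\<^esub> t \<odot>\<^bsub>P\<^esub> a" "s \<odot>\<^bsub>P\<^esub> (a \<oplus>\<^bsub>P\<^esub> b) = s \<odot>\<^bsub>P\<^esub> a \<oplus>\<^bsub>P\<^esub> s \<odot>\<^bsub>P\<^esub> b"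
    "(s * t) \<odot>\<^bsub>P\<^esub> a = s \<odot>\<^bsub>P\<^esub> (t \<odot>\<^bsub>P\<^esub> a)" "1 \<odot>\<^bsub>P\<^esub> a = a"
    "(s \<odot>\<^bsub>P\<^esub> a) \<otimes>\<^bsub>P\<^esub> b = s \<odot>\<^bsub>P\<^esub> (a \<otimes>\<^bsub>P\<^esub> b)" "a \<otimes>\<^bsub>P\<^esub> (s \<odot>\<^bsub>P\<^esub> b) = s \<odot>\<^bsub>P\<^esub> (a \<otimes>\<^bsub>P\<^esub> b)"
    "star P (star P a) = a" "star P (a \<oplus>\<^bsub>P\<^esub> b) = star P a \<oplus>\<^bsub>P\<^esub> star P b"
    "star P (s \<odot>\<^bsub>P\<^esub> a) = cnj s \<odot>\<^bsub>P\<^esub> star P a" "star P (a \<otimes>\<^bsub>P\<^esub> b) = star P b \<otimes>\<^bsub>P\<^esub> star P a"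
    if abc: "a \<in> carrier P" "b \<in> carrier P" "c \<in> carrier P" for a b c s t
    using abc
    by - ((rule extensionalityI[of _ T];
        simp add: ops ext' in_B BD(2,3,6,7,8,9,12,13,14,24) B' neg monoid.r_one[OF ring.is_monoid[OF BD(1)]]
          unital_cstar_algebra.smult_add[OF B] unital_cstar_algebra.smult_distrib[OF B]
          unital_cstar_algebra.smult_smult[OF B] unital_cstar_algebra.one_smult[OF B]
          unital_cstar_algebra.smult_mult_left[OF B] unital_cstar_algebra.smult_mult_right[OF B]
          unital_cstar_algebra.star_star[OF B] unital_cstar_algebra.star_add[OF B]
          unital_cstar_algebra.star_smult[OF B] unital_cstar_algebra.star_mult[OF B])+)
  have smult_le: "cnorm P (c \<odot>\<^bsub>P\<^esub> a) \<le> cmod c * cnorm P a" if "a \<in> carrier P" for a c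
  proof (rule leI[OF smult_in[OF that]])
    show "cnorm (B i) ((c \<odot>\<^bsub>P\<^esub> a) i) \<le> cmod c * cnorm P a" if i: "i \<in> T" for i
      using le[OF \<open>a \<in> carrier P\<close> i] i in_B[OF \<open>a \<in> carrier P\<close> i]
      by (simp add: smult unital_cstar_algebra.cnorm_smult[OF B[OF i]] mult_left_mono)
  qed (simp add: nonneg[OF that])
  have diff: "(a \<oplus>\<^bsub>P\<^esub> (-1) \<odot>\<^bsub>P\<^esub> b) i = a i \<ominus>\<^bsub>B i\<^esub> b i"
    if "a \<in> carrier P" "b \<in> carrier P" "i \<in> T" for a b i
    using that by (simp add: add smult in_B unital_cstar_algebra.diff_eq_smult[OF B])
  show ?thesis
  proof (rule unital_cstar_algebraI)
    fix a assume a: "a \<in> carrier P"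
    show "0 \<le> cnorm P a" by (rule nonneg[OF a])
    show "cnorm P a = 0 \<longleftrightarrow> a = \<zero>\<^bsub>P\<^esub>"
    proof
      assume 0: "cnorm P a = 0"
      have "a i = \<zero>\<^bsub>B i\<^esub>" if i: "i \<in> T" for i
        using le[OF a i] 0 unital_cstar_algebra.cnorm_nonneg[OF B[OF i] in_B[OF a i]]
          unital_cstar_algebra.cnorm_eq_0[OF B[OF i] in_B[OF a i]] by simp
      then show "a = \<zero>\<^bsub>P\<^esub>"
        by (intro extensionalityI[of _ T]) (auto simp: zero ext' a)
    next
      assume "a = \<zero>\<^bsub>P\<^esub>"
      then have "cnorm P a \<le> 0"
        by (intro leI a) (auto simp: zero unital_cstar_algebra.cnorm_zero[OF B])
      then show "cnorm P a = 0" using nonneg[OF a] by simp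
    qed
    show "cnorm P (c \<odot>\<^bsub>P\<^esub> a) = cmod c * cnorm P a" for c
    proof (cases "c = 0")
      case True
      then show ?thesis using smult_le[OF a, of c] nonneg[OF smult_in[OF a], of c] by simp
    next
      case False
      have "a = (1/c) \<odot>\<^bsub>P\<^esub> (c \<odot>\<^bsub>P\<^esub> a)"
        using False algebra(11)[OF a a a, of "1/c" c] algebra(12)[OF a a a] by simp
      then have "cnorm P a \<le> cmod (1/c) * cnorm P (c \<odot>\<^bsub>P\<^esub> a)"
        using smult_le[OF smult_in[OF a], of "1/c" c] by simp
      then have "cmod c * cnorm P a \<le> cnorm P (c \<odot>\<^bsub>P\<^esub> a)"
        using False by (simp add: field_simps norm_divide)
      then show ?thesis using smult_le[OF a, of c] by simp
    qed
    show "cnorm P (star P a \<otimes>\<^bsub>P\<^esub> a) = (cnorm P a)\<^sup>2"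
    proof (rule antisym)
      have i: "cnorm (B i) ((star P a \<otimes>\<^bsub>P\<^esub> a) i) = (cnorm (B i) (a i))\<^sup>2" if "i \<in> T" for i
        using that a by (simp add: mult star in_B unital_cstar_algebra.cstar_identity[OF B])
      show "cnorm P (star P a \<otimes>\<^bsub>P\<^esub> a) \<le> (cnorm P a)\<^sup>2"
      proof (rule leI[OF mult_in[OF star_in[OF a] a]])
        show "cnorm (B j) ((star P a \<otimes>\<^bsub>P\<^esub> a) j) \<le> (cnorm P a)\<^sup>2" if j: "j \<in> T" for j
          unfolding i[OF j]
          by (intro power_mono le a j unital_cstar_algebra.cnorm_nonneg[OF B[OF j]] in_B)
      qed simp
      have "cnorm P a \<le> sqrt (cnorm P (star P a \<otimes>\<^bsub>P\<^esub> a))"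
      proof (rule leI[OF a])
        show "cnorm (B j) (a j) \<le> sqrt (cnorm P (star P a \<otimes>\<^bsub>P\<^esub> a))" if j: "j \<in> T" for j
          using le[OF mult_in[OF star_in[OF a] a] j] unfolding i[OF j] by (rule real_le_rsqrt)
      qed (simp add: nonneg[OF mult_in[OF star_in[OF a] a]])
      then show "(cnorm P a)\<^sup>2 \<le> cnorm P (star P a \<otimes>\<^bsub>P\<^esub> a)"
        using nonneg[OF a] nonneg[OF mult_in[OF star_in[OF a] a]]
        power_mono[of "cnorm P a" "sqrt (cnorm P (star P a \<otimes>\<^bsub>P\<^esub> a))" 2] by simp
    qed
    fix b assume b: "b \<in> carrier P"
    show "cnorm P (a \<oplus>\<^bsub>P\<^esub> b) \<le> cnorm P a + cnorm P b"
    proof (rule leI[OF add_in[OF a b]])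
      fix i assume i: "i \<in> T"
      show "cnorm (B i) ((a \<oplus>\<^bsub>P\<^esub> b) i) \<le> cnorm P a + cnorm P b"
        using unital_cstar_algebra.cnorm_triangle[OF B[OF i] in_B[OF a i] in_B[OF b i]]
          le[OF a i] le[OF b i] i by (simp add: add)
    qed (simp add: nonneg a b)
    show "cnorm P (a \<otimes>\<^bsub>P\<^esub> b) \<le> cnorm P a * cnorm P b"
    proof (rule leI[OF mult_in[OF a b]])
      fix i assume i: "i \<in> T"
      have "cnorm (B i) (a i \<otimes>\<^bsub>B i\<^esub> b i) \<le> cnorm (B i) (a i) * cnorm (B i) (b i)"
        by (rule unital_cstar_algebra.cnorm_mult[OF B[OF i] in_B[OF a i] in_B[OF b i]])
      also have "\<dots> \<le> cnorm P a * cnorm P b"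
        by (intro mult_mono le a b i nonneg unital_cstar_algebra.cnorm_nonneg[OF B[OF i]] in_B)
      finally show "cnorm (B i) ((a \<otimes>\<^bsub>P\<^esub> b) i) \<le> cnorm P a * cnorm P b"
        using i by (simp add: mult)
    qed (simp add: nonneg a b)
  next
    fix \<sigma> :: "nat \<Rightarrow> 'i \<Rightarrow> 'b"
    assume \<sigma>: "\<And>n. \<sigma> n \<in> carrier P"
      and Cauchy: "\<And>e. e > 0 \<Longrightarrow> \<exists>N. \<forall>m\<ge>N. \<forall>n\<ge>N. cnorm P (\<sigma> m \<oplus>\<^bsub>P\<^esub> (-1) \<odot>\<^bsub>P\<^esub> \<sigma> n) < e"
    have coord: "cnorm (B i) (\<sigma> m i \<ominus>\<^bsub>B i\<^esub> \<sigma> n i) \<le> cnorm P (\<sigma> m \<oplus>\<^bsub>P\<^esub> (-1) \<odot>\<^bsub>P\<^esub> \<sigma> n)"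
      if "i \<in> T" for i m n
      using le[OF add_in[OF \<sigma>[of m] smult_in[OF \<sigma>[of n], of "-1"]] that] that by (simp add: diff \<sigma>)
    have "\<exists>x\<in>carrier (B i). (\<lambda>n. cnorm (B i) (\<sigma> n i \<ominus>\<^bsub>B i\<^esub> x)) \<longlonglongrightarrow> 0" if i: "i \<in> T" for i
    proof (rule unital_cstar_algebra.Cauchy_seq_limit[OF B[OF i]])
      show "\<sigma> n i \<in> carrier (B i)" for n using \<sigma> i by (rule in_B)
      show "\<exists>N. \<forall>m\<ge>N. \<forall>n\<ge>N. cnorm (B i) (\<sigma> m i \<ominus>\<^bsub>B i\<^esub> \<sigma> n i) < e" if "e > 0" for e
        using Cauchy[OF that] coord[OF i] by (meson order.strict_trans1)
    qed
    then obtain x where x: "\<And>i. i \<in> T \<Longrightarrow> x i \<in> carrier (B i)"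
      and lim_x: "\<And>i. i \<in> T \<Longrightarrow> (\<lambda>n. cnorm (B i) (\<sigma> n i \<ominus>\<^bsub>B i\<^esub> x i)) \<longlonglongrightarrow> 0"
      by metis
    define a where "a = restrict x T"
    \<comment> \<open>Letting \<open>m\<close> tend to infinity in the Cauchy condition makes the pointwise limit uniform.\<close>
    have unif: "\<exists>N. \<forall>n\<ge>N. \<forall>i\<in>T. cnorm (B i) (\<sigma> n i \<ominus>\<^bsub>B i\<^esub> a i) \<le> e" if "e > 0" for e
    proof -
      obtain N where N: "\<And>m n. m \<ge> N \<Longrightarrow> n \<ge> N \<Longrightarrow> cnorm P (\<sigma> m \<oplus>\<^bsub>P\<^esub> (-1) \<odot>\<^bsub>P\<^esub> \<sigma> n) < e"
        using Cauchy[OF \<open>e > 0\<close>] by blast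
      have "cnorm (B i) (\<sigma> n i \<ominus>\<^bsub>B i\<^esub> x i) \<le> e" if n: "n \<ge> N" and i: "i \<in> T" for n i
      proof (rule LIMSEQ_le_const)
        show "(\<lambda>m. e + cnorm (B i) (\<sigma> m i \<ominus>\<^bsub>B i\<^esub> x i)) \<longlonglongrightarrow> e"
          using tendsto_add[OF tendsto_const lim_x[OF i], of e] by simp
        have "cnorm (B i) (\<sigma> n i \<ominus>\<^bsub>B i\<^esub> x i) \<le> e + cnorm (B i) (\<sigma> m i \<ominus>\<^bsub>B i\<^esub> x i)" if m: "m \<ge> N" for m
          using unital_cstar_algebra.cnorm_diff_triangle[OF B[OF i] in_B[OF \<sigma> i] in_B[OF \<sigma> i] x[OF i], of n m]
            coord[OF i, of n m] N[OF n m] by simp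
        then show "\<exists>N. \<forall>m\<ge>N. cnorm (B i) (\<sigma> n i \<ominus>\<^bsub>B i\<^esub> x i) \<le> e + cnorm (B i) (\<sigma> m i \<ominus>\<^bsub>B i\<^esub> x i)"
          by blast
      qed
      then show ?thesis by (auto simp: a_def)
    qed
    have a: "a \<in> carrier P"
      by (rule lim[OF \<sigma> _ unif]) (use x in \<open>auto simp: a_def\<close>)
    have "\<exists>N. \<forall>n\<ge>N. cnorm P (\<sigma> n \<oplus>\<^bsub>P\<^esub> (-1) \<odot>\<^bsub>P\<^esub> a) < e" if "e > 0" for e
    proof -
      obtain N where N: "\<And>n i. n \<ge> N \<Longrightarrow> i \<in> T \<Longrightarrow> cnorm (B i) (\<sigma> n i \<ominus>\<^bsub>B i\<^esub> a i) \<le> e / 2"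
        using unif[of "e/2"] \<open>e > 0\<close> by auto
      have "cnorm P (\<sigma> n \<oplus>\<^bsub>P\<^esub> (-1) \<odot>\<^bsub>P\<^esub> a) \<le> e / 2" if "n \<ge> N" for n
      proof (rule leI[OF add_in[OF \<sigma> smult_in[OF a]]])
        show "cnorm (B i) ((\<sigma> n \<oplus>\<^bsub>P\<^esub> (-1) \<odot>\<^bsub>P\<^esub> a) i) \<le> e / 2" if i: "i \<in> T" for i
          unfolding diff[OF \<sigma> a i] by (rule N[OF \<open>n \<ge> N\<close> i])
      qed (use \<open>e > 0\<close> in simp)
      then show ?thesis using \<open>e > 0\<close> by (intro exI[of _ N]) force
    qed
    then show "\<exists>x\<in>carrier P. \<forall>e>0. \<exists>N. \<forall>n\<ge>N. cnorm P (\<sigma> n \<oplus>\<^bsub>P\<^esub> (-1) \<odot>\<^bsub>P\<^esub> x) < e"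
      using a by blast
  qed (use zero_in one_in add_in mult_in smult_in star_in algebra add_comm in auto)
qed

section \<open>Matrices with the operator norm\<close>

lemma vnorm_L2_set: "vnorm v = L2_set (\<lambda>i. cmod (vec_index v i)) {..<dim_vec v}"
  by (simp add: vnorm_def L2_set_def)

lemma vnorm_nonneg [simp]: "0 \<le> vnorm v"
  by (simp add: vnorm_L2_set)

lemma cmod_index_le_vnorm: "i < dim_vec v \<Longrightarrow> cmod (vec_index v i) \<le> vnorm v"
  unfolding vnorm_L2_set by (rule member_le_L2_set) auto

lemma vnorm_le_sum: "vnorm v \<le> (\<Sum>i<dim_vec v. cmod (vec_index v i))"
  unfolding vnorm_L2_set by (rule L2_set_le_sum) auto

lemma vnorm_add: "v \<in> carrier_vec n \<Longrightarrow> w \<in> carrier_vec n \<Longrightarrow> vnorm (v + w) \<le> vnorm v + vnorm w"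
proof -
  assume vw: "v \<in> carrier_vec n" "w \<in> carrier_vec n"
  have "vnorm (v + w) \<le> L2_set (\<lambda>i. cmod (vec_index v i) + cmod (vec_index w i)) {..<n}"
    using vw unfolding vnorm_L2_set by (auto intro!: L2_set_mono norm_triangle_ineq)
  also have "\<dots> \<le> vnorm v + vnorm w"
    using vw unfolding vnorm_L2_set by (metis L2_set_triangle_ineq carrier_vecD)
  finally show ?thesis .
qed

lemma vnorm_smult: "vnorm (c \<cdot>\<^sub>v v) = cmod c * vnorm v"
proof -
  have "vnorm (c \<cdot>\<^sub>v v) = L2_set (\<lambda>i. cmod c * cmod (vec_index v i)) {..<dim_vec v}"
    unfolding vnorm_L2_set by (intro L2_set_cong) (auto simp: norm_mult)
  then show ?thesis by (simp add: vnorm_L2_set L2_set_right_distrib)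
qed

lemma vnorm_zero [simp]: "vnorm (0\<^sub>v n) = 0"
  by (simp add: vnorm_def)

lemma vnorm_eq_0D: "vnorm v = 0 \<Longrightarrow> v = 0\<^sub>v (dim_vec v)"
  using cmod_index_le_vnorm[of _ v] by (intro eq_vecI) auto

lemma vnorm_unit_vec: "j < n \<Longrightarrow> vnorm (unit_vec n j) = 1"
  by (simp add: vnorm_def if_distrib[of cmod] if_distrib[of "\<lambda>x. x\<^sup>2"] sum.delta cong: if_cong)

lemma index_mult_mat_vec_sum:
  "T \<in> carrier_mat n m \<Longrightarrow> v \<in> carrier_vec m \<Longrightarrow> i < n
    \<Longrightarrow> vec_index (T *\<^sub>v v) i = (\<Sum>j<m. T $$ (i, j) * vec_index v j)"
  by (auto simp: scalar_prod_def atLeast0LessThan)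

lemma vnorm_mult_mat_vec_le_entries:
  assumes T: "T \<in> carrier_mat n n" and v: "v \<in> carrier_vec n"
  shows "vnorm (T *\<^sub>v v) \<le> (\<Sum>i<n. \<Sum>j<n. cmod (T $$ (i, j))) * vnorm v"
proof -
  have "vnorm (T *\<^sub>v v) \<le> (\<Sum>i<n. cmod (vec_index (T *\<^sub>v v) i))"
    using vnorm_le_sum[of "T *\<^sub>v v"] T by simp
  also have "\<dots> \<le> (\<Sum>i<n. \<Sum>j<n. cmod (T $$ (i, j)) * vnorm v)"
  proof (rule sum_mono)
    fix i assume "i \<in> {..<n}"
    then have "cmod (vec_index (T *\<^sub>v v) i) \<le> (\<Sum>j<n. cmod (T $$ (i, j) * vec_index v j))"
      using index_mult_mat_vec_sum[OF T v, of i] norm_sum by auto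
    also have "\<dots> \<le> (\<Sum>j<n. cmod (T $$ (i, j)) * vnorm v)"
      using v by (intro sum_mono) (auto simp: norm_mult intro!: mult_left_mono cmod_index_le_vnorm)
    finally show "cmod (vec_index (T *\<^sub>v v) i) \<le> (\<Sum>j<n. cmod (T $$ (i, j)) * vnorm v)" .
  qed
  finally show ?thesis by (simp add: sum_distrib_right)
qed

lemma mat_opnorm_bdd:
  assumes T: "T \<in> carrier_mat n n"
  shows "bdd_above ((\<lambda>v. vnorm (T *\<^sub>v v)) ` {v \<in> carrier_vec (dim_col T). vnorm v \<le> 1})"
proof (rule bdd_aboveI2)
  fix v assume v: "v \<in> {v \<in> carrier_vec (dim_col T). vnorm v \<le> 1}"
  then have "vnorm (T *\<^sub>v v) \<le> (\<Sum>i<n. \<Sum>j<n. cmod (T $$ (i, j))) * vnorm v"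
    using T by (intro vnorm_mult_mat_vec_le_entries) auto
  also have "\<dots> \<le> (\<Sum>i<n. \<Sum>j<n. cmod (T $$ (i, j))) * 1"
    using v by (intro mult_left_mono) (auto intro!: sum_nonneg)
  finally show "vnorm (T *\<^sub>v v) \<le> (\<Sum>i<n. \<Sum>j<n. cmod (T $$ (i, j))) * 1" .
qed

lemma mat_opnorm_nonneg:
  assumes T: "T \<in> carrier_mat n n" shows "0 \<le> mat_opnorm T"
proof -
  have "vnorm (T *\<^sub>v 0\<^sub>v n) \<le> mat_opnorm T"
    unfolding mat_opnorm_def using T by (intro cSUP_upper mat_opnorm_bdd) auto
  then show ?thesis using vnorm_nonneg order_trans by blast
qed

lemma vnorm_mult_mat_vec_le:
  assumes T: "T \<in> carrier_mat n n" and v: "v \<in> carrier_vec n"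
  shows "vnorm (T *\<^sub>v v) \<le> mat_opnorm T * vnorm v"
proof (cases "vnorm v = 0")
  case True
  then have "v = 0\<^sub>v n" using vnorm_eq_0D[OF True] v by simp
  then have "T *\<^sub>v v = 0\<^sub>v n" using T by auto
  then show ?thesis using True by simp
next
  case False
  then have pos: "vnorm v > 0" using vnorm_nonneg[of v] by linarith
  define w where "w = complex_of_real (1 / vnorm v) \<cdot>\<^sub>v v"
  have w: "w \<in> carrier_vec n" "vnorm w \<le> 1"
    using v pos by (auto simp: w_def vnorm_smult norm_divide)
  have "vnorm (T *\<^sub>v w) \<le> mat_opnorm T"
    unfolding mat_opnorm_def using T w by (intro cSUP_upper mat_opnorm_bdd) auto
  moreover have "T *\<^sub>v w = complex_of_real (1 / vnorm v) \<cdot>\<^sub>v (T *\<^sub>v v)"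
    unfolding w_def using T v by (intro mult_mat_vec)
  ultimately show ?thesis using pos by (simp add: vnorm_smult norm_divide field_simps)
qed

lemma mat_opnorm_leI:
  assumes T: "T \<in> carrier_mat n n" and c: "0 \<le> c"
    and le: "\<And>v. v \<in> carrier_vec n \<Longrightarrow> vnorm (T *\<^sub>v v) \<le> c * vnorm v"
  shows "mat_opnorm T \<le> c"
  unfolding mat_opnorm_def
proof (rule cSUP_least)
  show "{v \<in> carrier_vec (dim_col T). vnorm v \<le> 1} \<noteq> {}"
    by (auto intro!: exI[of _ "0\<^sub>v (dim_col T)"])
  fix v assume v: "v \<in> {v \<in> carrier_vec (dim_col T). vnorm v \<le> 1}"
  then have "vnorm (T *\<^sub>v v) \<le> c * vnorm v" using T by (intro le) auto
  also have "\<dots> \<le> c * 1" using v c by (intro mult_left_mono) auto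
  finally show "vnorm (T *\<^sub>v v) \<le> c" by simp
qed

lemma mat_opnorm_le_entries:
  "T \<in> carrier_mat n n \<Longrightarrow> mat_opnorm T \<le> (\<Sum>i<n. \<Sum>j<n. cmod (T $$ (i, j)))"
  by (rule mat_opnorm_leI) (auto intro!: sum_nonneg vnorm_mult_mat_vec_le_entries)

lemma entry_le_mat_opnorm:
  assumes T: "T \<in> carrier_mat n n" and ij: "i < n" "j < n"
  shows "cmod (T $$ (i, j)) \<le> mat_opnorm T"
proof -
  have "vec_index (T *\<^sub>v unit_vec n j) i = T $$ (i, j)"
    using T ij by (simp add: index_mult_mat_vec_sum[OF T] if_distrib sum.delta cong: if_cong)
  then have "cmod (T $$ (i, j)) \<le> vnorm (T *\<^sub>v unit_vec n j)"
    using cmod_index_le_vnorm[of i "T *\<^sub>v unit_vec n j"] T ij by simp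
  also have "\<dots> \<le> mat_opnorm T * 1"
    using vnorm_mult_mat_vec_le[OF T, of "unit_vec n j"] ij by (simp add: vnorm_unit_vec)
  finally show ?thesis by simp
qed

lemma mat_adjoint_carrier [simp]: "T \<in> carrier_mat n m \<Longrightarrow> mat_adjoint T \<in> carrier_mat m n"
  by (auto simp: mat_adjoint_def mat_of_rows_def)

lemma index_mat_adjoint:
  "T \<in> carrier_mat n m \<Longrightarrow> i < m \<Longrightarrow> j < n \<Longrightarrow> mat_adjoint T $$ (i, j) = cnj (T $$ (j, i))"
  by (auto simp: mat_adjoint_def mat_of_rows_def)

lemma index_mult_mat_sum:
  "S \<in> carrier_mat n m \<Longrightarrow> T \<in> carrier_mat m k \<Longrightarrow> i < n \<Longrightarrow> j < k
    \<Longrightarrow> (S * T) $$ (i, j) = (\<Sum>l<m. S $$ (i, l) * T $$ (l, j))"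
  by (auto simp: scalar_prod_def atLeast0LessThan)

lemma sum_cmod_mult_le_vnorm:
  assumes "v \<in> carrier_vec n" "w \<in> carrier_vec n"
  shows "cmod (\<Sum>i<n. cnj (vec_index v i) * vec_index w i) \<le> vnorm v * vnorm w"
proof -
  have "cmod (\<Sum>i<n. cnj (vec_index v i) * vec_index w i)
      \<le> (\<Sum>i<n. \<bar>cmod (vec_index v i)\<bar> * \<bar>cmod (vec_index w i)\<bar>)"
    by (rule order_trans[OF norm_sum]) (simp add: norm_mult)
  also have "\<dots> \<le> vnorm v * vnorm w"
    using assms L2_set_mult_ineq[of "\<lambda>i. cmod (vec_index v i)" "\<lambda>i. cmod (vec_index w i)" "{..<n}"]
    by (simp add: vnorm_L2_set)
  finally show ?thesis .
qed

lemma vnorm_square: "v \<in> carrier_vec n \<Longrightarrow> complex_of_real ((vnorm v)\<^sup>2) = (\<Sum>i<n. cnj (vec_index v i) * vec_index v i)"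
proof -
  assume v: "v \<in> carrier_vec n"
  have "(vnorm v)\<^sup>2 = (\<Sum>i<n. (cmod (vec_index v i))\<^sup>2)"
    using v by (simp add: vnorm_def sum_nonneg)
  then show ?thesis
    by (simp only: of_real_sum complex_norm_square mult.commute)
qed

text \<open>This is \<open>\<parallel>T v\<parallel>\<^sup>2 = \<langle>v, T\<^sup>* T v\<rangle>\<close> followed by the Cauchy-Schwarz inequality, and it is the source of
the C*-identity for matrices.\<close>

lemma vnorm_mult_mat_vec_square_le:
  assumes T: "T \<in> carrier_mat n n" and v: "v \<in> carrier_vec n"
  shows "(vnorm (T *\<^sub>v v))\<^sup>2 \<le> vnorm v * vnorm ((mat_adjoint T * T) *\<^sub>v v)"
proof -
  let ?w = "T *\<^sub>v v"
  have w: "?w \<in> carrier_vec n" using T v by auto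
  have T': "mat_adjoint T \<in> carrier_mat n n" using T by simp
  have "complex_of_real ((vnorm ?w)\<^sup>2) = (\<Sum>i<n. cnj (vec_index ?w i) * vec_index ?w i)"
    by (rule vnorm_square[OF w])
  also have "\<dots> = (\<Sum>i<n. \<Sum>j<n. cnj (T $$ (i, j)) * cnj (vec_index v j) * vec_index ?w i)"
    using index_mult_mat_vec_sum[OF T v] by (intro sum.cong) (auto simp: sum_distrib_right)
  also have "\<dots> = (\<Sum>j<n. \<Sum>i<n. cnj (T $$ (i, j)) * cnj (vec_index v j) * vec_index ?w i)"
    by (rule sum.swap)
  also have "\<dots> = (\<Sum>j<n. cnj (vec_index v j) * vec_index (mat_adjoint T *\<^sub>v ?w) j)"
    using index_mult_mat_vec_sum[OF T' w] index_mat_adjoint[OF T]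
    by (intro sum.cong) (auto simp: sum_distrib_left mult_ac)
  also have "mat_adjoint T *\<^sub>v ?w = (mat_adjoint T * T) *\<^sub>v v"
    using assoc_mult_mat_vec[OF T' T v] by simp
  finally have "(vnorm ?w)\<^sup>2 = cmod (\<Sum>j<n. cnj (vec_index v j) * vec_index ((mat_adjoint T * T) *\<^sub>v v) j)"
    by (metis norm_of_real abs_of_nonneg zero_le_power2)
  also have "\<dots> \<le> vnorm v * vnorm ((mat_adjoint T * T) *\<^sub>v v)"
    using T T' v by (intro sum_cmod_mult_le_vnorm mult_mat_vec_carrier mult_carrier_mat)
  finally show ?thesis .
qed

lemma mat_opnorm_mult:
  assumes S: "S \<in> carrier_mat n n" and T: "T \<in> carrier_mat n n"
  shows "mat_opnorm (S * T) \<le> mat_opnorm S * mat_opnorm T"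
proof (rule mat_opnorm_leI)
  fix v :: "complex vec" assume v: "v \<in> carrier_vec n"
  have "vnorm ((S * T) *\<^sub>v v) = vnorm (S *\<^sub>v (T *\<^sub>v v))"
    using S T v by simp
  also have "\<dots> \<le> mat_opnorm S * vnorm (T *\<^sub>v v)"
    using S T v by (intro vnorm_mult_mat_vec_le) auto
  also have "\<dots> \<le> mat_opnorm S * (mat_opnorm T * vnorm v)"
    using S T v by (intro mult_left_mono vnorm_mult_mat_vec_le mat_opnorm_nonneg) auto
  finally show "vnorm ((S * T) *\<^sub>v v) \<le> mat_opnorm S * mat_opnorm T * vnorm v"
    by simp
qed (use S T in \<open>auto intro!: mult_nonneg_nonneg mat_opnorm_nonneg\<close>)

lemma mat_opnorm_square_le:
  assumes T: "T \<in> carrier_mat n n"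
  shows "(mat_opnorm T)\<^sup>2 \<le> mat_opnorm (mat_adjoint T * T)"
proof -
  let ?S = "mat_adjoint T * T"
  have S: "?S \<in> carrier_mat n n" using T by (metis mat_adjoint_carrier mult_carrier_mat)
  have "mat_opnorm T \<le> sqrt (mat_opnorm ?S)"
  proof (rule mat_opnorm_leI[OF T])
    fix v :: "complex vec" assume v: "v \<in> carrier_vec n"
    have "(vnorm (T *\<^sub>v v))\<^sup>2 \<le> vnorm v * (mat_opnorm ?S * vnorm v)"
      using vnorm_mult_mat_vec_square_le[OF T v] vnorm_mult_mat_vec_le[OF S v]
      by (meson mult_left_mono order_trans vnorm_nonneg)
    then have "vnorm (T *\<^sub>v v) \<le> sqrt (vnorm v * (mat_opnorm ?S * vnorm v))"
      by (rule real_le_rsqrt)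
    also have "vnorm v * (mat_opnorm ?S * vnorm v) = mat_opnorm ?S * (vnorm v)\<^sup>2"
      by (simp add: power2_eq_square)
    finally show "vnorm (T *\<^sub>v v) \<le> sqrt (mat_opnorm ?S) * vnorm v"
      by (simp add: real_sqrt_mult)
  qed (simp add: mat_opnorm_nonneg[OF S])
  then have "(mat_opnorm T)\<^sup>2 \<le> (sqrt (mat_opnorm ?S))\<^sup>2"
    using mat_opnorm_nonneg[OF T] by (rule power_mono)
  then show ?thesis using mat_opnorm_nonneg[OF S] by simp
qed

lemma mat_adjoint_eq:
  "T \<in> carrier_mat n m \<Longrightarrow> mat_adjoint T = mat m n (\<lambda>(i, j). cnj (T $$ (j, i)))"
  using mat_adjoint_carrier[of T n m] by (intro eq_matI) (auto simp: index_mat_adjoint simp del: mat_adjoint_carrier)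

lemma mat_adjoint_adjoint: "T \<in> carrier_mat n n \<Longrightarrow> mat_adjoint (mat_adjoint T) = (T :: complex mat)"
  by (rule eq_matI) (auto simp: mat_adjoint_eq[of _ n n])

lemma mat_adjoint_add:
  "S \<in> carrier_mat n m \<Longrightarrow> T \<in> carrier_mat n m
    \<Longrightarrow> mat_adjoint (S + T) = mat_adjoint S + mat_adjoint (T :: complex mat)"
  by (rule eq_matI) (auto simp: mat_adjoint_eq[of _ n m])

lemma mat_adjoint_smult:
  "T \<in> carrier_mat n m \<Longrightarrow> mat_adjoint (c \<cdot>\<^sub>m T) = cnj c \<cdot>\<^sub>m mat_adjoint (T :: complex mat)"
  by (rule eq_matI) (auto simp: mat_adjoint_eq[of _ n m])

lemma mat_adjoint_mult:
  assumes S: "S \<in> carrier_mat n m" and T: "(T :: complex mat) \<in> carrier_mat m k"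
  shows "mat_adjoint (S * T) = mat_adjoint T * mat_adjoint S"
proof (rule eq_matI)
  have dims: "dim_row (mat_adjoint T * mat_adjoint S) = k" "dim_col (mat_adjoint T * mat_adjoint S) = n"
    using mat_adjoint_carrier[OF S] mat_adjoint_carrier[OF T] by auto
  have p: "S * T \<in> carrier_mat n k" using S T by simp
  show "mat_adjoint (S * T) $$ (i, j) = (mat_adjoint T * mat_adjoint S) $$ (i, j)"
    if "i < dim_row (mat_adjoint T * mat_adjoint S)" "j < dim_col (mat_adjoint T * mat_adjoint S)" for i j
  proof -
    have ij: "i < k" "j < n" using that dims by auto
    have "mat_adjoint (S * T) $$ (i, j) = cnj (\<Sum>l<m. S $$ (j, l) * T $$ (l, i))"
      using ij by (simp only: index_mat_adjoint[OF p] index_mult_mat_sum[OF S T])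
    also have "\<dots> = (\<Sum>l<m. mat_adjoint T $$ (i, l) * mat_adjoint S $$ (l, j))"
      using ij by (simp add: index_mat_adjoint[OF S] index_mat_adjoint[OF T] mult.commute)
    also have "\<dots> = (mat_adjoint T * mat_adjoint S) $$ (i, j)"
      using ij index_mult_mat_sum[OF mat_adjoint_carrier[OF T] mat_adjoint_carrier[OF S]] by simp
    finally show ?thesis .
  qed
qed (simp_all add: carrier_matD[OF mat_adjoint_carrier[OF mult_carrier_mat[OF S T]]]
    carrier_matD[OF mat_adjoint_carrier[OF S]] carrier_matD[OF mat_adjoint_carrier[OF T]])

lemma mat_opnorm_add:
  assumes xy: "x \<in> carrier_mat n n" "y \<in> carrier_mat n n"
  shows "mat_opnorm (x + y) \<le> mat_opnorm x + mat_opnorm y"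
proof (rule mat_opnorm_leI)
  fix v :: "complex vec" assume v: "v \<in> carrier_vec n"
  have "vnorm ((x + y) *\<^sub>v v) \<le> vnorm (x *\<^sub>v v) + vnorm (y *\<^sub>v v)"
    unfolding add_mult_distrib_mat_vec[OF xy v] using xy v
    by (intro vnorm_add[of _ n] mult_mat_vec_carrier)
  then show "vnorm ((x + y) *\<^sub>v v) \<le> (mat_opnorm x + mat_opnorm y) * vnorm v"
    using vnorm_mult_mat_vec_le[OF xy(1) v] vnorm_mult_mat_vec_le[OF xy(2) v]
    by (simp add: distrib_right)
qed (use xy in \<open>auto intro!: add_nonneg_nonneg mat_opnorm_nonneg\<close>)

lemma mat_opnorm_smult:
  assumes x: "x \<in> carrier_mat n n"
  shows "mat_opnorm (c \<cdot>\<^sub>m x) = cmod c * mat_opnorm x"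
proof (rule antisym)
  have smult_le: "mat_opnorm (c \<cdot>\<^sub>m x) \<le> cmod c * mat_opnorm x" if x: "x \<in> carrier_mat n n" for c x
  proof (rule mat_opnorm_leI)
    fix v :: "complex vec" assume v: "v \<in> carrier_vec n"
    have "(c \<cdot>\<^sub>m x) *\<^sub>v v = c \<cdot>\<^sub>v (x *\<^sub>v v)"
      using x v by (intro eq_vecI) auto
    then show "vnorm ((c \<cdot>\<^sub>m x) *\<^sub>v v) \<le> cmod c * mat_opnorm x * vnorm v"
      using vnorm_mult_mat_vec_le[OF x v] by (simp add: vnorm_smult mult.assoc mult_left_mono)
  qed (use x in \<open>auto intro!: mult_nonneg_nonneg mat_opnorm_nonneg\<close>)
  show "mat_opnorm (c \<cdot>\<^sub>m x) \<le> cmod c * mat_opnorm x" by (rule smult_le[OF x])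
  show "cmod c * mat_opnorm x \<le> mat_opnorm (c \<cdot>\<^sub>m x)"
  proof (cases "c = 0")
    case True
    then show ?thesis using x mat_opnorm_nonneg[of "c \<cdot>\<^sub>m x" n] by simp
  next
    case False
    then have "(1 / c) \<cdot>\<^sub>m (c \<cdot>\<^sub>m x) = x" using x by (intro eq_matI) auto
    then have "mat_opnorm x \<le> cmod (1 / c) * mat_opnorm (c \<cdot>\<^sub>m x)"
      using smult_le[of "c \<cdot>\<^sub>m x" "1 / c"] x by simp
    then show ?thesis using False by (simp add: norm_divide field_simps)
  qed
qed

lemma mat_opnorm_eq_0:
  assumes x: "x \<in> carrier_mat n n" shows "mat_opnorm x = 0 \<longleftrightarrow> x = 0\<^sub>m n n"
proof
  assume "mat_opnorm x = 0"
  then show "x = 0\<^sub>m n n"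
    using x entry_le_mat_opnorm[OF x] by (intro eq_matI) auto
next
  assume "x = 0\<^sub>m n n"
  then show "mat_opnorm x = 0"
    using mat_opnorm_le_entries[OF x] mat_opnorm_nonneg[OF x] by simp
qed

lemma mat_opnorm_adjoint:
  assumes T: "T \<in> carrier_mat n n" shows "mat_opnorm (mat_adjoint T) = mat_opnorm T"
proof -
  have le: "mat_opnorm T \<le> mat_opnorm (mat_adjoint T)" if T: "T \<in> carrier_mat n n" for T
  proof (cases "mat_opnorm T = 0")
    case False
    have "(mat_opnorm T)\<^sup>2 \<le> mat_opnorm (mat_adjoint T) * mat_opnorm T"
      using mat_opnorm_square_le[OF T] mat_opnorm_mult[of "mat_adjoint T" n T] T by simp
    then show ?thesis using False mat_opnorm_nonneg[OF T] by (simp add: power2_eq_square)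
  qed (use mat_opnorm_nonneg[of "mat_adjoint T" n] T in simp)
  from le[OF T] le[of "mat_adjoint T"] T show ?thesis by (simp add: mat_adjoint_adjoint)
qed

definition mat_cstar :: "nat \<Rightarrow> complex mat cstar" where
  "mat_cstar n = \<lparr>carrier = carrier_mat n n, mult = (*), one = 1\<^sub>m n, zero = 0\<^sub>m n n,
     add = (+), smult = (\<cdot>\<^sub>m), star = mat_adjoint, cnorm = mat_opnorm\<rparr>"

lemma mat_cstar_simps [simp]:
  "carrier (mat_cstar n) = carrier_mat n n" "mult (mat_cstar n) = (*)" "one (mat_cstar n) = 1\<^sub>m n"
  "zero (mat_cstar n) = 0\<^sub>m n n" "add (mat_cstar n) = (+)" "Module.smult (mat_cstar n) = (\<cdot>\<^sub>m)"
  "star (mat_cstar n) = mat_adjoint" "cnorm (mat_cstar n) = mat_opnorm"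
  by (simp_all add: mat_cstar_def)

lemma mat_cstar_algebra: "unital_cstar_algebra (mat_cstar n)"
proof (rule unital_cstar_algebraI, unfold mat_cstar_simps)
  show "mat_opnorm (mat_adjoint x * x) = (mat_opnorm x)\<^sup>2" if x: "x \<in> carrier_mat n n" for x
    using mat_opnorm_square_le[OF x] mat_opnorm_mult[OF mat_adjoint_carrier[OF x] x]
    by (simp add: mat_opnorm_adjoint[OF x] power2_eq_square)
  show "x + y = y + x" if "x \<in> carrier_mat n n" "y \<in> carrier_mat n n" for x y :: "complex mat"
    using that by (rule comm_add_mat)
  show "- 1 \<cdot>\<^sub>m x + x = 0\<^sub>m n n" "(c * d) \<cdot>\<^sub>m x = c \<cdot>\<^sub>m (d \<cdot>\<^sub>m x)" "1 \<cdot>\<^sub>m x = x"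
    if "x \<in> carrier_mat n n" for x :: "complex mat" and c d
    using that by (auto intro!: eq_matI)
  fix \<sigma> :: "nat \<Rightarrow> complex mat"
  assume \<sigma>: "\<And>n'. \<sigma> n' \<in> carrier_mat n n"
    and C: "\<And>e. 0 < e \<Longrightarrow> \<exists>N. \<forall>m\<ge>N. \<forall>n\<ge>N. mat_opnorm (\<sigma> m + - 1 \<cdot>\<^sub>m \<sigma> n) < e"
  have "\<exists>l. (\<lambda>k. \<sigma> k $$ (i, j)) \<longlonglongrightarrow> l" if ij: "i < n" "j < n" for i j
  proof -
    have "Cauchy (\<lambda>k. \<sigma> k $$ (i, j))"
    proof (rule CauchyI)
      fix e :: real assume "0 < e"
      then obtain N where N: "\<And>m k. m \<ge> N \<Longrightarrow> k \<ge> N \<Longrightarrow> mat_opnorm (\<sigma> m + - 1 \<cdot>\<^sub>m \<sigma> k) < e"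
        using C by blast
      have "norm (\<sigma> m $$ (i, j) - \<sigma> k $$ (i, j)) < e" if "m \<ge> N" "k \<ge> N" for m k
        using entry_le_mat_opnorm[of "\<sigma> m + - 1 \<cdot>\<^sub>m \<sigma> k" n i j] N[OF that] ij \<sigma>[of m] \<sigma>[of k] by simp
      then show "\<exists>M. \<forall>m\<ge>M. \<forall>n\<ge>M. norm (\<sigma> m $$ (i, j) - \<sigma> n $$ (i, j)) < e" by blast
    qed
    then show ?thesis using convergent_eq_Cauchy by blast
  qed
  then obtain l where l: "\<And>i j. i < n \<Longrightarrow> j < n \<Longrightarrow> (\<lambda>k. \<sigma> k $$ (i, j)) \<longlonglongrightarrow> l i j"
    by metis
  define L where "L = mat n n (\<lambda>(i, j). l i j)"
  have L: "L \<in> carrier_mat n n" by (simp add: L_def)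
  have "(\<lambda>k. \<Sum>i<n. \<Sum>j<n. cmod (\<sigma> k $$ (i, j) - l i j)) \<longlonglongrightarrow> (\<Sum>i<n. \<Sum>j<n. cmod (l i j - l i j))"
    by (intro tendsto_intros l) auto
  then have lim: "(\<lambda>k. \<Sum>i<n. \<Sum>j<n. cmod (\<sigma> k $$ (i, j) - l i j)) \<longlonglongrightarrow> 0" by simp
  have "\<exists>N. \<forall>k\<ge>N. mat_opnorm (\<sigma> k + - 1 \<cdot>\<^sub>m L) < e" if "0 < e" for e
  proof -
    obtain N where N: "\<And>k. k \<ge> N \<Longrightarrow> (\<Sum>i<n. \<Sum>j<n. cmod (\<sigma> k $$ (i, j) - l i j)) < e"
      using order_tendstoD(2)[OF lim \<open>0 < e\<close>] by (auto simp: eventually_sequentially)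
    have "mat_opnorm (\<sigma> k + - 1 \<cdot>\<^sub>m L) < e" if "k \<ge> N" for k
    proof -
      have "mat_opnorm (\<sigma> k + - 1 \<cdot>\<^sub>m L) \<le> (\<Sum>i<n. \<Sum>j<n. cmod ((\<sigma> k + - 1 \<cdot>\<^sub>m L) $$ (i, j)))"
        using \<sigma> L by (intro mat_opnorm_le_entries) auto
      also have "\<dots> = (\<Sum>i<n. \<Sum>j<n. cmod (\<sigma> k $$ (i, j) - l i j))"
        using \<sigma>[of k] L by (intro sum.cong) (auto simp: L_def)
      finally show ?thesis using N[OF that] by simp
    qed
    then show ?thesis by blast
  qed
  then show "\<exists>x\<in>carrier_mat n n. \<forall>e>0. \<exists>N. \<forall>n\<ge>N. mat_opnorm (\<sigma> n + - 1 \<cdot>\<^sub>m x) < e"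
    using L by blast
qed (simp_all add: assoc_mult_mat[of _ n n _ n _ n] add_mult_distrib_mat[of _ n n _ _ n] mult_add_distrib_mat[of _ n n _ n]
    assoc_add_mat[of _ n n] mat_opnorm_nonneg mat_opnorm_mult[of _ n]
    mult_smult_distrib[of _ n n _ n] mult_smult_assoc_mat[of _ n n _ n]
    mat_adjoint_adjoint mat_adjoint_add[of _ n n] mat_adjoint_smult[of _ n n] mat_adjoint_mult[of _ n n _ n]
    mat_opnorm_add[of _ n] mat_opnorm_smult[of _ n] mat_opnorm_eq_0
    add_smult_distrib_left_mat[of _ n n] add_smult_distrib_right_mat[of _ n n])


section \<open>Matrix-valued continuous functions\<close>

lemma continuous_map_euclidean_atin:
  "continuous_map X euclidean f \<longleftrightarrow> (\<forall>x\<in>topspace X. (f \<longlongrightarrow> f x) (atin X x))"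
  by (simp add: continuous_map_atin)

lemma continuous_map_complex_mult:
  fixes f g :: "'x \<Rightarrow> complex"
  shows "continuous_map X euclidean f \<Longrightarrow> continuous_map X euclidean g
    \<Longrightarrow> continuous_map X euclidean (\<lambda>x. f x * g x)"
  unfolding continuous_map_euclidean_atin by (auto intro: tendsto_mult)

lemma continuous_map_complex_add:
  fixes f g :: "'x \<Rightarrow> complex"
  shows "continuous_map X euclidean f \<Longrightarrow> continuous_map X euclidean g
    \<Longrightarrow> continuous_map X euclidean (\<lambda>x. f x + g x)"
  unfolding continuous_map_euclidean_atin by (auto intro: tendsto_add)

lemma continuous_map_complex_sum:
  fixes f :: "'i \<Rightarrow> 'x \<Rightarrow> complex"
  shows "(\<And>i. i \<in> J \<Longrightarrow> continuous_map X euclidean (f i)) \<Longrightarrow> continuous_map X euclidean (\<lambda>x. \<Sum>i\<in>J. f i x)"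
  unfolding continuous_map_euclidean_atin by (auto intro: tendsto_sum)

lemma continuous_map_complex_cnj:
  "continuous_map X euclidean f \<Longrightarrow> continuous_map X euclidean (\<lambda>x. cnj (f x))"
  unfolding continuous_map_euclidean_atin by (auto intro: tendsto_cnj)

lemma continuous_map_complex_of_real:
  "continuous_map X euclidean f \<Longrightarrow> continuous_map X euclidean (\<lambda>x. complex_of_real (f x))"
  unfolding continuous_map_euclidean_atin by (auto intro: tendsto_of_real)

lemma continuous_map_bounded_on_compact_space:
  fixes f :: "'x \<Rightarrow> complex"
  assumes "compact_space X" "continuous_map X euclidean f"
  shows "\<exists>K. \<forall>x\<in>topspace X. cmod (f x) \<le> K"
proof -
  have "compactin euclidean (f ` topspace X)"
    using assms by (intro image_compactin) (auto simp: compact_space_def)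
  then have "bounded (f ` topspace X)" by (simp add: compact_imp_bounded)
  then show ?thesis unfolding bounded_iff by simp
qed

lemma C_mat_simps:
  "carrier (C_mat X n) = {f \<in> topspace X \<rightarrow>\<^sub>E carrier_mat n n.
     \<forall>i<n. \<forall>j<n. continuous_map X euclidean (\<lambda>x. f x $$ (i, j))}"
  "mult (C_mat X n) = (\<lambda>f g. \<lambda>x\<in>topspace X. f x * g x)"
  "one (C_mat X n) = (\<lambda>x\<in>topspace X. 1\<^sub>m n)"
  "zero (C_mat X n) = (\<lambda>x\<in>topspace X. 0\<^sub>m n n)"
  "add (C_mat X n) = (\<lambda>f g. \<lambda>x\<in>topspace X. f x + g x)"
  "Module.smult (C_mat X n) = (\<lambda>c f. \<lambda>x\<in>topspace X. c \<cdot>\<^sub>m f x)"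
  "star (C_mat X n) = (\<lambda>f. \<lambda>x\<in>topspace X. mat_adjoint (f x))"
  "cnorm (C_mat X n) = (\<lambda>f. Sup (insert 0 ((\<lambda>x. mat_opnorm (f x)) ` topspace X)))"
  by (simp_all add: C_mat_def)

lemma C_mat_carrierI:
  assumes "\<And>x. x \<in> topspace X \<Longrightarrow> F x \<in> carrier_mat n n"
    and "\<And>i j. i < n \<Longrightarrow> j < n \<Longrightarrow> continuous_map X euclidean (\<lambda>x. F x $$ (i, j))"
  shows "(\<lambda>x\<in>topspace X. F x) \<in> carrier (C_mat X n)"
proof -
  have "continuous_map X euclidean (\<lambda>x. (\<lambda>x\<in>topspace X. F x) x $$ (i, j))" if "i < n" "j < n" for i j
    by (rule continuous_map_eq[OF assms(2)[OF that]]) simp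
  moreover have "(\<lambda>x\<in>topspace X. F x) \<in> topspace X \<rightarrow>\<^sub>E carrier_mat n n"
    using assms(1) by (simp add: restrict_PiE_iff)
  ultimately show ?thesis
    unfolding C_mat_simps by simp
qed

lemma C_mat_carrierD:
  assumes "f \<in> carrier (C_mat X n)"
  shows "x \<in> topspace X \<Longrightarrow> f x \<in> carrier_mat n n"
    and "i < n \<Longrightarrow> j < n \<Longrightarrow> continuous_map X euclidean (\<lambda>x. f x $$ (i, j))"
    and "f \<in> extensional (topspace X)"
proof -
  have f: "f \<in> topspace X \<rightarrow>\<^sub>E carrier_mat n n"
      "\<forall>i<n. \<forall>j<n. continuous_map X euclidean (\<lambda>x. f x $$ (i, j))"
    using assms unfolding C_mat_simps by simp_all
  show "x \<in> topspace X \<Longrightarrow> f x \<in> carrier_mat n n"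
    using f(1) by (rule PiE_mem)
  show "i < n \<Longrightarrow> j < n \<Longrightarrow> continuous_map X euclidean (\<lambda>x. f x $$ (i, j))"
    using f(2) by simp
  show "f \<in> extensional (topspace X)"
    using f(1) by (simp add: PiE_def)
qed

lemma bdd_above_mat_opnorm_C_mat:
  assumes X: "compact_space X" and f: "f \<in> carrier (C_mat X n)"
  shows "bdd_above ((\<lambda>x. mat_opnorm (f x)) ` topspace X)"
proof -
  have "\<exists>K. \<forall>x\<in>topspace X. cmod (f x $$ (i, j)) \<le> K" if "i < n" "j < n" for i j
    by (rule continuous_map_bounded_on_compact_space[OF X C_mat_carrierD(2)[OF f that]])
  then have K: "\<And>i j. i < n \<Longrightarrow> j < n \<Longrightarrow> \<forall>x\<in>topspace X. cmod (f x $$ (i, j)) \<le> K i j"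
    if "K = (\<lambda>i j. SOME k. \<forall>x\<in>topspace X. cmod (f x $$ (i, j)) \<le> k)" for K
    unfolding that by (rule someI_ex)
  define K where "K = (\<lambda>i j. SOME k. \<forall>x\<in>topspace X. cmod (f x $$ (i, j)) \<le> k)"
  note K = K[OF K_def, rule_format]
  show ?thesis
  proof (rule bdd_aboveI2)
    fix x assume x: "x \<in> topspace X"
    have "mat_opnorm (f x) \<le> (\<Sum>i<n. \<Sum>j<n. cmod (f x $$ (i, j)))"
      by (rule mat_opnorm_le_entries[OF C_mat_carrierD(1)[OF f x]])
    also have "\<dots> \<le> (\<Sum>i<n. \<Sum>j<n. K i j)"
    proof (intro sum_mono)
      show "cmod (f x $$ (i, j)) \<le> K i j" if "i \<in> {..<n}" "j \<in> {..<n}" for i j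
        using that by (intro K x) simp_all
    qed
    finally show "mat_opnorm (f x) \<le> (\<Sum>i<n. \<Sum>j<n. K i j)" .
  qed
qed

text \<open>Each entry of a matrix is bounded by its operator norm, so that the entries of a uniform limit are
uniform limits of continuous functions; conversely compactness bounds the norms of the values.\<close>

theorem C_mat_cstar_algebra:
  fixes X :: "'x topology"
  assumes X: "compact_space X"
  shows "unital_cstar_algebra (C_mat X n)"
proof (rule subproduct_cstar_algebra[where T = "topspace X" and B = "\<lambda>_. mat_cstar n"])
  show "unital_cstar_algebra (mat_cstar n)" by (rule mat_cstar_algebra)
  show "carrier (C_mat X n) \<subseteq> extensional (topspace X)"
    using C_mat_carrierD(3) by blast
  show "a x \<in> carrier (mat_cstar n)" if "a \<in> carrier (C_mat X n)" "x \<in> topspace X" for a x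
    using C_mat_carrierD(1)[OF that] by simp
  show "bdd_above ((\<lambda>x. cnorm (mat_cstar n) (a x)) ` topspace X)" if "a \<in> carrier (C_mat X n)" for a
    using bdd_above_mat_opnorm_C_mat[OF X that] by simp
  show "\<zero>\<^bsub>C_mat X n\<^esub> \<in> carrier (C_mat X n)" "\<one>\<^bsub>C_mat X n\<^esub> \<in> carrier (C_mat X n)"
    unfolding C_mat_simps(3,4) by (intro C_mat_carrierI; simp)+
  fix a assume a: "a \<in> carrier (C_mat X n)"
  note aD = C_mat_carrierD[OF a]
  show "c \<odot>\<^bsub>C_mat X n\<^esub> a \<in> carrier (C_mat X n)" for c
    unfolding C_mat_simps(6)
  proof (rule C_mat_carrierI)
    show "continuous_map X euclidean (\<lambda>x. (c \<cdot>\<^sub>m a x) $$ (i, j))" if ij: "i < n" "j < n" for i j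
    proof (rule continuous_map_eq)
      show "continuous_map X euclidean (\<lambda>x. c * a x $$ (i, j))"
        using aD(2)[OF ij] by (intro continuous_map_complex_mult) auto
      show "c * a x $$ (i, j) = (c \<cdot>\<^sub>m a x) $$ (i, j)" if "x \<in> topspace X" for x
        using aD(1)[OF that] ij by simp
    qed
  qed (use aD(1) in auto)
  show "star (C_mat X n) a \<in> carrier (C_mat X n)"
    unfolding C_mat_simps(7)
  proof (rule C_mat_carrierI)
    show "continuous_map X euclidean (\<lambda>x. mat_adjoint (a x) $$ (i, j))" if ij: "i < n" "j < n" for i j
    proof (rule continuous_map_eq)
      show "continuous_map X euclidean (\<lambda>x. cnj (a x $$ (j, i)))"
        using aD(2)[OF ij(2,1)] by (rule continuous_map_complex_cnj)
      show "cnj (a x $$ (j, i)) = mat_adjoint (a x) $$ (i, j)" if "x \<in> topspace X" for x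
        using index_mat_adjoint[OF aD(1)[OF that]] ij by simp
    qed
  qed (use aD(1) in auto)
  fix b assume b: "b \<in> carrier (C_mat X n)"
  note bD = C_mat_carrierD[OF b]
  show "a \<oplus>\<^bsub>C_mat X n\<^esub> b \<in> carrier (C_mat X n)"
    unfolding C_mat_simps(5)
  proof (rule C_mat_carrierI)
    show "continuous_map X euclidean (\<lambda>x. (a x + b x) $$ (i, j))" if ij: "i < n" "j < n" for i j
    proof (rule continuous_map_eq)
      show "continuous_map X euclidean (\<lambda>x. a x $$ (i, j) + b x $$ (i, j))"
        using aD(2)[OF ij] bD(2)[OF ij] by (rule continuous_map_complex_add)
      show "a x $$ (i, j) + b x $$ (i, j) = (a x + b x) $$ (i, j)" if "x \<in> topspace X" for x
        using aD(1)[OF that] bD(1)[OF that] ij by simp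
    qed
  qed (use aD(1) bD(1) in auto)
  show "a \<otimes>\<^bsub>C_mat X n\<^esub> b \<in> carrier (C_mat X n)"
    unfolding C_mat_simps(2)
  proof (rule C_mat_carrierI)
    show "continuous_map X euclidean (\<lambda>x. (a x * b x) $$ (i, j))" if ij: "i < n" "j < n" for i j
    proof (rule continuous_map_eq)
      show "continuous_map X euclidean (\<lambda>x. \<Sum>l<n. a x $$ (i, l) * b x $$ (l, j))"
        using aD(2) bD(2) ij by (intro continuous_map_complex_sum continuous_map_complex_mult) auto
      show "(\<Sum>l<n. a x $$ (i, l) * b x $$ (l, j)) = (a x * b x) $$ (i, j)" if "x \<in> topspace X" for x
        using index_mult_mat_sum[OF aD(1)[OF that] bD(1)[OF that]] ij by simp
    qed
  qed (use aD(1) bD(1) mult_carrier_mat in blast)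
next
  fix \<sigma> :: "nat \<Rightarrow> 'x \<Rightarrow> complex mat" and a
  assume \<sigma>: "\<And>k. \<sigma> k \<in> carrier (C_mat X n)" and a: "a \<in> (\<Pi>\<^sub>E x\<in>topspace X. carrier (mat_cstar n))"
    and lim: "\<And>e. e > 0 \<Longrightarrow> \<exists>N. \<forall>k\<ge>N. \<forall>x\<in>topspace X.
      cnorm (mat_cstar n) (\<sigma> k x \<ominus>\<^bsub>mat_cstar n\<^esub> a x) \<le> e"
  have ax: "a x \<in> carrier_mat n n" if "x \<in> topspace X" for x
    using a that by auto
  have cont: "continuous_map X euclidean (\<lambda>x. a x $$ (i, j))" if ij: "i < n" "j < n" for i j
  proof -
    have "continuous_map X Met_TC.mtopology (\<lambda>x. a x $$ (i, j))"
    proof (rule Met_TC.continuous_map_uniform_limit_alt[where F = sequentially and f = "\<lambda>k x. \<sigma> k x $$ (i, j)"])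
      show "\<forall>\<^sub>F k in sequentially. continuous_map X Met_TC.mtopology (\<lambda>x. \<sigma> k x $$ (i, j))"
        using C_mat_carrierD(2)[OF \<sigma> ij] by simp
      fix e :: real assume "e > 0"
      then obtain N where N: "\<And>k x. k \<ge> N \<Longrightarrow> x \<in> topspace X
          \<Longrightarrow> cnorm (mat_cstar n) (\<sigma> k x \<ominus>\<^bsub>mat_cstar n\<^esub> a x) \<le> e / 2"
        using lim[of "e / 2"] by auto
      have "dist (\<sigma> k x $$ (i, j)) (a x $$ (i, j)) < e" if k: "k \<ge> N" and x: "x \<in> topspace X" for k x
      proof -
        have s: "\<sigma> k x \<in> carrier_mat n n" by (rule C_mat_carrierD(1)[OF \<sigma> x])
        have "\<sigma> k x \<ominus>\<^bsub>mat_cstar n\<^esub> a x = \<sigma> k x + (-1) \<cdot>\<^sub>m a x"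
          using unital_cstar_algebra.diff_eq_smult[OF mat_cstar_algebra, of "\<sigma> k x" n "a x"] s ax[OF x] by simp
        moreover have "cmod ((\<sigma> k x + (-1) \<cdot>\<^sub>m a x) $$ (i, j)) \<le> mat_opnorm (\<sigma> k x + (-1) \<cdot>\<^sub>m a x)"
          using s ax[OF x] ij by (intro entry_le_mat_opnorm) auto
        ultimately show ?thesis
          using N[OF k x] s ax[OF x] ij \<open>e > 0\<close> by (simp add: dist_norm)
      qed
      then show "\<forall>\<^sub>F k in sequentially. \<forall>x\<in>topspace X. dist (\<sigma> k x $$ (i, j)) (a x $$ (i, j)) < e"
        unfolding eventually_sequentially by blast
    qed auto
    then show ?thesis by simp
  qed
  have "(\<lambda>x\<in>topspace X. a x) \<in> carrier (C_mat X n)"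
    by (rule C_mat_carrierI[OF ax cont])
  moreover have "(\<lambda>x\<in>topspace X. a x) = a" using a by (simp add: PiE_restrict)
  ultimately show "a \<in> carrier (C_mat X n)" by simp
qed (simp_all only: C_mat_simps(2-8) mat_cstar_simps)

lemma scalar_mat_ops:
  fixes c d :: complex
  shows "c \<cdot>\<^sub>m 1\<^sub>m n + d \<cdot>\<^sub>m 1\<^sub>m n = (c + d) \<cdot>\<^sub>m 1\<^sub>m n"
    and "(c \<cdot>\<^sub>m 1\<^sub>m n) * (d \<cdot>\<^sub>m 1\<^sub>m n) = (c * d) \<cdot>\<^sub>m 1\<^sub>m n"
    and "c \<cdot>\<^sub>m (d \<cdot>\<^sub>m 1\<^sub>m n) = (c * d) \<cdot>\<^sub>m 1\<^sub>m n"
    and "mat_adjoint (c \<cdot>\<^sub>m 1\<^sub>m n) = cnj c \<cdot>\<^sub>m 1\<^sub>m n"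
    and "1 \<cdot>\<^sub>m 1\<^sub>m n = (1\<^sub>m n :: complex mat)"
proof -
  show "(c \<cdot>\<^sub>m 1\<^sub>m n) * (d \<cdot>\<^sub>m 1\<^sub>m n) = (c * d) \<cdot>\<^sub>m 1\<^sub>m n"
    by (subst mult_smult_distrib[of _ n n _ n]) (simp_all, intro eq_matI, auto)
  show "mat_adjoint (c \<cdot>\<^sub>m 1\<^sub>m n) = cnj c \<cdot>\<^sub>m 1\<^sub>m n"
    by (intro eq_matI) (auto simp: mat_adjoint_eq[of _ n n])
qed (intro eq_matI; auto simp: distrib_right)+

lemma C_mat_evaluation:
  "x \<in> topspace X \<Longrightarrow> (\<lambda>f. f x) \<in> star_hom (C_mat X n) (mat_cstar n)"
  by (rule star_homI) (simp_all add: C_mat_simps(2-7) C_mat_carrierD(1))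

text \<open>A map into \<open>C(X, M\<^sub>n)\<close> is a *-homomorphism if all its point evaluations are. This allows an
attaching map to be defined by cases on the points.\<close>

lemma star_hom_C_matI:
  assumes "\<And>b. b \<in> carrier S \<Longrightarrow> \<Phi> b \<in> carrier (C_mat X n)" and ext: "\<And>b. \<Phi> b \<in> extensional (topspace X)"
    and ev: "\<And>x. x \<in> topspace X \<Longrightarrow> (\<lambda>b. \<Phi> b x) \<in> star_hom S (mat_cstar n)"
  shows "\<Phi> \<in> star_hom S (C_mat X n)"
  by (rule star_homI; (rule assms(1), assumption)?;
      (rule extensionalityI[of _ "topspace X"], rule ext)?)
    (simp_all add: C_mat_simps(2-7) star_homD[OF ev, simplified])

lemma mat_opnorm_le_cnorm_C_mat:
  assumes "compact_space X" "f \<in> carrier (C_mat X n)" "x \<in> topspace X"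
  shows "mat_opnorm (f x) \<le> cnorm (C_mat X n) f"
  unfolding C_mat_simps using bdd_above_mat_opnorm_C_mat[OF assms(1,2)] assms(3)
  by (intro cSup_upper) auto

lemma cnorm_C_mat_leI:
  assumes "0 \<le> c" "\<And>x. x \<in> topspace X \<Longrightarrow> mat_opnorm (f x) \<le> c"
  shows "cnorm (C_mat X n) f \<le> c"
  unfolding C_mat_simps using assms by (intro cSup_least) auto

lemma star_hom_dist_le:
  assumes "unital_cstar_algebra A" "unital_cstar_algebra B" "h \<in> star_hom A B"
    and "x \<in> carrier A" "y \<in> carrier A"
  shows "cnorm B (h x \<ominus>\<^bsub>B\<^esub> h y) \<le> cnorm A (x \<ominus>\<^bsub>A\<^esub> y)"
  unfolding star_hom_diff[OF assms, symmetric]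
  by (rule star_hom_contractive[OF assms(1-3) unital_cstar_algebra.diff_in[OF assms(1,4,5)]])

lemma restriction_star_hom:
  assumes S: "S \<subseteq> topspace X"
  shows "(\<lambda>f. restrict f S) \<in> star_hom (C_mat X n) (C_mat (subtopology X S) n)"
proof (rule star_homI)
  have top: "topspace (subtopology X S) = S" using S by auto
  show "restrict f S \<in> carrier (C_mat (subtopology X S) n)" if f: "f \<in> carrier (C_mat X n)" for f
  proof -
    have "(\<lambda>x\<in>topspace (subtopology X S). f x) \<in> carrier (C_mat (subtopology X S) n)"
      using C_mat_carrierD(1)[OF f] S
      by (intro C_mat_carrierI continuous_map_from_subtopology C_mat_carrierD(2)[OF f]) auto
    then show ?thesis by (simp only: top)
  qed
qed (use S in \<open>auto simp: C_mat_simps(2-8) Int_absorb1 intro!: restrict_ext\<close>)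

section \<open>Stages of an iterated pullback\<close>

lemma stage_simps:
  "carrier (stage D k) = stage_carrier D k"
  "mult (stage D k) = (\<lambda>a b. \<lambda>i\<in>{..k}. a i \<otimes>\<^bsub>C_at D i\<^esub> b i)"
  "one (stage D k) = (\<lambda>i\<in>{..k}. \<one>\<^bsub>C_at D i\<^esub>)"
  "zero (stage D k) = (\<lambda>i\<in>{..k}. \<zero>\<^bsub>C_at D i\<^esub>)"
  "add (stage D k) = (\<lambda>a b. \<lambda>i\<in>{..k}. a i \<oplus>\<^bsub>C_at D i\<^esub> b i)"
  "Module.smult (stage D k) = (\<lambda>c a. \<lambda>i\<in>{..k}. c \<odot>\<^bsub>C_at D i\<^esub> a i)"
  "star (stage D k) = (\<lambda>a. \<lambda>i\<in>{..k}. star (C_at D i) (a i))"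
  "cnorm (stage D k) = (\<lambda>a. Max ((\<lambda>i. cnorm (C_at D i) (a i)) ` {..k}))"
  by (simp_all add: stage_def)

lemma restrict_restrict_atMost: "j \<le> k \<Longrightarrow> restrict (restrict a {..k}) {..j} = restrict a {..j :: nat}"
  by (auto simp: restrict_restrict Int_absorb1)

text \<open>The recursive description unrolled: an element of a stage is a family that satisfies the gluing
condition at every level.\<close>

lemma stage_carrier_iff:
  "a \<in> stage_carrier D k \<longleftrightarrow> a \<in> extensional {..k} \<and> (\<forall>i\<le>k. a i \<in> carrier (C_at D i)) \<and>
     (\<forall>i<k. attach_hom D (Suc i) (restrict a {..i}) = restrict (a (Suc i)) (attach_set D (Suc i)))"
proof (induction k arbitrary: a)
  case 0
  then show ?case by simp
next
  case (Suc k)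
  have at: "restrict a {..k} i = a i" if "i \<le> k" for i using that by simp
  have e1: "(\<forall>i\<le>k. restrict a {..k} i \<in> carrier (C_at D i)) \<longleftrightarrow> (\<forall>i\<le>k. a i \<in> carrier (C_at D i))"
    by (intro all_cong1 imp_cong refl) (simp only: at)
  have e2: "(\<forall>i<k. attach_hom D (Suc i) (restrict (restrict a {..k}) {..i}) = restrict (restrict a {..k} (Suc i)) (attach_set D (Suc i)))
      \<longleftrightarrow> (\<forall>i<k. attach_hom D (Suc i) (restrict a {..i}) = restrict (a (Suc i)) (attach_set D (Suc i)))"
    by (intro all_cong1 imp_cong refl) (simp only: at Suc_leI restrict_restrict_atMost less_imp_le)
  have all_le: "(\<forall>i\<le>Suc k. P i) \<longleftrightarrow> (\<forall>i\<le>k. P i) \<and> P (Suc k)" for P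
    by (auto simp: le_Suc_eq)
  show ?case
    unfolding stage_carrier.simps(2) mem_Collect_eq Suc.IH e1 e2 all_le All_less_Suc
    using restrict_extensional[of a "{..k}"] by argo
qed

lemma stage_carrier_restrict:
  assumes "j \<le> k" "a \<in> stage_carrier D k"
  shows "restrict a {..j} \<in> stage_carrier D j"
  using assms
proof (induction k arbitrary: a rule: dec_induct)
  case base
  then have "restrict a {..j} = a" by (intro extensional_restrict) (simp add: stage_carrier_iff)
  then show ?case using base by simp
next
  case (step k)
  have "restrict a {..k} \<in> stage_carrier D k" using step.prems by simp
  then have "restrict (restrict a {..k}) {..j} \<in> stage_carrier D j" by (rule step.IH)
  then show ?case by (simp only: restrict_restrict_atMost[OF step.hyps(1)])
qed

lemma stage_restrict_ops:
  "j \<le> k \<Longrightarrow> restrict (a \<oplus>\<^bsub>stage D k\<^esub> b) {..j} = restrict a {..j} \<oplus>\<^bsub>stage D j\<^esub> restrict b {..j}"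
  "j \<le> k \<Longrightarrow> restrict (a \<otimes>\<^bsub>stage D k\<^esub> b) {..j} = restrict a {..j} \<otimes>\<^bsub>stage D j\<^esub> restrict b {..j}"
  "j \<le> k \<Longrightarrow> restrict (c \<odot>\<^bsub>stage D k\<^esub> a) {..j} = c \<odot>\<^bsub>stage D j\<^esub> restrict a {..j}"
  "j \<le> k \<Longrightarrow> restrict (star (stage D k) a) {..j} = star (stage D j) (restrict a {..j})"
  "j \<le> k \<Longrightarrow> restrict \<one>\<^bsub>stage D k\<^esub> {..j} = \<one>\<^bsub>stage D j\<^esub>"
  "j \<le> k \<Longrightarrow> restrict \<zero>\<^bsub>stage D k\<^esub> {..j} = \<zero>\<^bsub>stage D j\<^esub>"
  by (auto simp: stage_simps(2-8) intro!: ext)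

lemma stage_index_ops:
  "i \<le> k \<Longrightarrow> (a \<oplus>\<^bsub>stage D k\<^esub> b) i = a i \<oplus>\<^bsub>C_at D i\<^esub> b i"
  "i \<le> k \<Longrightarrow> (a \<otimes>\<^bsub>stage D k\<^esub> b) i = a i \<otimes>\<^bsub>C_at D i\<^esub> b i"
  "i \<le> k \<Longrightarrow> (c \<odot>\<^bsub>stage D k\<^esub> a) i = c \<odot>\<^bsub>C_at D i\<^esub> a i"
  "i \<le> k \<Longrightarrow> star (stage D k) a i = star (C_at D i) (a i)"
  "i \<le> k \<Longrightarrow> \<one>\<^bsub>stage D k\<^esub> i = \<one>\<^bsub>C_at D i\<^esub>"
  "i \<le> k \<Longrightarrow> \<zero>\<^bsub>stage D k\<^esub> i = \<zero>\<^bsub>C_at D i\<^esub>"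
  by (simp_all add: stage_simps(2-8))

lemma cnorm_le_cnorm_stage: "i \<le> k \<Longrightarrow> cnorm (C_at D i) (a i) \<le> cnorm (stage D k) a"
  unfolding stage_simps by (intro Max_ge) auto

lemma cnorm_stage_leI:
  "(\<And>i. i \<le> k \<Longrightarrow> cnorm (C_at D i) (a i) \<le> c) \<Longrightarrow> cnorm (stage D k) a \<le> c"
  unfolding stage_simps by (subst Max_le_iff) auto

locale rsh =
  fixes D :: "'x rsh_data"
  assumes valid: "valid_rsh_data D"
begin

lemma compact_at: "k \<le> len D \<Longrightarrow> compact_space (space_at D k)"
  and Hausdorff_at: "k \<le> len D \<Longrightarrow> Hausdorff_space (space_at D k)"
  and msize_ge_1: "k \<le> len D \<Longrightarrow> 1 \<le> msize D k"
  using valid unfolding valid_rsh_data_def by auto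

lemma normal_at: "k \<le> len D \<Longrightarrow> normal_space (space_at D k)"
  using compact_at Hausdorff_at compact_Hausdorff_or_regular_imp_normal_space by blast

lemma closedin_attach: "Suc k \<le> len D \<Longrightarrow> closedin (space_at D (Suc k)) (attach_set D (Suc k))"
  using valid unfolding valid_rsh_data_def by auto

lemma attach_subset: "Suc k \<le> len D \<Longrightarrow> attach_set D (Suc k) \<subseteq> topspace (space_at D (Suc k))"
  using closedin_attach closedin_subset by blast

lemma attach_hom: "Suc k \<le> len D \<Longrightarrow> attach_hom D (Suc k) \<in> star_hom (stage D k) (C0_at D (Suc k))"
  using valid unfolding valid_rsh_data_def by (metis atLeastAtMost_iff diff_Suc_1 le_add1 plus_1_eq_Suc)

lemma C_at_cstar: "k \<le> len D \<Longrightarrow> unital_cstar_algebra (C_at D k)"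
  unfolding C_at_def by (rule C_mat_cstar_algebra[OF compact_at])

lemma C0_at_cstar: "Suc k \<le> len D \<Longrightarrow> unital_cstar_algebra (C0_at D (Suc k))"
  unfolding C0_at_def
  by (intro C_mat_cstar_algebra compact_space_subtopology closedin_compact_space compact_at closedin_attach)

lemma restriction_hom:
  "Suc k \<le> len D \<Longrightarrow> (\<lambda>f. restrict f (attach_set D (Suc k))) \<in> star_hom (C_at D (Suc k)) (C0_at D (Suc k))"
  unfolding C_at_def C0_at_def by (rule restriction_star_hom[OF attach_subset])

lemma stage_closed_Suc:
  assumes k: "Suc k \<le> len D"
    and a: "a \<in> extensional {..Suc k}" "restrict a {..k} \<in> carrier (stage D k)" "a (Suc k) \<in> carrier (C_at D (Suc k))"
      "attach_hom D (Suc k) (restrict a {..k}) = restrict (a (Suc k)) (attach_set D (Suc k))"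
  shows "a \<in> carrier (stage D (Suc k))"
  using a by (simp add: stage_simps(1))

text \<open>The two assertions have to be proved together. For the limit of a sequence in stage \<open>k + 1\<close> the
gluing condition \<open>\<phi>(a) = \<rho>(f)\<close> survives because both maps are contractive, and contractivity of
\<open>\<phi>\<close> is available once stage \<open>k\<close> is known to be a C*-algebra; closedness under uniform limits is in
turn what makes stage \<open>k + 1\<close> complete.\<close>

theorem stage_cstar_and_closed:
  assumes "k \<le> len D"
  shows "unital_cstar_algebra (stage D k) \<and>
    (\<forall>\<sigma> a. (\<forall>n::nat. \<sigma> n \<in> stage_carrier D k) \<longrightarrow> a \<in> (\<Pi>\<^sub>E i\<in>{..k}. carrier (C_at D i)) \<longrightarrow>
      (\<forall>e>0. \<exists>N. \<forall>n\<ge>N. \<forall>i\<in>{..k}. cnorm (C_at D i) (\<sigma> n i \<ominus>\<^bsub>C_at D i\<^esub> a i) \<le> e) \<longrightarrow> a \<in> stage_carrier D k)"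
    (is "_ \<and> ?lim k")
proof -
  have main: "unital_cstar_algebra (stage D k)"
    if k: "k \<le> len D" and lim: "?lim k"
    and zero_in: "\<zero>\<^bsub>stage D k\<^esub> \<in> carrier (stage D k)" and one_in: "\<one>\<^bsub>stage D k\<^esub> \<in> carrier (stage D k)"
    and add_in: "\<And>a b. a \<in> carrier (stage D k) \<Longrightarrow> b \<in> carrier (stage D k) \<Longrightarrow> a \<oplus>\<^bsub>stage D k\<^esub> b \<in> carrier (stage D k)"
    and mult_in: "\<And>a b. a \<in> carrier (stage D k) \<Longrightarrow> b \<in> carrier (stage D k) \<Longrightarrow> a \<otimes>\<^bsub>stage D k\<^esub> b \<in> carrier (stage D k)"
    and smult_in: "\<And>c a. a \<in> carrier (stage D k) \<Longrightarrow> c \<odot>\<^bsub>stage D k\<^esub> a \<in> carrier (stage D k)"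
    and star_in: "\<And>a. a \<in> carrier (stage D k) \<Longrightarrow> star (stage D k) a \<in> carrier (stage D k)"
    for k
  proof (rule subproduct_cstar_algebra[where T = "{..k}" and B = "C_at D"])
    show "unital_cstar_algebra (C_at D i)" if "i \<in> {..k}" for i
      using that k by (intro C_at_cstar) auto
    show "a i \<in> carrier (C_at D i)" if "a \<in> carrier (stage D k)" "i \<in> {..k}" for a i
      using that by (simp add: stage_simps(1) stage_carrier_iff)
    show "carrier (stage D k) \<subseteq> extensional {..k}"
      by (auto simp: stage_simps(1) stage_carrier_iff)
    show "cnorm (stage D k) a = Sup (insert 0 ((\<lambda>i. cnorm (C_at D i) (a i)) ` {..k}))"
      if a: "a \<in> carrier (stage D k)" for a
    proof -
      have "0 \<le> cnorm (C_at D 0) (a 0)"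
        using a k by (intro unital_cstar_algebra.cnorm_nonneg[OF C_at_cstar])
          (auto simp: stage_simps(1) stage_carrier_iff)
      also have "\<dots> \<le> Max ((\<lambda>i. cnorm (C_at D i) (a i)) ` {..k})"
        by (intro Max_ge) auto
      finally show ?thesis
        unfolding stage_simps by (subst cSup_eq_Max) (auto simp: max_def)
    qed
    show "a \<in> carrier (stage D k)"
      if "\<And>n::nat. \<sigma> n \<in> carrier (stage D k)" "a \<in> (\<Pi>\<^sub>E i\<in>{..k}. carrier (C_at D i))"
        "\<And>e. e > 0 \<Longrightarrow> \<exists>N. \<forall>n\<ge>N. \<forall>i\<in>{..k}. cnorm (C_at D i) (\<sigma> n i \<ominus>\<^bsub>C_at D i\<^esub> a i) \<le> e" for \<sigma> a
      using lim that unfolding stage_simps(1) by blast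
  qed (use zero_in one_in add_in mult_in smult_in star_in in \<open>auto simp: stage_simps(2-7)\<close>)
  show ?thesis using assms
  proof (induction k)
    case 0
    have lim0: "?lim 0"
      by (auto simp: PiE_iff)
    interpret C0: unital_cstar_algebra "C_at D 0" by (rule C_at_cstar) simp
    have "unital_cstar_algebra (stage D 0)"
      by (rule main[OF _ lim0]) (auto simp: stage_simps)
    then show ?case using lim0 by blast
  next
    case (Suc k)
    then have k: "Suc k \<le> len D" by simp
    interpret S: unital_cstar_algebra "stage D k" using Suc by simp
    interpret C: unital_cstar_algebra "C_at D (Suc k)" by (rule C_at_cstar[OF k])
    interpret C0: unital_cstar_algebra "C0_at D (Suc k)" by (rule C0_at_cstar[OF k])
    let ?\<phi> = "attach_hom D (Suc k)" and ?\<rho> = "\<lambda>f. restrict f (attach_set D (Suc k))"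
    note \<phi> = star_homD[OF attach_hom[OF k]] and \<rho> = star_homD[OF restriction_hom[OF k]]
    have in_stage: "restrict a {..k} \<in> carrier (stage D k)" "a (Suc k) \<in> carrier (C_at D (Suc k))"
        "?\<phi> (restrict a {..k}) = ?\<rho> (a (Suc k))" "a \<in> extensional {..Suc k}"
      if "a \<in> carrier (stage D (Suc k))" for a
      using that by (simp_all add: stage_simps(1))
    have lim: "?lim (Suc k)"
    proof (intro allI impI)
      fix \<sigma> :: "nat \<Rightarrow> nat \<Rightarrow> 'x \<Rightarrow> complex mat" and a
      assume \<sigma>: "\<forall>n. \<sigma> n \<in> stage_carrier D (Suc k)" and a: "a \<in> (\<Pi>\<^sub>E i\<in>{..Suc k}. carrier (C_at D i))"
        and conv: "\<forall>e>0. \<exists>N. \<forall>n\<ge>N. \<forall>i\<in>{..Suc k}. cnorm (C_at D i) (\<sigma> n i \<ominus>\<^bsub>C_at D i\<^esub> a i) \<le> e"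
      have \<sigma>': "restrict (\<sigma> n) {..k} \<in> stage_carrier D k" for n
        using \<sigma> by (intro stage_carrier_restrict[of _ "Suc k"]) auto
      have "restrict a {..k} \<in> (\<Pi>\<^sub>E i\<in>{..k}. carrier (C_at D i))" using a by auto
      moreover have "\<forall>e>0. \<exists>N. \<forall>n\<ge>N. \<forall>i\<in>{..k}.
          cnorm (C_at D i) (restrict (\<sigma> n) {..k} i \<ominus>\<^bsub>C_at D i\<^esub> restrict a {..k} i) \<le> e"
      proof (intro allI impI)
        fix e :: real assume "e > 0"
        then obtain N where "\<forall>n\<ge>N. \<forall>i\<in>{..Suc k}. cnorm (C_at D i) (\<sigma> n i \<ominus>\<^bsub>C_at D i\<^esub> a i) \<le> e"
          using conv by blast
        then show "\<exists>N. \<forall>n\<ge>N. \<forall>i\<in>{..k}.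
            cnorm (C_at D i) (restrict (\<sigma> n) {..k} i \<ominus>\<^bsub>C_at D i\<^esub> restrict a {..k} i) \<le> e"
          by (intro exI[of _ N]) auto
      qed
      moreover have "\<forall>n. restrict (\<sigma> n) {..k} \<in> stage_carrier D k" using \<sigma>' by blast
      moreover have "?lim k" using Suc by simp
      ultimately have ra: "restrict a {..k} \<in> carrier (stage D k)"
        unfolding stage_simps(1)
        by (elim allE[of _ "\<lambda>n. restrict (\<sigma> n) {..k}"] allE[of _ "restrict a {..k}"] impE) assumption+
      have a': "a (Suc k) \<in> carrier (C_at D (Suc k))" using a by auto
      have sn: "\<sigma> n \<in> carrier (stage D (Suc k))" for n
        unfolding stage_simps(1) using \<sigma> by (rule spec)
      have s: "restrict (\<sigma> n) {..k} \<in> carrier (stage D k)" "\<sigma> n (Suc k) \<in> carrier (C_at D (Suc k))"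
          "?\<phi> (restrict (\<sigma> n) {..k}) = ?\<rho> (\<sigma> n (Suc k))" for n
        by (rule in_stage(1-3)[OF sn])+
      have "?\<phi> (restrict a {..k}) = ?\<rho> (a (Suc k))"
      proof (rule C0.eq_if_cnorm_le_null_seq)
        show "?\<phi> (restrict a {..k}) \<in> carrier (C0_at D (Suc k))" by (rule \<phi>(1)[OF ra])
        show "?\<rho> (a (Suc k)) \<in> carrier (C0_at D (Suc k))" by (rule \<rho>(1)[OF a'])
        fix m :: nat
        have "0 < 1 / real (Suc m)" by simp
        then obtain N where N: "\<forall>n\<ge>N. \<forall>i\<in>{..Suc k}. cnorm (C_at D i) (\<sigma> n i \<ominus>\<^bsub>C_at D i\<^esub> a i) \<le> 1 / real (Suc m)"
          using conv by blast
        have diff_i: "(restrict (\<sigma> N) {..k} \<ominus>\<^bsub>stage D k\<^esub> restrict a {..k}) i = \<sigma> N i \<ominus>\<^bsub>C_at D i\<^esub> a i"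
          if "i \<le> k" for i
        proof -
          interpret Ci: unital_cstar_algebra "C_at D i" using that k by (intro C_at_cstar) simp
          have "\<sigma> N i \<in> carrier (C_at D i)" "a i \<in> carrier (C_at D i)"
            using \<sigma> a that by (auto simp: stage_carrier_iff)
          then show ?thesis
            using that s(1) ra by (simp add: S.diff_eq_smult Ci.diff_eq_smult stage_index_ops)
        qed
        have 1: "cnorm (stage D k) (restrict (\<sigma> N) {..k} \<ominus>\<^bsub>stage D k\<^esub> restrict a {..k}) \<le> 1 / real (Suc m)"
          using N by (intro cnorm_stage_leI) (simp add: diff_i)
        have "cnorm (C0_at D (Suc k)) (?\<phi> (restrict (\<sigma> N) {..k}) \<ominus>\<^bsub>C0_at D (Suc k)\<^esub> ?\<phi> (restrict a {..k})) \<le> 1 / real (Suc m)"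
          by (rule order_trans[OF star_hom_dist_le[OF S.unital_cstar_algebra_axioms C0.unital_cstar_algebra_axioms
                attach_hom[OF k] s(1) ra] 1])
        moreover have "cnorm (C0_at D (Suc k)) (?\<rho> (\<sigma> N (Suc k)) \<ominus>\<^bsub>C0_at D (Suc k)\<^esub> ?\<rho> (a (Suc k))) \<le> 1 / real (Suc m)"
        proof (rule order_trans[OF star_hom_dist_le[OF C.unital_cstar_algebra_axioms C0.unital_cstar_algebra_axioms
                restriction_hom[OF k] s(2) a']])
          show "cnorm (C_at D (Suc k)) (\<sigma> N (Suc k) \<ominus>\<^bsub>C_at D (Suc k)\<^esub> a (Suc k)) \<le> 1 / real (Suc m)"
            using N by blast
        qed
        ultimately show "cnorm (C0_at D (Suc k)) (?\<phi> (restrict a {..k}) \<ominus>\<^bsub>C0_at D (Suc k)\<^esub> ?\<rho> (a (Suc k)))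
            \<le> 1 / real (Suc m) + 1 / real (Suc m)"
          using C0.cnorm_diff_triangle[OF \<phi>(1)[OF ra] \<rho>(1)[OF s(2)[of N]] \<rho>(1)[OF a']]
            C0.cnorm_diff_commute[OF \<phi>(1)[OF ra] \<rho>(1)[OF s(2)[of N]]]
          unfolding s(3)[of N] by linarith
      next
        show "(\<lambda>m. 1 / real (Suc m) + 1 / real (Suc m)) \<longlonglongrightarrow> 0"
          using tendsto_add[OF LIMSEQ_inverse_real_of_nat LIMSEQ_inverse_real_of_nat]
          by (simp add: inverse_eq_divide)
      qed
      then show "a \<in> stage_carrier D (Suc k)"
        using ra a a' by (simp add: stage_simps(1) PiE_def)
    qed
    have "unital_cstar_algebra (stage D (Suc k))"
    proof (rule main[OF k lim])
      note closed = stage_closed_Suc[OF k]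
      show "\<zero>\<^bsub>stage D (Suc k)\<^esub> \<in> carrier (stage D (Suc k))"
        using \<phi>(5)[OF S.zero_closed, of 0] \<rho>(5)[OF C.zero_closed, of 0] \<phi>(1)[OF S.zero_closed] \<rho>(1)[OF C.zero_closed]
        by (intro closed) (simp_all only: stage_restrict_ops[OF le_SucI[OF order_refl]] stage_index_ops[OF order_refl]
            S.zero_closed C.zero_closed S.zero_smult C.zero_smult C0.zero_smult, simp add: stage_simps)
      show "\<one>\<^bsub>stage D (Suc k)\<^esub> \<in> carrier (stage D (Suc k))"
        by (intro closed) (simp_all only: stage_restrict_ops[OF le_SucI[OF order_refl]] stage_index_ops[OF order_refl]
            S.one_closed C.one_closed \<phi>(4) \<rho>(4), simp add: stage_simps)
      fix a assume "a \<in> carrier (stage D (Suc k))"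
      note a = in_stage[OF this]
      show "c \<odot>\<^bsub>stage D (Suc k)\<^esub> a \<in> carrier (stage D (Suc k))" for c
        by (intro closed) (simp_all only: stage_restrict_ops[OF le_SucI[OF order_refl]] stage_index_ops[OF order_refl]
            S.smult_in[OF a(1)] C.smult_in[OF a(2)] \<phi>(5)[OF a(1)] \<rho>(5)[OF a(2)] a(3), simp add: stage_simps)
      show "star (stage D (Suc k)) a \<in> carrier (stage D (Suc k))"
        by (intro closed) (simp_all only: stage_restrict_ops[OF le_SucI[OF order_refl]] stage_index_ops[OF order_refl]
            S.star_in[OF a(1)] C.star_in[OF a(2)] \<phi>(6)[OF a(1)] \<rho>(6)[OF a(2)] a(3), simp add: stage_simps)
      fix b assume "b \<in> carrier (stage D (Suc k))"
      note b = in_stage[OF this]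
      show "a \<oplus>\<^bsub>stage D (Suc k)\<^esub> b \<in> carrier (stage D (Suc k))"
        using S.ring_simps(1)[OF a(1) b(1)] C.ring_simps(1)[OF a(2) b(2)]
        by (intro closed) (simp_all only: stage_restrict_ops[OF le_SucI[OF order_refl]] stage_index_ops[OF order_refl]
            \<phi>(2)[OF a(1) b(1)] \<rho>(2)[OF a(2) b(2)] a(3) b(3), simp add: stage_simps)
      show "a \<otimes>\<^bsub>stage D (Suc k)\<^esub> b \<in> carrier (stage D (Suc k))"
        using S.ring_simps(5)[OF a(1) b(1)] C.ring_simps(5)[OF a(2) b(2)]
        by (intro closed) (simp_all only: stage_restrict_ops[OF le_SucI[OF order_refl]] stage_index_ops[OF order_refl]
            \<phi>(3)[OF a(1) b(1)] \<rho>(3)[OF a(2) b(2)] a(3) b(3), simp add: stage_simps)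
    qed
    with lim show ?case by blast
  qed
qed

lemma stage_cstar: "k \<le> len D \<Longrightarrow> unital_cstar_algebra (stage D k)"
  using stage_cstar_and_closed by blast

end

section \<open>Extending elements to later stages\<close>

lemma Tietze_extension_complex:
  fixes f :: "'x \<Rightarrow> complex"
  assumes X: "normal_space X" "closedin X S" and f: "continuous_map (subtopology X S) euclidean f"
  shows "\<exists>g. continuous_map X euclidean g \<and> (\<forall>x\<in>S. g x = f x)"
proof -
  have "continuous_map (subtopology X S) euclideanreal (\<lambda>x. Re (f x))"
    "continuous_map (subtopology X S) euclideanreal (\<lambda>x. Im (f x))"
    using f unfolding continuous_map_euclidean_atin by (auto intro: tendsto_Re tendsto_Im)
  then obtain u v :: "'x \<Rightarrow> real" where u: "continuous_map X euclidean u" "\<forall>x\<in>S. u x = Re (f x)"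
    and v: "continuous_map X euclidean v" "\<forall>x\<in>S. v x = Im (f x)"
    using X normal_space_iff_Tietze[of X] by metis
  have "continuous_map X euclidean (\<lambda>x. complex_of_real (u x) + \<i> * complex_of_real (v x))"
    using u(1) v(1)
    by (intro continuous_map_complex_add continuous_map_complex_mult continuous_map_complex_of_real) auto
  moreover have "\<forall>x\<in>S. complex_of_real (u x) + \<i> * complex_of_real (v x) = f x"
    using u(2) v(2) by (simp add: complex_eq_iff)
  ultimately show ?thesis by blast
qed

lemma C_mat_Tietze_extension:
  assumes X: "normal_space X" "closedin X S" and f: "f \<in> carrier (C_mat (subtopology X S) n)"
  shows "\<exists>g\<in>carrier (C_mat X n). restrict g S = f"
proof -
  have top: "topspace (subtopology X S) = S"
    using closedin_subset[OF X(2)] by auto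
  have ex: "\<forall>p\<in>{..<n} \<times> {..<n}. \<exists>g. continuous_map X euclidean g \<and> (\<forall>x\<in>S. g x = f x $$ p)"
  proof
    fix p assume "p \<in> {..<n} \<times> {..<n}"
    then have "fst p < n" "snd p < n" by auto
    from Tietze_extension_complex[OF X C_mat_carrierD(2)[OF f this]]
    show "\<exists>g. continuous_map X euclidean g \<and> (\<forall>x\<in>S. g x = f x $$ p)" by simp
  qed
  obtain G where G': "\<forall>p\<in>{..<n} \<times> {..<n}. continuous_map X euclidean (G p) \<and> (\<forall>x\<in>S. G p x = f x $$ p)"
    using bchoice[OF ex] by (rule exE)
  have G: "continuous_map X euclidean (G p)" "x \<in> S \<Longrightarrow> G p x = f x $$ p"
    if "p \<in> {..<n} \<times> {..<n}" for p x
    using bspec[OF G' that] by simp_all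
  define g where "g = (\<lambda>x\<in>topspace X. mat n n (\<lambda>p. G p x))"
  have "g \<in> carrier (C_mat X n)"
    unfolding g_def
  proof (rule C_mat_carrierI)
    show "continuous_map X euclidean (\<lambda>x. mat n n (\<lambda>p. G p x) $$ (i, j))" if "i < n" "j < n" for i j
      using G(1)[of "(i, j)"] that by simp
  qed simp
  moreover have "restrict g S = f"
  proof (rule extensionalityI[of _ S])
    show "f \<in> extensional S" using C_mat_carrierD(3)[OF f] by (simp only: top)
    show "restrict g S x = f x" if x: "x \<in> S" for x
    proof -
      have "f x \<in> carrier_mat n n" using C_mat_carrierD(1)[OF f] x by (simp only: top)
      moreover have "x \<in> topspace X" using x closedin_subset[OF X(2)] by blast
      ultimately show ?thesis using x G(2)[OF _ x] by (intro eq_matI) (auto simp: g_def)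
    qed
  qed simp
  ultimately show ?thesis by blast
qed

text \<open>The closed set along which level \<open>k\<close> is attached. The attaching data of level 0 have no
meaning, and giving it the empty set lets statements about a level include level 0.\<close>

definition attached_part :: "'x rsh_data \<Rightarrow> nat \<Rightarrow> 'x set" where
  "attached_part D k = (if k = 0 then {} else attach_set D k)"

context rsh
begin

lemma closedin_attached_part: "k \<le> len D \<Longrightarrow> closedin (space_at D k) (attached_part D k)"
  using closedin_attach by (cases k) (auto simp: attached_part_def)

text \<open>The projection from a stage to an earlier one is surjective: at each level the attaching map gives
a function on the closed set \<open>X\<^sub>k\<^sup>(\<^sup>0\<^sup>)\<close>, which extends to \<open>X\<^sub>k\<close> by the Tietze theorem.\<close>

lemma stage_extend:
  assumes "j \<le> k" "k \<le> len D" "a \<in> carrier (stage D j)"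
  shows "\<exists>b\<in>carrier (stage D k). restrict b {..j} = a"
  using assms(1,2)
proof (induction k rule: dec_induct)
  case base
  have "restrict a {..j} = a"
    using assms(3) by (intro extensional_restrict) (auto simp: stage_simps(1) stage_carrier_iff)
  then show ?case using assms(3) by blast
next
  case (step k)
  have k: "Suc k \<le> len D" by (rule step.prems)
  obtain b where b: "b \<in> carrier (stage D k)" "restrict b {..j} = a"
    using step.IH[OF Suc_leD[OF k]] by (rule bexE)
  have "attach_hom D (Suc k) b \<in> carrier (C0_at D (Suc k))"
    by (rule star_homD(1)[OF attach_hom[OF k] b(1)])
  then obtain g where g: "g \<in> carrier (C_at D (Suc k))" "restrict g (attach_set D (Suc k)) = attach_hom D (Suc k) b"
    unfolding C0_at_def C_at_def
    using C_mat_Tietze_extension[OF normal_at[OF k] closedin_attach[OF k]] by (elim bexE[rotated]) assumption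
  have b_ext: "b \<in> extensional {..k}" using b(1) by (simp add: stage_simps(1) stage_carrier_iff)
  have rb: "restrict (b(Suc k := g)) {..k} = b"
    using b_ext by (auto simp: extensional_def intro!: ext)
  have "b(Suc k := g) \<in> carrier (stage D (Suc k))"
  proof (rule stage_closed_Suc[OF k])
    show "b(Suc k := g) \<in> extensional {..Suc k}"
      using b_ext by (auto simp: extensional_def)
  qed (simp_all only: rb b(1) g fun_upd_same)
  moreover have "restrict (b(Suc k := g)) {..j} = a"
    unfolding b(2)[symmetric] using step.hyps(1) by (intro restrict_ext) simp
  ultimately show ?case by blast
qed

text \<open>A function on \<open>X\<^sub>k\<close> that vanishes on the attached part fits together with zeros at the lower levels.
Such lifts are the multipliers by which an ideal of the whole algebra is cut down to level \<open>k\<close>.\<close>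

lemma stage_lift:
  assumes k: "k \<le> len D" and f: "f \<in> carrier (C_at D k)"
    and f0: "\<And>x. x \<in> attached_part D k \<Longrightarrow> f x = 0\<^sub>m (msize D k) (msize D k)"
  obtains e where "e \<in> carrier (stage D (len D))" "\<And>i. i < k \<Longrightarrow> e i = \<zero>\<^bsub>C_at D i\<^esub>" "e k = f"
proof -
  define a where "a = (\<lambda>i\<in>{..k}. if i < k then \<zero>\<^bsub>C_at D i\<^esub> else f)"
  have "a \<in> carrier (stage D k)"
  proof (cases k)
    case 0
    then show ?thesis using f by (auto simp: a_def stage_simps(1))
  next
    case (Suc m)
    have m: "Suc m \<le> len D" using k Suc by simp
    interpret S: unital_cstar_algebra "stage D m" using m by (intro stage_cstar) simp
    interpret C: unital_cstar_algebra "C_at D (Suc m)" by (rule C_at_cstar[OF m])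
    interpret C0: unital_cstar_algebra "C0_at D (Suc m)" by (rule C0_at_cstar[OF m])
    have ra: "restrict a {..m} = \<zero>\<^bsub>stage D m\<^esub>"
      by (auto simp: a_def Suc stage_simps(4) intro!: ext)
    have "attach_hom D (Suc m) \<zero>\<^bsub>stage D m\<^esub> = \<zero>\<^bsub>C0_at D (Suc m)\<^esub>"
      using star_homD(5)[OF attach_hom[OF m] S.zero_closed, of 0] star_homD(1)[OF attach_hom[OF m] S.zero_closed] by simp
    also have "\<dots> = restrict f (attach_set D (Suc m))"
      using f0 Suc attach_subset[OF m]
      by (auto simp: C0_at_def C_mat_simps(4) attached_part_def intro!: ext)
    finally have "attach_hom D (Suc m) (restrict a {..m}) = restrict (a (Suc m)) (attach_set D (Suc m))"
      by (simp add: ra) (simp add: a_def Suc)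
    then have "a \<in> carrier (stage D (Suc m))"
      using f by (intro stage_closed_Suc[OF m]) (simp_all add: ra, simp_all add: a_def Suc)
    then show ?thesis by (simp add: Suc)
  qed
  from stage_extend[OF k order_refl this]
  obtain e where e: "e \<in> carrier (stage D (len D))" "restrict e {..k} = a"
    by (rule bexE)
  have "e i = a i" if "i \<le> k" for i
    using fun_cong[OF e(2), of i] that by simp
  then have "\<And>i. i < k \<Longrightarrow> e i = \<zero>\<^bsub>C_at D i\<^esub>" "e k = f" by (simp_all add: a_def)
  with e(1) show ?thesis by (rule that)
qed

end

section \<open>Approximation by ideals of matrix-valued functions\<close>

text \<open>With matrix units \<open>E\<^sub>i\<^sub>j\<close> this is \<open>\<alpha> E\<^sub>r\<^sub>p c \<beta> E\<^sub>q\<^sub>s = \<alpha> c\<^sub>p\<^sub>q \<beta> E\<^sub>r\<^sub>s\<close>: any single entry of \<open>c\<close> can be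
isolated and moved to any place.\<close>

lemma mat_unit_sandwich:
  fixes c :: "complex mat"
  assumes c: "c \<in> carrier_mat n n" and pq: "p < n" "q < n"
  shows "mat n n (\<lambda>ij. if ij = (r, p) then \<alpha> else 0) * c * mat n n (\<lambda>ij. if ij = (q, s) then \<beta> else 0)
    = mat n n (\<lambda>ij. if ij = (r, s) then \<alpha> * c $$ (p, q) * \<beta> else 0)" (is "?E * c * ?F = ?G")
proof -
  have E: "?E \<in> carrier_mat n n" and F: "?F \<in> carrier_mat n n" by simp_all
  have Ec: "?E * c \<in> carrier_mat n n" using E c by (rule mult_carrier_mat)
  have 1: "(?E * c) $$ (i, l) = (if i = r then \<alpha> * c $$ (p, l) else 0)" if "i < n" "l < n" for i l
  proof -
    have "(?E * c) $$ (i, l) = (\<Sum>m<n. (if m = p then (if i = r then \<alpha> * c $$ (p, l) else 0) else 0))"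
      unfolding index_mult_mat_sum[OF E c that] using that by (intro sum.cong) auto
    then show ?thesis using pq by simp
  qed
  have 2: "(?E * c * ?F) $$ (i, j) = ?G $$ (i, j)" if "i < n" "j < n" for i j
  proof -
    have "(?E * c * ?F) $$ (i, j) = (\<Sum>m<n. (if m = q then (if i = r \<and> j = s then \<alpha> * c $$ (p, q) * \<beta> else 0) else 0))"
      unfolding index_mult_mat_sum[OF Ec F that] using that 1 by (intro sum.cong) auto
    then show ?thesis using pq that by simp
  qed
  show ?thesis
    by (rule eq_matI) (use 2 in simp_all)
qed

lemma abs_mat_opnorm_diff_le:
  assumes S: "S \<in> carrier_mat n n" and T: "T \<in> carrier_mat n n"
  shows "\<bar>mat_opnorm S - mat_opnorm T\<bar> \<le> (\<Sum>i<n. \<Sum>j<n. cmod (S $$ (i, j) - T $$ (i, j)))"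
proof -
  have le: "mat_opnorm S - mat_opnorm T \<le> (\<Sum>i<n. \<Sum>j<n. cmod (S $$ (i, j) - T $$ (i, j)))"
    if S: "S \<in> carrier_mat n n" and T: "T \<in> carrier_mat n n" for S T
  proof -
    have d: "S + (-1) \<cdot>\<^sub>m T \<in> carrier_mat n n" using S T by simp
    have "S = T + (S + (-1) \<cdot>\<^sub>m T)" using S T by (intro eq_matI) auto
    then have "mat_opnorm S \<le> mat_opnorm T + mat_opnorm (S + (-1) \<cdot>\<^sub>m T)"
      using mat_opnorm_add[OF T d] by simp
    also have "mat_opnorm (S + (-1) \<cdot>\<^sub>m T) \<le> (\<Sum>i<n. \<Sum>j<n. cmod ((S + (-1) \<cdot>\<^sub>m T) $$ (i, j)))"
      by (rule mat_opnorm_le_entries[OF d])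
    also have "\<dots> = (\<Sum>i<n. \<Sum>j<n. cmod (S $$ (i, j) - T $$ (i, j)))"
      using S T by (intro sum.cong) auto
    finally show ?thesis by simp
  qed
  have "mat_opnorm T - mat_opnorm S \<le> (\<Sum>i<n. \<Sum>j<n. cmod (S $$ (i, j) - T $$ (i, j)))"
    using le[OF T S] by (simp add: norm_minus_commute)
  with le[OF S T] show ?thesis by simp
qed

lemma continuous_map_mat_opnorm:
  assumes g: "g \<in> carrier (C_mat X n)"
  shows "continuous_map X euclideanreal (\<lambda>x. mat_opnorm (g x))"
  unfolding continuous_map_euclidean_atin
proof
  fix x assume x: "x \<in> topspace X"
  have "((\<lambda>y. g y $$ (i, j)) \<longlongrightarrow> g x $$ (i, j)) (atin X x)" if "i < n" "j < n" for i j
    using C_mat_carrierD(2)[OF g that] x unfolding continuous_map_euclidean_atin by (rule bspec)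
  then have "((\<lambda>y. \<Sum>i<n. \<Sum>j<n. cmod (g y $$ (i, j) - g x $$ (i, j))) \<longlongrightarrow>
      (\<Sum>i<n. \<Sum>j<n. cmod (g x $$ (i, j) - g x $$ (i, j)))) (atin X x)"
    by (intro tendsto_sum tendsto_norm tendsto_diff tendsto_const) simp_all
  then have lim: "((\<lambda>y. \<Sum>i<n. \<Sum>j<n. cmod (g y $$ (i, j) - g x $$ (i, j))) \<longlongrightarrow> 0) (atin X x)"
    by simp
  have "((\<lambda>y. mat_opnorm (g y) - mat_opnorm (g x)) \<longlongrightarrow> 0) (atin X x)"
  proof (rule Lim_null_comparison[OF _ lim])
    have "norm (mat_opnorm (g y) - mat_opnorm (g x)) \<le> (\<Sum>i<n. \<Sum>j<n. cmod (g y $$ (i, j) - g x $$ (i, j)))"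
      if "y \<in> topspace X" for y
      unfolding real_norm_def
      by (rule abs_mat_opnorm_diff_le[OF C_mat_carrierD(1)[OF g that] C_mat_carrierD(1)[OF g x]])
    then show "\<forall>\<^sub>F y in atin X x. norm (mat_opnorm (g y) - mat_opnorm (g x))
        \<le> (\<Sum>i<n. \<Sum>j<n. cmod (g y $$ (i, j) - g x $$ (i, j)))"
      unfolding eventually_atin by (intro disjI2 exI[of _ "topspace X"]) (simp add: x)
  qed
  then show "((\<lambda>y. mat_opnorm (g y)) \<longlongrightarrow> mat_opnorm (g x)) (atin X x)"
    by (simp add: LIM_zero_iff)
qed

definition scalar_fun :: "'x topology \<Rightarrow> nat \<Rightarrow> ('x \<Rightarrow> real) \<Rightarrow> 'x \<Rightarrow> complex mat" where
  "scalar_fun X n h = (\<lambda>x\<in>topspace X. complex_of_real (h x) \<cdot>\<^sub>m 1\<^sub>m n)"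

text \<open>The setting of this and the next lemma is that of one level of an iterated pullback, attached along
\<open>Y\<close>. The set \<open>L\<close> stands for all the components of elements of an ideal at this level, and \<open>J\<close> for the
components of those elements that vanish at the lower levels. An element of \<open>L\<close> gets into \<open>J\<close> when it
is multiplied on both sides by functions vanishing on \<open>Y\<close>.

If the entry \<open>(p, q)\<close> of \<open>c\<close> is nonzero at \<open>y\<close>, the sum over \<open>r\<close> of the products
\<open>\<psi> E\<^sub>r\<^sub>p c \<beta> E\<^sub>q\<^sub>r\<close>, with a Urysohn function \<open>\<psi>\<close> that vanishes on \<open>Y\<close> and \<open>\<beta>\<close> a multiple of
\<open>\<psi> cnj c\<^sub>p\<^sub>q\<close>, is \<open>\<sigma> 1\<close> with a nonnegative function \<open>\<sigma>\<close>.\<close>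

lemma C_mat_ideal_local_unit:
  fixes X :: "'x topology" and J L :: "('x \<Rightarrow> complex mat) set"
  assumes X: "compact_space X" "Hausdorff_space X" and Y: "closedin X Y"
    and J_zero: "\<zero>\<^bsub>C_mat X n\<^esub> \<in> J" and J_add: "\<And>u v. u \<in> J \<Longrightarrow> v \<in> J \<Longrightarrow> u \<oplus>\<^bsub>C_mat X n\<^esub> v \<in> J"
    and L: "L \<subseteq> carrier (C_mat X n)"
    and VLV: "\<And>v c w. v \<in> carrier (C_mat X n) \<Longrightarrow> (\<And>x. x \<in> Y \<Longrightarrow> v x = 0\<^sub>m n n) \<Longrightarrow>
      w \<in> carrier (C_mat X n) \<Longrightarrow> (\<And>x. x \<in> Y \<Longrightarrow> w x = 0\<^sub>m n n) \<Longrightarrow> c \<in> L \<Longrightarrow>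
      (v \<otimes>\<^bsub>C_mat X n\<^esub> c) \<otimes>\<^bsub>C_mat X n\<^esub> w \<in> J"
    and y: "y \<in> topspace X" "y \<notin> Y" and c: "c \<in> L" "c y \<noteq> 0\<^sub>m n n"
  shows "\<exists>\<sigma>. continuous_map X euclideanreal \<sigma> \<and> (\<forall>x. 0 \<le> \<sigma> x) \<and> 1 < \<sigma> y \<and> scalar_fun X n \<sigma> \<in> J"
proof -
  have cC: "c \<in> carrier (C_mat X n)" using c(1) L by blast
  note cD = C_mat_carrierD[OF cC]
  have "\<exists>p q. p < n \<and> q < n \<and> c y $$ (p, q) \<noteq> 0"
  proof (rule ccontr)
    assume "\<nexists>p q. p < n \<and> q < n \<and> c y $$ (p, q) \<noteq> 0"
    then have "c y = 0\<^sub>m n n" using cD(1)[OF y(1)] by (intro eq_matI) auto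
    with c(2) show False by simp
  qed
  then obtain p q where pq: "p < n" "q < n" "c y $$ (p, q) \<noteq> 0" by blast
  define z where "z = c y $$ (p, q)"
  have z: "cmod z > 0" using pq by (simp add: z_def)
  have "normal_space X" using X compact_Hausdorff_or_regular_imp_normal_space by blast
  moreover have "closedin X {y}" using X(2) y(1) by (simp add: closedin_Hausdorff_singleton)
  moreover have "disjnt Y {y}" using y(2) by (simp add: disjnt_def)
  ultimately obtain \<psi> where \<psi>: "continuous_map X (top_of_set {0..1::real}) \<psi>" "\<psi> ` Y \<subseteq> {0}" "\<psi> ` {y} \<subseteq> {1}"
    using Urysohn_lemma[of X Y "{y}" 0 1] Y by (metis zero_le_one)
  have \<psi>c: "continuous_map X euclideanreal \<psi>"
    using \<psi>(1) continuous_map_into_fulltopology by blast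
  have \<psi>0: "\<psi> x = 0" if "x \<in> Y" for x using \<psi>(2) that by auto
  have \<psi>1: "\<psi> y = 1" using \<psi>(3) by auto
  \<comment> \<open>The factor \<open>2 / \<bar>z\<bar>\<^sup>2\<close> makes \<open>\<sigma> y = 2\<close>.\<close>
  define \<beta> where "\<beta> = (\<lambda>x. complex_of_real (2 / (cmod z)\<^sup>2) * complex_of_real (\<psi> x) * cnj (c x $$ (p, q)))"
  define \<sigma> where "\<sigma> = (\<lambda>x. 2 / (cmod z)\<^sup>2 * (\<psi> x)\<^sup>2 * (cmod (c x $$ (p, q)))\<^sup>2)"
  have \<alpha>\<beta>: "complex_of_real (\<psi> x) * c x $$ (p, q) * \<beta> x = complex_of_real (\<sigma> x)" for x
  proof -
    have "complex_of_real ((cmod (c x $$ (p, q)))\<^sup>2) = c x $$ (p, q) * cnj (c x $$ (p, q))"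
      by (rule complex_norm_square)
    then show ?thesis
      by (simp only: \<sigma>_def \<beta>_def of_real_mult) (simp add: power2_eq_square mult_ac)
  qed
  have \<beta>c: "continuous_map X euclidean \<beta>"
    unfolding \<beta>_def using \<psi>c cD(2)[OF pq(1,2)]
    by (intro continuous_map_complex_mult continuous_map_complex_of_real continuous_map_complex_cnj) auto
  have \<sigma>c: "continuous_map X euclideanreal \<sigma>"
    using \<psi>c cD(2)[OF pq(1,2)] unfolding \<sigma>_def continuous_map_euclidean_atin
    by (intro ballI tendsto_mult tendsto_power tendsto_norm tendsto_const) simp_all
  have \<beta>0: "\<beta> x = 0" if "x \<in> Y" for x using \<psi>0[OF that] by (simp add: \<beta>_def)
  define E where "E = (\<lambda>h r s. \<lambda>x\<in>topspace X. mat n n (\<lambda>ij. if ij = (r, s) then h x else (0::complex)))"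
  have E_in: "E h r s \<in> carrier (C_mat X n)" if h: "continuous_map X euclidean h" for h r s
    unfolding E_def
  proof (rule C_mat_carrierI)
    show "continuous_map X euclidean (\<lambda>x. mat n n (\<lambda>ij. if ij = (r, s) then h x else 0) $$ (i, j))"
      if "i < n" "j < n" for i j
      using that h by (cases "(i, j) = (r, s)") auto
  qed simp
  have E_0: "E h r s x = 0\<^sub>m n n" if "x \<in> Y" "h x = 0" for h r s x
    using that closedin_subset[OF Y] by (auto simp: E_def intro!: eq_matI)
  have Yc: "continuous_map X euclidean (\<lambda>x. complex_of_real (\<psi> x))"
    by (rule continuous_map_complex_of_real[OF \<psi>c])
  have u_in: "E (\<lambda>x. complex_of_real (\<sigma> x)) r r \<in> J" for r
  proof -
    have "(E (\<lambda>x. complex_of_real (\<psi> x)) r p \<otimes>\<^bsub>C_mat X n\<^esub> c) \<otimes>\<^bsub>C_mat X n\<^esub> E \<beta> q r \<in> J"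
      by (intro VLV E_in Yc \<beta>c c(1)) (simp_all add: E_0 \<psi>0 \<beta>0)
    also have "(E (\<lambda>x. complex_of_real (\<psi> x)) r p \<otimes>\<^bsub>C_mat X n\<^esub> c) \<otimes>\<^bsub>C_mat X n\<^esub> E \<beta> q r
        = E (\<lambda>x. complex_of_real (\<sigma> x)) r r"
    proof (rule extensionalityI[of _ "topspace X"])
      fix x assume x: "x \<in> topspace X"
      show "((E (\<lambda>x. complex_of_real (\<psi> x)) r p \<otimes>\<^bsub>C_mat X n\<^esub> c) \<otimes>\<^bsub>C_mat X n\<^esub> E \<beta> q r) x
          = E (\<lambda>x. complex_of_real (\<sigma> x)) r r x"
        using x mat_unit_sandwich[OF cD(1)[OF x] pq(1,2), of r "complex_of_real (\<psi> x)" r "\<beta> x"]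
        by (simp only: C_mat_simps(2) E_def restrict_apply' \<alpha>\<beta>)
    qed (simp_all add: C_mat_simps(2) E_def)
    finally show ?thesis .
  qed
  have partial: "(\<lambda>x\<in>topspace X. mat n n (\<lambda>(i, j). if i = j \<and> i < m then complex_of_real (\<sigma> x) else 0)) \<in> J"
    (is "?P m \<in> J") for m
  proof (induction m)
    case 0
    have "?P 0 = \<zero>\<^bsub>C_mat X n\<^esub>"
      unfolding C_mat_simps(4) by (intro restrict_ext eq_matI) auto
    then show ?case using J_zero by simp
  next
    case (Suc m)
    have "?P m \<oplus>\<^bsub>C_mat X n\<^esub> E (\<lambda>x. complex_of_real (\<sigma> x)) m m = ?P (Suc m)"
      unfolding C_mat_simps(5) E_def by (intro restrict_ext eq_matI) (auto simp: less_Suc_eq)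
    then show ?case using J_add[OF Suc u_in[of m]] by simp
  qed
  have eq: "?P n = scalar_fun X n \<sigma>"
    unfolding scalar_fun_def by (intro restrict_ext eq_matI) auto
  have "scalar_fun X n \<sigma> \<in> J" using partial[of n] by (simp only: eq)
  moreover have "1 < \<sigma> y" using z by (simp add: \<sigma>_def \<psi>1 z_def[symmetric])
  moreover have "\<forall>x. 0 \<le> \<sigma> x" by (simp add: \<sigma>_def)
  ultimately show ?thesis using \<sigma>c by blast
qed

text \<open>Compactness of \<open>{x. \<parallel>g x\<parallel> \<ge> e}\<close> gives a single \<open>\<sigma> 1\<close> in \<open>J\<close> with \<open>\<sigma> > 1\<close> on this set. With
\<open>t = \<sigma> / max \<sigma> 1\<close> the element \<open>t\<^sup>2 g\<close> equals \<open>g\<close> there and differs from \<open>g\<close> elsewhere by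
\<open>(1 - t\<^sup>2) g\<close>, which has norm less than \<open>e\<close>. It lies in \<open>J\<close> as the product of
\<open>v = (t / max \<sigma> 1) g\<close>, which vanishes on \<open>Y\<close> because \<open>\<sigma>\<close> does, and \<open>\<sigma> 1\<close>.\<close>

lemma C_mat_ideal_approximation:
  fixes X :: "'x topology" and J L :: "('x \<Rightarrow> complex mat) set"
  assumes X: "compact_space X" "Hausdorff_space X" and Y: "closedin X Y" and n: "1 \<le> n"
    and J_zero: "\<zero>\<^bsub>C_mat X n\<^esub> \<in> J" and J_add: "\<And>u v. u \<in> J \<Longrightarrow> v \<in> J \<Longrightarrow> u \<oplus>\<^bsub>C_mat X n\<^esub> v \<in> J"
    and J_vanish: "\<And>u x. u \<in> J \<Longrightarrow> x \<in> Y \<Longrightarrow> u x = 0\<^sub>m n n"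
    and VJ: "\<And>v u. v \<in> carrier (C_mat X n) \<Longrightarrow> (\<And>x. x \<in> Y \<Longrightarrow> v x = 0\<^sub>m n n) \<Longrightarrow> u \<in> J \<Longrightarrow>
      v \<otimes>\<^bsub>C_mat X n\<^esub> u \<in> J"
    and L: "L \<subseteq> carrier (C_mat X n)"
    and VLV: "\<And>v c w. v \<in> carrier (C_mat X n) \<Longrightarrow> (\<And>x. x \<in> Y \<Longrightarrow> v x = 0\<^sub>m n n) \<Longrightarrow>
      w \<in> carrier (C_mat X n) \<Longrightarrow> (\<And>x. x \<in> Y \<Longrightarrow> w x = 0\<^sub>m n n) \<Longrightarrow> c \<in> L \<Longrightarrow>
      (v \<otimes>\<^bsub>C_mat X n\<^esub> c) \<otimes>\<^bsub>C_mat X n\<^esub> w \<in> J"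
    and g: "g \<in> carrier (C_mat X n)" and e: "0 < e"
    and g_Y: "\<And>x. x \<in> Y \<Longrightarrow> mat_opnorm (g x) < e"
    and g_L: "\<And>x. x \<in> topspace X \<Longrightarrow> (\<And>c. c \<in> L \<Longrightarrow> c x = 0\<^sub>m n n) \<Longrightarrow> mat_opnorm (g x) < e"
  shows "\<exists>u\<in>J. \<forall>x\<in>topspace X. mat_opnorm (g x + (-1) \<cdot>\<^sub>m u x) \<le> e"
proof -
  define good where "good = (\<lambda>\<sigma>. continuous_map X euclideanreal \<sigma> \<and> (\<forall>x. 0 \<le> \<sigma> x) \<and> scalar_fun X n \<sigma> \<in> J)"
  define K where "K = {x \<in> topspace X. mat_opnorm (g x) \<in> {e..}}"
  have "closedin X K"
    unfolding K_def by (rule closedin_continuous_map_preimage[OF continuous_map_mat_opnorm[OF g]]) simp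
  then have K: "compactin X K" by (rule closedin_compact_space[OF X(1)])
  define \<U> where "\<U> = {U. \<exists>\<sigma>. good \<sigma> \<and> U = {x \<in> topspace X. \<sigma> x \<in> {1<..}}}"
  have U_open: "openin X U" if U: "U \<in> \<U>" for U
  proof -
    obtain \<sigma> where \<sigma>: "good \<sigma>" "U = {x \<in> topspace X. \<sigma> x \<in> {1<..}}" using U unfolding \<U>_def by blast
    have c: "continuous_map X euclideanreal \<sigma>" using \<sigma>(1) unfolding good_def by blast
    show ?thesis unfolding \<sigma>(2) by (rule openin_continuous_map_preimage[OF c]) simp
  qed
  have cover: "K \<subseteq> \<Union>\<U>"
  proof
    fix y assume "y \<in> K"
    then have y: "y \<in> topspace X" "e \<le> mat_opnorm (g y)" by (simp_all add: K_def)
    have "y \<notin> Y" using g_Y[of y] y(2) by linarith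
    moreover obtain c where "c \<in> L" "c y \<noteq> 0\<^sub>m n n"
      using g_L[OF y(1)] y(2) by (meson not_le)
    ultimately obtain \<sigma> where "continuous_map X euclideanreal \<sigma>" "\<forall>x. 0 \<le> \<sigma> x" "1 < \<sigma> y" "scalar_fun X n \<sigma> \<in> J"
      using C_mat_ideal_local_unit[OF X Y J_zero J_add L VLV y(1)] by blast
    then have "good \<sigma>" "y \<in> {x \<in> topspace X. \<sigma> x \<in> {1<..}}" using y(1) by (simp_all add: good_def)
    then show "y \<in> \<Union>\<U>" unfolding \<U>_def by blast
  qed
  obtain \<F> where \<F>: "finite \<F>" "\<F> \<subseteq> \<U>" "K \<subseteq> \<Union>\<F>"
    using K U_open cover unfolding compactin_def by meson
  have scalar_add: "scalar_fun X n \<sigma> \<oplus>\<^bsub>C_mat X n\<^esub> scalar_fun X n \<tau> = scalar_fun X n (\<lambda>x. \<sigma> x + \<tau> x)" for \<sigma> \<tau>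
    unfolding C_mat_simps(5) scalar_fun_def by (intro restrict_ext eq_matI) auto
  have "\<exists>\<sigma>. good \<sigma> \<and> (\<forall>x\<in>\<Union>\<F>. 1 < \<sigma> x)"
    using \<F>(1,2)
  proof (induction \<F> rule: finite_induct)
    case empty
    have "scalar_fun X n (\<lambda>_. 0) = \<zero>\<^bsub>C_mat X n\<^esub>"
      unfolding C_mat_simps(4) scalar_fun_def by (intro restrict_ext eq_matI) auto
    then have "good (\<lambda>_. 0)" using J_zero by (simp add: good_def)
    then show ?case by blast
  next
    case (insert U \<F>)
    then obtain \<tau> where \<tau>: "good \<tau>" "\<forall>x\<in>\<Union>\<F>. 1 < \<tau> x" by blast
    obtain \<sigma> where \<sigma>: "good \<sigma>" "U = {x \<in> topspace X. \<sigma> x \<in> {1<..}}" using insert.prems unfolding \<U>_def by blast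
    have pos: "0 \<le> \<sigma> x" "0 \<le> \<tau> x" for x using \<sigma>(1) \<tau>(1) unfolding good_def by blast+
    have "good (\<lambda>x. \<sigma> x + \<tau> x)"
      using \<sigma>(1) \<tau>(1) pos J_add[of "scalar_fun X n \<sigma>" "scalar_fun X n \<tau>"]
      unfolding good_def scalar_add by (simp add: continuous_map_add)
    moreover have "1 < \<sigma> x + \<tau> x" if "x \<in> \<Union>(insert U \<F>)" for x
    proof (cases "x \<in> U")
      case True
      then have "1 < \<sigma> x" by (simp add: \<sigma>(2))
      then show ?thesis using pos(2)[of x] by linarith
    next
      case False
      then have "1 < \<tau> x" using that \<tau>(2) by blast
      then show ?thesis using pos(1)[of x] by linarith
    qed
    ultimately show ?case by blast
  qed
  then obtain \<sigma> where \<sigma>: "good \<sigma>" "\<forall>x\<in>\<Union>\<F>. 1 < \<sigma> x" by blast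
  have \<sigma>c: "continuous_map X euclideanreal \<sigma>" and \<sigma>pos: "\<And>x. 0 \<le> \<sigma> x" and \<sigma>J: "scalar_fun X n \<sigma> \<in> J"
    using \<sigma>(1) unfolding good_def by blast+
  have \<sigma>Y: "\<sigma> x = 0" if x: "x \<in> Y" for x
  proof -
    have "(complex_of_real (\<sigma> x) \<cdot>\<^sub>m 1\<^sub>m n) $$ (0, 0) = 0\<^sub>m n n $$ (0, 0)"
      using J_vanish[OF \<sigma>J x] x closedin_subset[OF Y] by (auto simp: scalar_fun_def)
    then show ?thesis using n by simp
  qed
  define t where "t = (\<lambda>x. \<sigma> x / max (\<sigma> x) 1)"
  have t: "0 \<le> t x" "t x \<le> 1" for x using \<sigma>pos[of x] by (auto simp: t_def divide_le_eq_1)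
  define s where "s = (\<lambda>x. t x / max (\<sigma> x) 1)"
  have max_nz: "max (\<sigma> x) 1 \<noteq> 0" for x by linarith
  have sc: "continuous_map X euclideanreal s"
    using \<sigma>c unfolding s_def t_def continuous_map_euclidean_atin
    by (intro ballI tendsto_divide tendsto_max tendsto_const max_nz) simp_all
  define v where "v = (\<lambda>x\<in>topspace X. complex_of_real (s x) \<cdot>\<^sub>m g x)"
  have v: "v \<in> carrier (C_mat X n)"
    unfolding v_def
  proof (rule C_mat_carrierI)
    show "complex_of_real (s x) \<cdot>\<^sub>m g x \<in> carrier_mat n n" if "x \<in> topspace X" for x
      using C_mat_carrierD(1)[OF g that] by simp
    show "continuous_map X euclidean (\<lambda>x. (complex_of_real (s x) \<cdot>\<^sub>m g x) $$ (i, j))" if ij: "i < n" "j < n" for i j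
    proof (rule continuous_map_eq)
      show "continuous_map X euclidean (\<lambda>x. complex_of_real (s x) * g x $$ (i, j))"
        by (intro continuous_map_complex_mult continuous_map_complex_of_real sc C_mat_carrierD(2)[OF g ij])
      show "complex_of_real (s x) * g x $$ (i, j) = (complex_of_real (s x) \<cdot>\<^sub>m g x) $$ (i, j)"
        if "x \<in> topspace X" for x
        using C_mat_carrierD(1)[OF g that] ij by simp
    qed
  qed
  have "v x = 0\<^sub>m n n" if "x \<in> Y" for x
  proof -
    have "x \<in> topspace X" using that closedin_subset[OF Y] by blast
    then show ?thesis
      using C_mat_carrierD(1)[OF g, of x] \<sigma>Y[OF that] by (intro eq_matI) (simp_all add: v_def s_def t_def)
  qed
  then have uJ: "v \<otimes>\<^bsub>C_mat X n\<^esub> scalar_fun X n \<sigma> \<in> J"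
    using v \<sigma>J VJ by blast
  have "mat_opnorm (g x + (-1) \<cdot>\<^sub>m (v \<otimes>\<^bsub>C_mat X n\<^esub> scalar_fun X n \<sigma>) x) \<le> e" if x: "x \<in> topspace X" for x
  proof -
    have gx: "g x \<in> carrier_mat n n" by (rule C_mat_carrierD(1)[OF g x])
    have st: "s x * \<sigma> x = (t x)\<^sup>2" by (simp add: s_def t_def power2_eq_square)
    have "(v \<otimes>\<^bsub>C_mat X n\<^esub> scalar_fun X n \<sigma>) x = (complex_of_real (s x) \<cdot>\<^sub>m g x) * (complex_of_real (\<sigma> x) \<cdot>\<^sub>m 1\<^sub>m n)"
      using x by (simp add: C_mat_simps(2) v_def scalar_fun_def)
    also have "\<dots> = complex_of_real (\<sigma> x) \<cdot>\<^sub>m (complex_of_real (s x) \<cdot>\<^sub>m g x)"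
      using gx by (subst mult_smult_distrib[of _ n n _ n]) simp_all
    also have "\<dots> = complex_of_real ((t x)\<^sup>2) \<cdot>\<^sub>m g x"
      unfolding st[symmetric] using gx by (intro eq_matI) simp_all
    finally have "g x + (-1) \<cdot>\<^sub>m (v \<otimes>\<^bsub>C_mat X n\<^esub> scalar_fun X n \<sigma>) x = complex_of_real (1 - (t x)\<^sup>2) \<cdot>\<^sub>m g x"
      using gx by (intro eq_matI) (simp_all add: algebra_simps)
    then have eq: "mat_opnorm (g x + (-1) \<cdot>\<^sub>m (v \<otimes>\<^bsub>C_mat X n\<^esub> scalar_fun X n \<sigma>) x) = \<bar>1 - (t x)\<^sup>2\<bar> * mat_opnorm (g x)"
      by (simp only: mat_opnorm_smult[OF gx] norm_of_real)
    show ?thesis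
    proof (cases "x \<in> K")
      case True
      then have "1 < \<sigma> x" using \<F>(3) \<sigma>(2) by blast
      then have "t x = 1" by (simp add: t_def)
      then show ?thesis using eq e by simp
    next
      case False
      then have "mat_opnorm (g x) < e" using x by (simp add: K_def)
      moreover have "\<bar>1 - (t x)\<^sup>2\<bar> \<le> 1" using t[of x] by (simp add: power_le_one)
      then have "\<bar>1 - (t x)\<^sup>2\<bar> * mat_opnorm (g x) \<le> 1 * mat_opnorm (g x)"
        by (intro mult_right_mono mat_opnorm_nonneg[OF gx])
      ultimately show ?thesis using eq by simp
    qed
  qed
  with uJ show ?thesis by blast
qed


section \<open>Ideals and their zero sets\<close>

definition zero_set :: "'x rsh_data \<Rightarrow> (nat \<Rightarrow> 'x \<Rightarrow> complex mat) set \<Rightarrow> nat \<Rightarrow> 'x set" where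
  "zero_set D I k = {x \<in> topspace (space_at D k). \<forall>a\<in>I. a k x = 0\<^sub>m (msize D k) (msize D k)}"

lemma stage_at:
  assumes "a \<in> carrier (stage D k)" "i \<le> k"
  shows "a i \<in> carrier (C_at D i)"
proof -
  have h: "\<forall>i\<le>k. a i \<in> carrier (C_at D i)"
    using assms(1) unfolding stage_simps(1) stage_carrier_iff by (elim conjE)
  show ?thesis by (rule h[rule_format, OF assms(2)])
qed

lemma stage_attach:
  assumes "a \<in> carrier (stage D k)" "Suc i \<le> k"
  shows "attach_hom D (Suc i) (restrict a {..i}) = restrict (a (Suc i)) (attach_set D (Suc i))"
proof -
  have h: "\<forall>i<k. attach_hom D (Suc i) (restrict a {..i}) = restrict (a (Suc i)) (attach_set D (Suc i))"
    using assms(1) unfolding stage_simps(1) stage_carrier_iff by (elim conjE)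
  show ?thesis by (rule h[rule_format, OF Suc_le_lessD[OF assms(2)]])
qed

locale rsh_ideal = rsh D for D :: "'x rsh_data" +
  fixes I :: "(nat \<Rightarrow> 'x \<Rightarrow> complex mat) set"
  assumes I_sub: "I \<subseteq> carrier (stage D (len D))"
    and I_zero: "\<zero>\<^bsub>stage D (len D)\<^esub> \<in> I"
    and I_add: "a \<in> I \<Longrightarrow> b \<in> I \<Longrightarrow> a \<oplus>\<^bsub>stage D (len D)\<^esub> b \<in> I"
    and I_left: "b \<in> carrier (stage D (len D)) \<Longrightarrow> a \<in> I \<Longrightarrow> b \<otimes>\<^bsub>stage D (len D)\<^esub> a \<in> I"
    and I_right: "b \<in> carrier (stage D (len D)) \<Longrightarrow> a \<in> I \<Longrightarrow> a \<otimes>\<^bsub>stage D (len D)\<^esub> b \<in> I"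
begin

lemma I_stage: "a \<in> I \<Longrightarrow> i \<le> len D \<Longrightarrow> a i \<in> carrier (C_at D i)"
  by (rule stage_at[OF subsetD[OF I_sub]])

lemma I_attach:
  assumes "a \<in> I" "Suc i \<le> len D"
  shows "attach_hom D (Suc i) (restrict a {..i}) = restrict (a (Suc i)) (attach_set D (Suc i))"
  by (rule stage_attach[OF subsetD[OF I_sub assms(1)] assms(2)])

lemma I_restrict: "a \<in> I \<Longrightarrow> i \<le> len D \<Longrightarrow> restrict a {..i} \<in> carrier (stage D i)"
  using stage_carrier_restrict[of i "len D" a D] subsetD[OF I_sub, of a] unfolding stage_simps(1) by simp

lemma vanish_on_attached_part:
  assumes a: "a \<in> carrier (stage D (len D))" "\<And>i. i < k \<Longrightarrow> a i = \<zero>\<^bsub>C_at D i\<^esub>"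
    and k: "k \<le> len D" and x: "x \<in> attached_part D k"
  shows "a k x = 0\<^sub>m (msize D k) (msize D k)"
proof (cases k)
  case 0
  then show ?thesis using x by (simp add: attached_part_def)
next
  case (Suc m)
  have m: "Suc m \<le> len D" using k Suc by simp
  interpret S: unital_cstar_algebra "stage D m" using m by (intro stage_cstar) simp
  interpret C0: unital_cstar_algebra "C0_at D (Suc m)" by (rule C0_at_cstar[OF m])
  have xs: "x \<in> attach_set D (Suc m)" using x Suc by (simp add: attached_part_def)
  have "restrict a {..m} = \<zero>\<^bsub>stage D m\<^esub>"
    unfolding stage_simps(4) using a(2) Suc by (intro restrict_ext) simp
  moreover have "attach_hom D (Suc m) \<zero>\<^bsub>stage D m\<^esub> = \<zero>\<^bsub>C0_at D (Suc m)\<^esub>"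
    using star_homD(5)[OF attach_hom[OF m] S.zero_closed, of 0] star_homD(1)[OF attach_hom[OF m] S.zero_closed] by simp
  moreover have "attach_hom D (Suc m) (restrict a {..m}) = restrict (a (Suc m)) (attach_set D (Suc m))"
    by (rule stage_attach[OF a(1) m])
  ultimately have "restrict (a (Suc m)) (attach_set D (Suc m)) x = \<zero>\<^bsub>C0_at D (Suc m)\<^esub> x"
    by (simp only:)
  then show ?thesis
    using xs attach_subset[OF m] Suc by (auto simp: C0_at_def C_mat_simps(4))
qed

text \<open>The \<open>k\<close>-th components of those elements of the ideal that vanish at all lower levels. Adding such an
element to another one corrects its \<open>k\<close>-th component and leaves the components below unchanged.\<close>

definition level :: "nat \<Rightarrow> ('x \<Rightarrow> complex mat) set" where
  "level k = {u. \<exists>a\<in>I. (\<forall>i<k. a i = \<zero>\<^bsub>C_at D i\<^esub>) \<and> a k = u}"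

text \<open>Multipliers on \<open>X\<^sub>k\<close> that vanish on the attached part lift to the whole algebra with zeros at the
lower levels, so that a product with them remains in the ideal and also vanishes at the lower levels.\<close>

lemma level_approximation:
  assumes k: "k \<le> len D" and g: "g \<in> carrier (C_at D k)" and e: "0 < e"
    and g_att: "\<And>x. x \<in> attached_part D k \<Longrightarrow> mat_opnorm (g x) < e"
    and g_zero: "\<And>x. x \<in> zero_set D I k \<Longrightarrow> mat_opnorm (g x) < e"
  shows "\<exists>u\<in>level k. \<forall>x\<in>topspace (space_at D k). mat_opnorm (g x + (-1) \<cdot>\<^sub>m u x) \<le> e"
proof -
  let ?R = "stage D (len D)"
  have Ci: "unital_cstar_algebra (C_at D i)" if "i \<le> k" for i
    using that k by (intro C_at_cstar) simp
  have levelI: "u \<in> level k" if "a \<in> I" "\<And>i. i < k \<Longrightarrow> a i = \<zero>\<^bsub>C_at D i\<^esub>" "a k = u" for a u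
    using that unfolding level_def by blast
  show ?thesis
  proof (rule C_mat_ideal_approximation[where L = "(\<lambda>a. a k) ` I" and Y = "attached_part D k"])
    show "compact_space (space_at D k)" "Hausdorff_space (space_at D k)" "1 \<le> msize D k"
      "closedin (space_at D k) (attached_part D k)"
      using k by (rule compact_at Hausdorff_at msize_ge_1 closedin_attached_part)+
    show "g \<in> carrier (C_mat (space_at D k) (msize D k))" using g unfolding C_at_def .
    show "(\<lambda>a. a k) ` I \<subseteq> carrier (C_mat (space_at D k) (msize D k))"
      using I_stage[OF _ k] unfolding C_at_def by blast
    have "\<zero>\<^bsub>C_at D k\<^esub> \<in> level k"
      by (rule levelI[OF I_zero]) (use k in \<open>simp_all add: stage_index_ops\<close>)
    then show "\<zero>\<^bsub>C_mat (space_at D k) (msize D k)\<^esub> \<in> level k" unfolding C_at_def .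
    show "u \<oplus>\<^bsub>C_mat (space_at D k) (msize D k)\<^esub> v \<in> level k" if uv: "u \<in> level k" "v \<in> level k" for u v
    proof -
      obtain a b where a: "a \<in> I" "\<forall>i<k. a i = \<zero>\<^bsub>C_at D i\<^esub>" "a k = u"
        and b: "b \<in> I" "\<forall>i<k. b i = \<zero>\<^bsub>C_at D i\<^esub>" "b k = v"
        using uv unfolding level_def by blast
      show ?thesis
      proof (rule levelI[OF I_add[OF a(1) b(1)]])
        show "(a \<oplus>\<^bsub>?R\<^esub> b) i = \<zero>\<^bsub>C_at D i\<^esub>" if i: "i < k" for i
        proof -
          interpret C: unital_cstar_algebra "C_at D i" using i by (intro Ci) simp
          show ?thesis using i k a(2) b(2) by (simp add: stage_index_ops)
        qed
        show "(a \<oplus>\<^bsub>?R\<^esub> b) k = u \<oplus>\<^bsub>C_mat (space_at D k) (msize D k)\<^esub> v"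
          using k a(3) b(3) by (simp add: stage_index_ops C_at_def)
      qed
    qed
    show "u x = 0\<^sub>m (msize D k) (msize D k)" if u: "u \<in> level k" and x: "x \<in> attached_part D k" for u x
    proof -
      obtain a where a: "a \<in> I" "\<forall>i<k. a i = \<zero>\<^bsub>C_at D i\<^esub>" "a k = u"
        using u unfolding level_def by blast
      have "a \<in> carrier ?R" using a(1) I_sub by blast
      from vanish_on_attached_part[OF this _ k x] a(2,3) show ?thesis by simp
    qed
    have zero_mult: "x \<otimes>\<^bsub>C_at D i\<^esub> y = \<zero>\<^bsub>C_at D i\<^esub>"
      if "i < k" "x = \<zero>\<^bsub>C_at D i\<^esub>" "y \<in> carrier (C_at D i)" for i x y
      using that Ci[of i] by (simp add: ring.ring_simprules(24)[OF unital_cstar_algebra.is_ring])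
    fix v assume "v \<in> carrier (C_mat (space_at D k) (msize D k))"
      and v0: "\<And>x. x \<in> attached_part D k \<Longrightarrow> v x = 0\<^sub>m (msize D k) (msize D k)"
    then have "v \<in> carrier (C_at D k)" unfolding C_at_def by blast
    from stage_lift[OF k this v0]
    obtain d where d: "d \<in> carrier ?R" "\<And>i. i < k \<Longrightarrow> d i = \<zero>\<^bsub>C_at D i\<^esub>" "d k = v" by blast
    have da: "(d \<otimes>\<^bsub>?R\<^esub> a) i = \<zero>\<^bsub>C_at D i\<^esub>" if "i < k" "a \<in> I" for i a
      using that k d(2) zero_mult I_stage[OF that(2), of i] by (simp add: stage_index_ops)
    show "v \<otimes>\<^bsub>C_mat (space_at D k) (msize D k)\<^esub> u \<in> level k" if u: "u \<in> level k" for u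
    proof -
      obtain a where a: "a \<in> I" "a k = u" using u unfolding level_def by blast
      show ?thesis
        by (rule levelI[OF I_left[OF d(1) a(1)] da[OF _ a(1)]])
          (use k d(3) a(2) in \<open>simp_all add: stage_index_ops C_at_def\<close>)
    qed
    fix w c assume "w \<in> carrier (C_mat (space_at D k) (msize D k))"
      and w0: "\<And>x. x \<in> attached_part D k \<Longrightarrow> w x = 0\<^sub>m (msize D k) (msize D k)"
      and c: "c \<in> (\<lambda>a. a k) ` I"
    then have "w \<in> carrier (C_at D k)" unfolding C_at_def by blast
    from stage_lift[OF k this w0]
    obtain d' where d': "d' \<in> carrier ?R" "\<And>i. i < k \<Longrightarrow> d' i = \<zero>\<^bsub>C_at D i\<^esub>" "d' k = w" by blast
    obtain a where a: "a \<in> I" "c = a k" using c by blast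
    have d'C: "d' i \<in> carrier (C_at D i)" if "i < k" for i
      using that k by (intro stage_at[OF d'(1)]) simp
    show "(v \<otimes>\<^bsub>C_mat (space_at D k) (msize D k)\<^esub> c) \<otimes>\<^bsub>C_mat (space_at D k) (msize D k)\<^esub> w \<in> level k"
    proof (rule levelI[OF I_right[OF d'(1) I_left[OF d(1) a(1)]]])
      show "((d \<otimes>\<^bsub>?R\<^esub> a) \<otimes>\<^bsub>?R\<^esub> d') i = \<zero>\<^bsub>C_at D i\<^esub>" if i: "i < k" for i
      proof -
        have "((d \<otimes>\<^bsub>?R\<^esub> a) \<otimes>\<^bsub>?R\<^esub> d') i = (d \<otimes>\<^bsub>?R\<^esub> a) i \<otimes>\<^bsub>C_at D i\<^esub> d' i"
          using i k by (intro stage_index_ops) simp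
        also have "\<dots> = \<zero>\<^bsub>C_at D i\<^esub>" by (rule zero_mult[OF i da[OF i a(1)] d'C[OF i]])
        finally show ?thesis .
      qed
      show "((d \<otimes>\<^bsub>?R\<^esub> a) \<otimes>\<^bsub>?R\<^esub> d') k
          = (v \<otimes>\<^bsub>C_mat (space_at D k) (msize D k)\<^esub> c) \<otimes>\<^bsub>C_mat (space_at D k) (msize D k)\<^esub> w"
        using k d(3) d'(3) a(2) by (simp add: stage_index_ops C_at_def)
    qed
  next
    show "mat_opnorm (g x) < e" if "x \<in> attached_part D k" for x by (rule g_att[OF that])
    show "mat_opnorm (g x) < e"
      if "x \<in> topspace (space_at D k)" "\<And>c. c \<in> (\<lambda>a. a k) ` I \<Longrightarrow> c x = 0\<^sub>m (msize D k) (msize D k)" for x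
      by (rule g_zero) (use that in \<open>auto simp: zero_set_def\<close>)
  qed (rule e)
qed

text \<open>Induction on the level. Let \<open>a\<close> in the ideal approximate \<open>b\<close> at the levels up to \<open>k\<close>. The attaching
map is contractive, so that \<open>a\<close> and \<open>b\<close> are also close on the attached part of level \<open>k + 1\<close>; there
the difference is below \<open>e\<close>, and on the zero set of level \<open>k + 1\<close> it is zero. Thus the difference
can be approximated by an element of the ideal that vanishes at the levels up to \<open>k\<close>, and adding
this element to \<open>a\<close> corrects level \<open>k + 1\<close> only.\<close>

lemma ideal_approximation:
  assumes "k \<le> len D" "b \<in> carrier (stage D k)"
    and "\<And>i x. i \<le> k \<Longrightarrow> x \<in> zero_set D I i \<Longrightarrow> b i x = 0\<^sub>m (msize D i) (msize D i)"
    and "0 < e"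
  shows "\<exists>a\<in>I. cnorm (stage D k) (b \<ominus>\<^bsub>stage D k\<^esub> restrict a {..k}) \<le> e"
  using assms
proof (induction k arbitrary: b e)
  have step: "\<exists>a'\<in>I. (\<forall>i<k. a' i = a i) \<and>
      (\<forall>x\<in>topspace (space_at D k). mat_opnorm (b k x + (-1) \<cdot>\<^sub>m a' k x) \<le> e)"
    if k: "k \<le> len D" and b: "b k \<in> carrier (C_at D k)"
      and bz: "\<And>x. x \<in> zero_set D I k \<Longrightarrow> b k x = 0\<^sub>m (msize D k) (msize D k)"
      and e: "0 < e" and a: "a \<in> I"
      and att: "\<And>x. x \<in> attached_part D k \<Longrightarrow> mat_opnorm (b k x + (-1) \<cdot>\<^sub>m a k x) < e"
    for k b e a
  proof -
    let ?n = "msize D k" and ?X = "space_at D k"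
    interpret C: unital_cstar_algebra "C_at D k" by (rule C_at_cstar[OF k])
    have ak: "a k \<in> carrier (C_at D k)" by (rule I_stage[OF a k])
    have bM: "b k x \<in> carrier_mat ?n ?n" and aM: "a k x \<in> carrier_mat ?n ?n" if "x \<in> topspace ?X" for x
      using C_mat_carrierD(1)[OF b[unfolded C_at_def] that] C_mat_carrierD(1)[OF ak[unfolded C_at_def] that] by simp_all
    define g where "g = b k \<oplus>\<^bsub>C_at D k\<^esub> (-1) \<odot>\<^bsub>C_at D k\<^esub> a k"
    have gx: "g x = b k x + (-1) \<cdot>\<^sub>m a k x" if "x \<in> topspace ?X" for x
      using that by (simp add: g_def C_at_def C_mat_simps(5,6))
    have g: "g \<in> carrier (C_at D k)" unfolding g_def using b ak by (intro C.ring_simps(1) C.smult_in)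
    have "\<exists>u\<in>level k. \<forall>x\<in>topspace ?X. mat_opnorm (g x + (-1) \<cdot>\<^sub>m u x) \<le> e"
    proof (rule level_approximation[OF k g e])
      fix x
      show "mat_opnorm (g x) < e" if x: "x \<in> attached_part D k"
      proof -
        have "x \<in> topspace ?X" using x closedin_subset[OF closedin_attached_part[OF k]] by blast
        then show ?thesis using att[OF x] gx by simp
      qed
      show "mat_opnorm (g x) < e" if x: "x \<in> zero_set D I k"
      proof -
        have "x \<in> topspace ?X" "a k x = 0\<^sub>m ?n ?n" using x a by (simp_all add: zero_set_def)
        then have "g x = 0\<^sub>m ?n ?n" using gx bz[OF x] by (intro eq_matI) simp_all
        then show ?thesis using e mat_opnorm_eq_0[of "0\<^sub>m ?n ?n" ?n] by simp
      qed
    qed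
    then obtain c where c: "c \<in> I" "\<forall>i<k. c i = \<zero>\<^bsub>C_at D i\<^esub>"
      "\<forall>x\<in>topspace ?X. mat_opnorm (g x + (-1) \<cdot>\<^sub>m c k x) \<le> e"
      unfolding level_def by blast
    have ck: "c k \<in> carrier (C_at D k)" by (rule I_stage[OF c(1) k])
    have "(a \<oplus>\<^bsub>stage D (len D)\<^esub> c) i = a i" if i: "i < k" for i
    proof -
      have il: "i \<le> len D" using i k by simp
      interpret Ci: unital_cstar_algebra "C_at D i" by (rule C_at_cstar[OF il])
      show ?thesis using c(2) i il I_stage[OF a il] by (simp add: stage_index_ops)
    qed
    moreover have "mat_opnorm (b k x + (-1) \<cdot>\<^sub>m (a \<oplus>\<^bsub>stage D (len D)\<^esub> c) k x) \<le> e"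
      if x: "x \<in> topspace ?X" for x
    proof -
      have cM: "c k x \<in> carrier_mat ?n ?n"
        using C_mat_carrierD(1)[OF ck[unfolded C_at_def] x] .
      have "(a \<oplus>\<^bsub>stage D (len D)\<^esub> c) k x = a k x + c k x"
        using k x by (simp add: stage_index_ops C_at_def C_mat_simps(5))
      then have "b k x + (-1) \<cdot>\<^sub>m (a \<oplus>\<^bsub>stage D (len D)\<^esub> c) k x = g x + (-1) \<cdot>\<^sub>m c k x"
        unfolding gx[OF x] using aM[OF x] bM[OF x] cM by (intro eq_matI) simp_all
      then show ?thesis using c(3) x by simp
    qed
    ultimately show ?thesis using I_add[OF a c(1)] by blast
  qed
  have norm_le: "cnorm (stage D k) (b \<ominus>\<^bsub>stage D k\<^esub> restrict a {..k}) \<le> e"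
    if k: "k \<le> len D" and b: "b \<in> carrier (stage D k)" and a: "a \<in> I" and e: "0 < e"
      and le: "\<And>i x. i \<le> k \<Longrightarrow> x \<in> topspace (space_at D i) \<Longrightarrow> mat_opnorm (b i x + (-1) \<cdot>\<^sub>m a i x) \<le> e"
    for k b a e
  proof (rule cnorm_stage_leI)
    interpret S: unital_cstar_algebra "stage D k" by (rule stage_cstar[OF k])
    fix i assume i: "i \<le> k"
    have "(b \<ominus>\<^bsub>stage D k\<^esub> restrict a {..k}) i = b i \<oplus>\<^bsub>C_at D i\<^esub> (-1) \<odot>\<^bsub>C_at D i\<^esub> a i"
      unfolding S.diff_eq_smult[OF b I_restrict[OF a k]] using i by (simp add: stage_index_ops)
    then show "cnorm (C_at D i) ((b \<ominus>\<^bsub>stage D k\<^esub> restrict a {..k}) i) \<le> e"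
      unfolding C_at_def using le[OF i] e by (simp only:) (intro cnorm_C_mat_leI; simp add: C_mat_simps(5,6))
  qed
  have diff_le: "mat_opnorm (b i x + (-1) \<cdot>\<^sub>m a i x) \<le> cnorm (stage D k) (b \<ominus>\<^bsub>stage D k\<^esub> restrict a {..k})"
    if k: "k \<le> len D" and b: "b \<in> carrier (stage D k)" and a: "a \<in> I"
      and i: "i \<le> k" and x: "x \<in> topspace (space_at D i)" for k b a i x
  proof -
    interpret S: unital_cstar_algebra "stage D k" by (rule stage_cstar[OF k])
    have il: "i \<le> len D" using i k by simp
    interpret C: unital_cstar_algebra "C_at D i" by (rule C_at_cstar[OF il])
    have bi: "b i \<in> carrier (C_at D i)" by (rule stage_at[OF b i])
    have eq: "(b \<ominus>\<^bsub>stage D k\<^esub> restrict a {..k}) i = b i \<oplus>\<^bsub>C_at D i\<^esub> (-1) \<odot>\<^bsub>C_at D i\<^esub> a i"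
      unfolding S.diff_eq_smult[OF b I_restrict[OF a k]] using i by (simp add: stage_index_ops)
    have mem: "b i \<oplus>\<^bsub>C_at D i\<^esub> (-1) \<odot>\<^bsub>C_at D i\<^esub> a i \<in> carrier (C_at D i)"
      using bi I_stage[OF a il] by (intro C.ring_simps(1) C.smult_in)
    have "mat_opnorm ((b i \<oplus>\<^bsub>C_at D i\<^esub> (-1) \<odot>\<^bsub>C_at D i\<^esub> a i) x)
        \<le> cnorm (C_at D i) (b i \<oplus>\<^bsub>C_at D i\<^esub> (-1) \<odot>\<^bsub>C_at D i\<^esub> a i)"
      using mat_opnorm_le_cnorm_C_mat[OF compact_at[OF il] mem[unfolded C_at_def] x] unfolding C_at_def .
    also have "\<dots> \<le> cnorm (stage D k) (b \<ominus>\<^bsub>stage D k\<^esub> restrict a {..k})"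
      unfolding eq[symmetric] by (rule cnorm_le_cnorm_stage[OF i])
    finally show ?thesis using x by (simp add: C_at_def C_mat_simps(5,6))
  qed
  {
    case 0
    have b0: "b 0 \<in> carrier (C_at D 0)" by (rule stage_at[OF 0(2)]) simp
    have "\<exists>a'\<in>I. (\<forall>i<0. a' i = \<zero>\<^bsub>stage D (len D)\<^esub> i) \<and>
        (\<forall>x\<in>topspace (space_at D 0). mat_opnorm (b 0 x + (-1) \<cdot>\<^sub>m a' 0 x) \<le> e)"
    proof (rule step[where k = 0 and b = b and e = e])
      show "b 0 x = 0\<^sub>m (msize D 0) (msize D 0)" if "x \<in> zero_set D I 0" for x
        by (rule 0(3)[OF order_refl that])
      show "mat_opnorm (b 0 x + (-1) \<cdot>\<^sub>m \<zero>\<^bsub>stage D (len D)\<^esub> 0 x) < e" if "x \<in> attached_part D 0" for x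
        using that by (simp add: attached_part_def)
    qed (rule b0 0(4) I_zero le0)+
    then obtain a where a: "a \<in> I" "\<forall>x\<in>topspace (space_at D 0). mat_opnorm (b 0 x + (-1) \<cdot>\<^sub>m a 0 x) \<le> e"
      by (elim bexE conjE)
    have "cnorm (stage D 0) (b \<ominus>\<^bsub>stage D 0\<^esub> restrict a {..0}) \<le> e"
      by (rule norm_le[OF 0(1,2) a(1) 0(4)]) (use a(2) in simp)
    then show ?case using a(1) by blast
  next
    case (Suc k)
    note k = Suc.prems(1)
    have k': "k \<le> len D" using k by simp
    have rb: "restrict b {..k} \<in> carrier (stage D k)"
      using stage_carrier_restrict[of k "Suc k" b D] Suc.prems(2) by (simp add: stage_simps(1))
    have bk: "b (Suc k) \<in> carrier (C_at D (Suc k))"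
      by (rule stage_at[OF Suc.prems(2) order_refl])
    have "\<exists>a\<in>I. cnorm (stage D k) (restrict b {..k} \<ominus>\<^bsub>stage D k\<^esub> restrict a {..k}) \<le> e / 2"
      by (rule Suc.IH[OF k' rb]) (use Suc.prems(3,4) in simp_all)
    then obtain a where a: "a \<in> I" "cnorm (stage D k) (restrict b {..k} \<ominus>\<^bsub>stage D k\<^esub> restrict a {..k}) \<le> e / 2"
      by blast
    have att: "mat_opnorm (b (Suc k) x + (-1) \<cdot>\<^sub>m a (Suc k) x) < e" if "x \<in> attached_part D (Suc k)" for x
    proof -
      have x: "x \<in> attach_set D (Suc k)" using that by (simp add: attached_part_def)
      note cs = stage_cstar[OF k'] C0_at_cstar[OF k]
      interpret C0: unital_cstar_algebra "C0_at D (Suc k)" by (rule cs(2))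
      let ?\<phi> = "attach_hom D (Suc k)"
      have ra: "restrict a {..k} \<in> carrier (stage D k)" by (rule I_restrict[OF a(1) k'])
      have in0: "?\<phi> (restrict b {..k}) \<in> carrier (C0_at D (Suc k))" "?\<phi> (restrict a {..k}) \<in> carrier (C0_at D (Suc k))"
        by (rule star_homD(1)[OF attach_hom[OF k]], fact rb ra)+
      have top: "topspace (subtopology (space_at D (Suc k)) (attach_set D (Suc k))) = attach_set D (Suc k)"
        using attach_subset[OF k] by auto
      have "?\<phi> (restrict b {..k}) = restrict (b (Suc k)) (attach_set D (Suc k))"
        by (rule stage_attach[OF Suc.prems(2) order_refl])
      moreover have "?\<phi> (restrict a {..k}) = restrict (a (Suc k)) (attach_set D (Suc k))"
        by (rule I_attach[OF a(1) k])
      ultimately have val: "(?\<phi> (restrict b {..k}) \<ominus>\<^bsub>C0_at D (Suc k)\<^esub> ?\<phi> (restrict a {..k})) x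
          = b (Suc k) x + (-1) \<cdot>\<^sub>m a (Suc k) x"
        unfolding C0.diff_eq_smult[OF in0] unfolding C0_at_def C_mat_simps(5,6) top using x by simp
      have "mat_opnorm ((?\<phi> (restrict b {..k}) \<ominus>\<^bsub>C0_at D (Suc k)\<^esub> ?\<phi> (restrict a {..k})) x)
          \<le> cnorm (C0_at D (Suc k)) (?\<phi> (restrict b {..k}) \<ominus>\<^bsub>C0_at D (Suc k)\<^esub> ?\<phi> (restrict a {..k}))"
        unfolding C0_at_def
      proof (rule mat_opnorm_le_cnorm_C_mat)
        show "compact_space (subtopology (space_at D (Suc k)) (attach_set D (Suc k)))"
          by (intro compact_space_subtopology closedin_compact_space compact_at closedin_attach k)
        show "?\<phi> (restrict b {..k}) \<ominus>\<^bsub>C_mat (subtopology (space_at D (Suc k)) (attach_set D (Suc k))) (msize D (Suc k))\<^esub> ?\<phi> (restrict a {..k})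
            \<in> carrier (C_mat (subtopology (space_at D (Suc k)) (attach_set D (Suc k))) (msize D (Suc k)))"
          using C0.diff_in[OF in0] unfolding C0_at_def .
        show "x \<in> topspace (subtopology (space_at D (Suc k)) (attach_set D (Suc k)))" unfolding top by (rule x)
      qed
      also have "\<dots> \<le> cnorm (stage D k) (restrict b {..k} \<ominus>\<^bsub>stage D k\<^esub> restrict a {..k})"
        by (rule star_hom_dist_le[OF cs attach_hom[OF k] rb ra])
      also have "\<dots> \<le> e / 2" by (rule a(2))
      also have "\<dots> < e" using Suc.prems(4) by simp
      finally show ?thesis unfolding val .
    qed
    have "\<exists>a'\<in>I. (\<forall>i<Suc k. a' i = a i) \<and>
        (\<forall>x\<in>topspace (space_at D (Suc k)). mat_opnorm (b (Suc k) x + (-1) \<cdot>\<^sub>m a' (Suc k) x) \<le> e)"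
      by (rule step[where k = "Suc k" and b = b and e = e and a = a, OF k bk Suc.prems(3)[OF order_refl] Suc.prems(4) a(1) att])
    then obtain a' where a': "a' \<in> I" "\<forall>i<Suc k. a' i = a i"
      "\<forall>x\<in>topspace (space_at D (Suc k)). mat_opnorm (b (Suc k) x + (-1) \<cdot>\<^sub>m a' (Suc k) x) \<le> e"
      by (elim bexE conjE)
    have "cnorm (stage D (Suc k)) (b \<ominus>\<^bsub>stage D (Suc k)\<^esub> restrict a' {..Suc k}) \<le> e"
    proof (rule norm_le[OF k Suc.prems(2) a'(1) Suc.prems(4)])
      fix i x assume i: "i \<le> Suc k" and x: "x \<in> topspace (space_at D i)"
      show "mat_opnorm (b i x + (-1) \<cdot>\<^sub>m a' i x) \<le> e"
      proof (cases "i = Suc k")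
        case True
        then show ?thesis using a'(3) x by simp
      next
        case False
        then have ik: "i \<le> k" using i by simp
        have "mat_opnorm (restrict b {..k} i x + (-1) \<cdot>\<^sub>m a i x) \<le> e / 2"
          by (rule order_trans[OF diff_le[OF k' rb a(1) ik x] a(2)])
        then show ?thesis using a'(2) ik Suc.prems(4) by simp
      qed
    qed
    then show ?case using a'(1) by blast
  }
qed

end

section \<open>The unitization as a C*-algebra\<close>

lemma unitization_simps:
  "carrier (unitization A I) = I \<times> UNIV"
  "mult (unitization A I) (x, c) (y, d) = (x \<otimes>\<^bsub>A\<^esub> y \<oplus>\<^bsub>A\<^esub> d \<odot>\<^bsub>A\<^esub> x \<oplus>\<^bsub>A\<^esub> c \<odot>\<^bsub>A\<^esub> y, c * d)"
  "one (unitization A I) = (\<zero>\<^bsub>A\<^esub>, 1)"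
  "zero (unitization A I) = (\<zero>\<^bsub>A\<^esub>, 0)"
  "add (unitization A I) (x, c) (y, d) = (x \<oplus>\<^bsub>A\<^esub> y, c + d)"
  "Module.smult (unitization A I) b (x, c) = (b \<odot>\<^bsub>A\<^esub> x, b * c)"
  "star (unitization A I) (x, c) = (star A x, cnj c)"
  "cnorm (unitization A I) (x, c) = max (cmod c)
       (SUP y \<in> {y \<in> I. cnorm A y \<le> 1}. cnorm A (x \<otimes>\<^bsub>A\<^esub> y \<oplus>\<^bsub>A\<^esub> c \<odot>\<^bsub>A\<^esub> y))"
  by (simp_all add: unitization_def)

locale cstar_closed_ideal = A: unital_cstar_algebra A for A :: "'a cstar" (structure) +
  fixes I :: "'a set"
  assumes closed: "closed_ideal I A"
begin

lemma I_ideal: "ideal I A"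
  using closed by (simp add: closed_ideal_def)

lemma I_carrier: "x \<in> I \<Longrightarrow> x \<in> carrier A"
  using ideal.axioms(1)[OF I_ideal] by (rule additive_subgroup.a_Hcarr)

lemma I_zero: "\<zero> \<in> I"
  using ideal.axioms(1)[OF I_ideal] by (rule additive_subgroup.zero_closed)

lemma I_add: "x \<in> I \<Longrightarrow> y \<in> I \<Longrightarrow> x \<oplus> y \<in> I"
  using ideal.axioms(1)[OF I_ideal] by (rule additive_subgroup.a_closed)

lemma I_mult: "x \<in> I \<Longrightarrow> y \<in> I \<Longrightarrow> x \<otimes> y \<in> I"
  using ideal.I_l_closed[OF I_ideal] I_carrier by blast

lemma I_smult: "x \<in> I \<Longrightarrow> c \<odot> x \<in> I"
proof -
  assume x: "x \<in> I"
  have "(c \<odot> \<one>) \<otimes> x \<in> I" by (rule ideal.I_l_closed[OF I_ideal x]) simp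
  then show ?thesis using I_carrier[OF x] by (simp add: A.smult_mult_left)
qed

lemma I_limit:
  assumes \<sigma>: "\<And>n::nat. \<sigma> n \<in> I" and x: "x \<in> carrier A" and lim: "(\<lambda>n. cnorm A (\<sigma> n \<ominus> x)) \<longlonglongrightarrow> 0"
  shows "x \<in> I"
proof -
  interpret D: Metric_space "carrier A" "cdist A" by (rule A.Metric_space_cdist)
  have clo: "closedin D.mtopology I" using closed by (simp add: closed_ideal_def ctopology_def)
  have "limitin D.mtopology \<sigma> x sequentially"
    unfolding D.limit_metric_sequentially
  proof (intro conjI allI impI x)
    fix e :: real assume "0 < e"
    then obtain N where "\<And>n. n \<ge> N \<Longrightarrow> cnorm A (\<sigma> n \<ominus> x) < e"
      using order_tendstoD(2)[OF lim] by (auto simp: eventually_sequentially)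
    then show "\<exists>N. \<forall>n\<ge>N. \<sigma> n \<in> carrier A \<and> cdist A (\<sigma> n) x < e"
      using I_carrier[OF \<sigma>] x by (intro exI[of _ N]) (simp add: cdist_def)
  qed
  then show ?thesis
    by (rule limitin_closedin[OF _ clo]) (simp_all add: \<sigma>)
qed

end

locale cstar_closed_star_ideal = cstar_closed_ideal +
  assumes I_star: "x \<in> I \<Longrightarrow> star A x \<in> I"
begin

text \<open>The action of \<open>(x, c)\<close> on \<open>I\<close> as left multiplication by \<open>x + c 1\<close>. The map from \<open>I\<^sup>+\<close> to
operators on \<open>I\<close> is multiplicative and compatible with adjoints (\<open>star_act_mult\<close>), so that its
operator norm is a seminorm with the C*-identity. If \<open>I\<close> has a unit \<open>e\<close>, it vanishes at
\<open>(e, -1)\<close>, and only the maximum with the modulus of the scalar is a norm.\<close>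

definition act :: "'a \<times> complex \<Rightarrow> 'a \<Rightarrow> 'a" where
  "act z y = fst z \<otimes> y \<oplus> snd z \<odot> y"

definition act_norm :: "'a \<times> complex \<Rightarrow> real" where
  "act_norm z = (SUP y \<in> {y \<in> I. cnorm A y \<le> 1}. cnorm A (act z y))"

lemma cnorm_unitization: "cnorm (unitization A I) z = max (cmod (snd z)) (act_norm z)"
  by (cases z) (simp add: unitization_simps act_norm_def act_def)

lemmas AC = A.add_assoc A.add_comm A.ring_simps(22)
lemmas expand = A.distrib_left A.distrib_right A.smult_mult_left A.smult_mult_right A.smult_distrib
  A.smult_smult A.mult_assoc A.smult_add

lemma act_in: "fst z \<in> I \<Longrightarrow> y \<in> I \<Longrightarrow> act z y \<in> I"
  by (simp add: act_def I_add I_mult I_smult)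

lemma act_add:
  assumes "x \<in> I" "x' \<in> I" "y \<in> I"
  shows "act ((x, c) \<oplus>\<^bsub>unitization A I\<^esub> (x', c')) y = act (x, c) y \<oplus> act (x', c') y"
  using assms[THEN I_carrier] by (simp add: act_def unitization_simps expand AC)

lemma act_mult:
  assumes "x \<in> I" "x' \<in> I" "y \<in> I"
  shows "act ((x, c) \<otimes>\<^bsub>unitization A I\<^esub> (x', c')) y = act (x, c) (act (x', c') y)"
  using assms[THEN I_carrier] by (simp add: act_def unitization_simps expand AC)

lemma act_smult:
  assumes "x \<in> I" "y \<in> I"
  shows "act (b \<odot>\<^bsub>unitization A I\<^esub> (x, c)) y = b \<odot> act (x, c) y"
  using assms[THEN I_carrier] by (simp add: act_def unitization_simps expand)

lemma star_act_mult:
  assumes "x \<in> I" "y \<in> I" "u \<in> I"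
  shows "star A (act (x, c) y) \<otimes> u = star A y \<otimes> act (star (unitization A I) (x, c)) u"
  using assms[THEN I_carrier]
  by (simp add: act_def unitization_simps A.star_add A.star_mult A.star_smult expand AC)

lemma cnorm_act_le:
  assumes z: "fst z \<in> I" and y: "y \<in> I"
  shows "cnorm A (act z y) \<le> (cnorm A (fst z) + cmod (snd z)) * cnorm A y"
proof -
  have "cnorm A (act z y) \<le> cnorm A (fst z \<otimes> y) + cnorm A (snd z \<odot> y)"
    unfolding act_def using assms[THEN I_carrier] by (intro A.cnorm_triangle) auto
  then show ?thesis
    using A.cnorm_mult[OF assms[THEN I_carrier]] I_carrier[OF y] by (simp add: A.cnorm_smult algebra_simps)
qed

lemma bdd_act:
  assumes z: "fst z \<in> I"
  shows "bdd_above ((\<lambda>y. cnorm A (act z y)) ` {y \<in> I. cnorm A y \<le> 1})"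
proof (rule bdd_aboveI2)
  fix y assume y: "y \<in> {y \<in> I. cnorm A y \<le> 1}"
  then have "cnorm A (act z y) \<le> (cnorm A (fst z) + cmod (snd z)) * cnorm A y"
    using z by (intro cnorm_act_le) simp_all
  also have "\<dots> \<le> (cnorm A (fst z) + cmod (snd z)) * 1"
    using y A.cnorm_nonneg[OF I_carrier[OF z]] by (intro mult_left_mono) simp_all
  finally show "cnorm A (act z y) \<le> (cnorm A (fst z) + cmod (snd z)) * 1" .
qed

lemma act_norm_nonneg:
  assumes z: "fst z \<in> I" shows "0 \<le> act_norm z"
proof -
  have "cnorm A (act z \<zero>) \<le> act_norm z"
    unfolding act_norm_def by (intro cSUP_upper bdd_act z) (simp add: I_zero)
  moreover have "0 \<le> cnorm A (act z \<zero>)"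
    by (intro A.cnorm_nonneg I_carrier act_in z I_zero)
  ultimately show ?thesis by linarith
qed

lemma cnorm_act_le_act_norm:
  assumes z: "fst z \<in> I" and y: "y \<in> I"
  shows "cnorm A (act z y) \<le> act_norm z * cnorm A y"
proof (cases "cnorm A y = 0")
  case True
  then show ?thesis using cnorm_act_le[OF z y] by simp
next
  case False
  then have pos: "cnorm A y > 0" using A.cnorm_nonneg[OF I_carrier[OF y]] by linarith
  define w where "w = complex_of_real (1 / cnorm A y) \<odot> y"
  have w: "w \<in> I" "cnorm A w \<le> 1"
    using y pos by (simp_all add: w_def I_smult A.cnorm_smult I_carrier norm_divide)
  have "cnorm A (act z w) \<le> act_norm z"
    unfolding act_norm_def using w by (intro cSUP_upper bdd_act z) simp
  moreover have "act z w = complex_of_real (1 / cnorm A y) \<odot> act z y"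
    using I_carrier[OF y] I_carrier[OF z] by (simp add: act_def w_def expand mult.commute)
  ultimately show ?thesis
    using pos I_carrier[OF act_in[OF z y]] by (simp add: A.cnorm_smult norm_divide field_simps)
qed

lemma act_norm_leI:
  assumes K: "0 \<le> K" and le: "\<And>y. y \<in> I \<Longrightarrow> cnorm A (act z y) \<le> K * cnorm A y"
  shows "act_norm z \<le> K"
  unfolding act_norm_def
proof (rule cSUP_least)
  show "{y \<in> I. cnorm A y \<le> 1} \<noteq> {}" using I_zero by (auto intro!: exI[of _ \<zero>])
  fix y assume y: "y \<in> {y \<in> I. cnorm A y \<le> 1}"
  then have "cnorm A (act z y) \<le> K * cnorm A y" by (intro le) simp
  also have "\<dots> \<le> K * 1" using y K by (intro mult_left_mono) simp_all
  finally show "cnorm A (act z y) \<le> K" by simp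
qed

text \<open>The element \<open>x\<^sup>*\<close> of \<open>I\<close> detects the norm of \<open>x\<close>, since \<open>\<parallel>x x\<^sup>*\<parallel> = \<parallel>x\<parallel>\<^sup>2\<close>.\<close>

lemma cnorm_le_act_norm:
  assumes x: "x \<in> I" shows "cnorm A x \<le> act_norm (x, 0)"
proof (cases "cnorm A x = 0")
  case False
  have xc: "x \<in> carrier A" by (rule I_carrier[OF x])
  have "cnorm A (x \<otimes> star A x) = (cnorm A x)\<^sup>2"
    using A.cstar_identity[of "star A x"] xc by (simp add: A.star_star)
  moreover have "cnorm A (x \<otimes> star A x) \<le> act_norm (x, 0) * cnorm A x"
    using cnorm_act_le_act_norm[of "(x, 0)" "star A x"] x xc by (simp add: act_def I_star)
  ultimately show ?thesis using False A.cnorm_nonneg[OF xc] by (simp add: power2_eq_square)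
qed (use act_norm_nonneg[of "(x, 0)"] x in simp)

abbreviation (input) U where "U \<equiv> unitization A I"

lemma act_norm_mult:
  assumes "x \<in> I" "x' \<in> I"
  shows "act_norm ((x, c) \<otimes>\<^bsub>U\<^esub> (x', c')) \<le> act_norm (x, c) * act_norm (x', c')"
proof (rule act_norm_leI)
  fix y assume y: "y \<in> I"
  have "cnorm A (act (x, c) (act (x', c') y)) \<le> act_norm (x, c) * cnorm A (act (x', c') y)"
    using assms y by (intro cnorm_act_le_act_norm act_in) simp_all
  also have "\<dots> \<le> act_norm (x, c) * (act_norm (x', c') * cnorm A y)"
    using assms y by (intro mult_left_mono cnorm_act_le_act_norm act_norm_nonneg) simp_all
  finally show "cnorm A (act ((x, c) \<otimes>\<^bsub>U\<^esub> (x', c')) y) \<le> act_norm (x, c) * act_norm (x', c') * cnorm A y"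
    using assms y by (simp add: act_mult)
qed (use assms in \<open>simp add: act_norm_nonneg\<close>)

lemma mult_in_I: "x \<in> I \<Longrightarrow> x' \<in> I \<Longrightarrow> fst ((x, c) \<otimes>\<^bsub>U\<^esub> (x', c')) \<in> I"
  by (simp add: unitization_simps I_add I_mult I_smult)

text \<open>As for operators on a Hilbert space, with \<open>y\<^sup>* z\<close> in the role of the inner product:
\<open>\<parallel>w y\<parallel>\<^sup>2 = \<parallel>(w y)\<^sup>* (w y)\<parallel> = \<parallel>y\<^sup>* (w\<^sup>* w y)\<parallel>\<close>.\<close>

lemma act_norm_square_le:
  assumes x: "x \<in> I"
  shows "(act_norm (x, c))\<^sup>2 \<le> act_norm (star U (x, c) \<otimes>\<^bsub>U\<^esub> (x, c))"
proof -
  let ?w = "star U (x, c) \<otimes>\<^bsub>U\<^esub> (x, c)"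
  have w: "fst ?w \<in> I" unfolding unitization_simps(7) by (intro mult_in_I I_star x)
  have act_w: "act ?w y = act (star U (x, c)) (act (x, c) y)" if "y \<in> I" for y
    unfolding unitization_simps(7) by (intro act_mult I_star x that)
  have "act_norm (x, c) \<le> sqrt (act_norm ?w)"
  proof (rule act_norm_leI)
    fix y assume y: "y \<in> I"
    have yc: "y \<in> carrier A" by (rule I_carrier[OF y])
    have a: "act (x, c) y \<in> I" using x y by (intro act_in) simp_all
    have aw: "act ?w y \<in> carrier A" by (intro I_carrier act_in w y)
    have "(cnorm A (act (x, c) y))\<^sup>2 = cnorm A (star A (act (x, c) y) \<otimes> act (x, c) y)"
      using A.cstar_identity[OF I_carrier[OF a]] by simp
    also have "\<dots> = cnorm A (star A y \<otimes> act ?w y)"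
      unfolding star_act_mult[OF x y a] act_w[OF y] ..
    also have "\<dots> \<le> cnorm A y * cnorm A (act ?w y)"
      using A.cnorm_mult[OF A.star_in[OF yc] aw] yc by simp
    also have "\<dots> \<le> cnorm A y * (act_norm ?w * cnorm A y)"
      by (intro mult_left_mono cnorm_act_le_act_norm w y A.cnorm_nonneg yc)
    also have "\<dots> = act_norm ?w * (cnorm A y)\<^sup>2" by (simp add: power2_eq_square)
    finally have "cnorm A (act (x, c) y) \<le> sqrt (act_norm ?w * (cnorm A y)\<^sup>2)" by (rule real_le_rsqrt)
    then show "cnorm A (act (x, c) y) \<le> sqrt (act_norm ?w) * cnorm A y"
      using A.cnorm_nonneg[OF yc] by (simp add: real_sqrt_mult)
  qed (simp add: act_norm_nonneg[OF w])
  then have "(act_norm (x, c))\<^sup>2 \<le> (sqrt (act_norm ?w))\<^sup>2"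
    using act_norm_nonneg[of "(x, c)"] x by (intro power_mono) simp_all
  then show ?thesis using act_norm_nonneg[OF w] by simp
qed

lemma act_norm_star_mult:
  assumes x: "x \<in> I"
  shows "act_norm (star U (x, c) \<otimes>\<^bsub>U\<^esub> (x, c)) = (act_norm (x, c))\<^sup>2"
proof (rule antisym[OF _ act_norm_square_le[OF x]])
  have le: "act_norm (star U (x, c) \<otimes>\<^bsub>U\<^esub> (x, c)) \<le> act_norm (star U (x, c)) * act_norm (x, c)"
    if "x \<in> I" for x c
    unfolding unitization_simps(7) using that by (intro act_norm_mult I_star)
  have star_le: "act_norm (x, c) \<le> act_norm (star U (x, c))" if x: "x \<in> I" for x c
  proof (cases "act_norm (x, c) = 0")
    case True
    then show ?thesis using act_norm_nonneg[of "star U (x, c)"] I_star[OF x] by (simp add: unitization_simps)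
  next
    case False
    then have pos: "0 < act_norm (x, c)" using act_norm_nonneg[of "(x, c)"] x by simp
    have "act_norm (x, c) * act_norm (x, c) \<le> act_norm (star U (x, c)) * act_norm (x, c)"
      using order_trans[OF act_norm_square_le[OF x] le[OF x], of c] by (simp add: power2_eq_square)
    then show ?thesis using pos by (rule mult_right_le_imp_le)
  qed
  have "act_norm (star U (x, c)) \<le> act_norm (x, c)"
    using star_le[OF I_star[OF x], of "cnj c"] I_carrier[OF x] by (simp add: unitization_simps A.star_star)
  then have "act_norm (star U (x, c)) * act_norm (x, c) \<le> act_norm (x, c) * act_norm (x, c)"
    using act_norm_nonneg[of "(x, c)"] x by (intro mult_right_mono) simp_all
  then show "act_norm (star U (x, c) \<otimes>\<^bsub>U\<^esub> (x, c)) \<le> (act_norm (x, c))\<^sup>2"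
    using le[OF x, of c] by (simp add: power2_eq_square)
qed

lemma act_norm_add:
  assumes "x \<in> I" "x' \<in> I"
  shows "act_norm ((x, c) \<oplus>\<^bsub>U\<^esub> (x', c')) \<le> act_norm (x, c) + act_norm (x', c')"
proof (rule act_norm_leI)
  fix y assume y: "y \<in> I"
  have "cnorm A (act (x, c) y \<oplus> act (x', c') y) \<le> cnorm A (act (x, c) y) + cnorm A (act (x', c') y)"
    using assms y by (intro A.cnorm_triangle I_carrier act_in) simp_all
  also have "\<dots> \<le> act_norm (x, c) * cnorm A y + act_norm (x', c') * cnorm A y"
    using assms y by (intro add_mono cnorm_act_le_act_norm) simp_all
  finally show "cnorm A (act ((x, c) \<oplus>\<^bsub>U\<^esub> (x', c')) y) \<le> (act_norm (x, c) + act_norm (x', c')) * cnorm A y"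
    using assms y by (simp add: act_add distrib_right)
qed (use assms in \<open>simp add: act_norm_nonneg\<close>)

lemma act_norm_smult_le:
  assumes "x \<in> I"
  shows "act_norm (b \<odot>\<^bsub>U\<^esub> (x, c)) \<le> cmod b * act_norm (x, c)"
proof (rule act_norm_leI)
  fix y assume y: "y \<in> I"
  have "cnorm A (act (x, c) y) \<le> act_norm (x, c) * cnorm A y"
    using assms y by (intro cnorm_act_le_act_norm) simp_all
  then show "cnorm A (act (b \<odot>\<^bsub>U\<^esub> (x, c)) y) \<le> cmod b * act_norm (x, c) * cnorm A y"
    using assms y I_carrier[OF act_in[of "(x, c)" y]]
    by (simp add: act_smult A.cnorm_smult mult.assoc mult_left_mono)
qed (use assms in \<open>simp add: act_norm_nonneg\<close>)

lemma act_norm_smult: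
  assumes x: "x \<in> I"
  shows "act_norm (b \<odot>\<^bsub>U\<^esub> (x, c)) = cmod b * act_norm (x, c)"
proof (rule antisym[OF act_norm_smult_le[OF x]])
  show "cmod b * act_norm (x, c) \<le> act_norm (b \<odot>\<^bsub>U\<^esub> (x, c))"
  proof (cases "b = 0")
    case True
    then show ?thesis using act_norm_nonneg[of "b \<odot>\<^bsub>U\<^esub> (x, c)"] x by (simp add: unitization_simps I_smult I_zero)
  next
    case False
    have "(1 / b) \<odot>\<^bsub>U\<^esub> (b \<odot>\<^bsub>U\<^esub> (x, c)) = (x, c)"
      using False I_carrier[OF x] by (simp add: unitization_simps A.smult_smult)
    then have "act_norm (x, c) \<le> cmod (1 / b) * act_norm (b \<odot>\<^bsub>U\<^esub> (x, c))"
      using act_norm_smult_le[OF I_smult[OF x], of "1 / b" b "b * c"] by (simp add: unitization_simps)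
    then show ?thesis using False by (simp add: norm_divide field_simps)
  qed
qed

lemma act_norm_le: "x \<in> I \<Longrightarrow> act_norm (x, c) \<le> cnorm A x + cmod c"
  using cnorm_act_le[of "(x, c)"] A.cnorm_nonneg[OF I_carrier] by (intro act_norm_leI) simp_all

theorem unitization_cstar_algebra: "unital_cstar_algebra U"
proof (rule unital_cstar_algebraI, unfold unitization_simps(1))
  note S = unitization_simps
  show "\<zero>\<^bsub>U\<^esub> \<in> I \<times> UNIV" "\<one>\<^bsub>U\<^esub> \<in> I \<times> UNIV" by (simp_all add: S I_zero)
  fix z assume "z \<in> I \<times> (UNIV :: complex set)"
  then obtain x c where z: "z = (x, c)" and x: "x \<in> I" by auto
  have xc: "x \<in> carrier A" by (rule I_carrier[OF x])
  show "b \<odot>\<^bsub>U\<^esub> z \<in> I \<times> UNIV" for b by (simp add: z S I_smult x)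
  show "star U z \<in> I \<times> UNIV" by (simp add: z S I_star x)
  show "\<zero>\<^bsub>U\<^esub> \<oplus>\<^bsub>U\<^esub> z = z" using xc by (simp add: z S)
  show "(-1) \<odot>\<^bsub>U\<^esub> z \<oplus>\<^bsub>U\<^esub> z = \<zero>\<^bsub>U\<^esub>"
    using xc A.smult_add[OF xc, of "-1" 1] by (simp add: z S)
  show "\<one>\<^bsub>U\<^esub> \<otimes>\<^bsub>U\<^esub> z = z" using xc by (simp add: z S A.ring_simps(24))
  show "z \<otimes>\<^bsub>U\<^esub> \<one>\<^bsub>U\<^esub> = z" using xc by (simp add: z S A.ring_simps(25))
  show "(b + b') \<odot>\<^bsub>U\<^esub> z = b \<odot>\<^bsub>U\<^esub> z \<oplus>\<^bsub>U\<^esub> b' \<odot>\<^bsub>U\<^esub> z" for b b'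
    using xc by (simp add: z S A.smult_add distrib_right)
  show "(b * b') \<odot>\<^bsub>U\<^esub> z = b \<odot>\<^bsub>U\<^esub> (b' \<odot>\<^bsub>U\<^esub> z)" for b b'
    using xc by (simp add: z S A.smult_smult)
  show "1 \<odot>\<^bsub>U\<^esub> z = z" using xc by (simp add: z S)
  show "star U (star U z) = z" using xc by (simp add: z S A.star_star)
  show "star U (b \<odot>\<^bsub>U\<^esub> z) = cnj b \<odot>\<^bsub>U\<^esub> star U z" for b using xc by (simp add: z S A.star_smult)
  show nonneg: "0 \<le> cnorm U z" unfolding cnorm_unitization z by (simp add: le_max_iff_disj)
  show "cnorm U z = 0 \<longleftrightarrow> z = \<zero>\<^bsub>U\<^esub>"
  proof
    assume "cnorm U z = 0"
    then have "max (cmod c) (act_norm (x, c)) = 0" unfolding cnorm_unitization z by simp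
    then have "cmod c \<le> 0" "act_norm (x, c) \<le> 0" by linarith+
    then have c: "c = 0" and "act_norm (x, 0) \<le> 0" by auto
    then have "cnorm A x = 0" using cnorm_le_act_norm[OF x] A.cnorm_nonneg[OF xc] by linarith
    then show "z = \<zero>\<^bsub>U\<^esub>" using c xc by (simp add: z S A.cnorm_eq_0)
  next
    assume "z = \<zero>\<^bsub>U\<^esub>"
    then have "cnorm U z \<le> 0"
      using act_norm_le[OF I_zero, of 0] unfolding cnorm_unitization by (simp add: S)
    then show "cnorm U z = 0" using nonneg by simp
  qed
  show "cnorm U (b \<odot>\<^bsub>U\<^esub> z) = cmod b * cnorm U z" for b
    unfolding cnorm_unitization z act_norm_smult[OF x] using max_mult_distrib_left[of "cmod b" "cmod c" "act_norm (x, c)"]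
    by (simp add: S norm_mult)
  show "cnorm U (star U z \<otimes>\<^bsub>U\<^esub> z) = (cnorm U z)\<^sup>2"
  proof -
    have T: "0 \<le> act_norm (x, c)" using x by (intro act_norm_nonneg) simp
    have "max (cmod c * cmod c) (act_norm (x, c) * act_norm (x, c)) = max (cmod c) (act_norm (x, c)) * max (cmod c) (act_norm (x, c))"
      using T by (simp add: max_def mult_mono mult_mono' antisym not_le less_imp_le)
    then show ?thesis
      unfolding cnorm_unitization z act_norm_star_mult[OF x] by (simp add: S norm_mult power2_eq_square)
  qed
  fix w assume "w \<in> I \<times> (UNIV :: complex set)"
  then obtain y d where w: "w = (y, d)" and y: "y \<in> I" by auto
  have yc: "y \<in> carrier A" by (rule I_carrier[OF y])
  show "z \<oplus>\<^bsub>U\<^esub> w \<in> I \<times> UNIV" using x y by (simp add: z w S I_add)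
  show "z \<otimes>\<^bsub>U\<^esub> w \<in> I \<times> UNIV" using x y by (simp add: z w S I_add I_mult I_smult)
  show "z \<oplus>\<^bsub>U\<^esub> w = w \<oplus>\<^bsub>U\<^esub> z" using xc yc by (simp add: z w S A.add_comm add.commute)
  show "b \<odot>\<^bsub>U\<^esub> (z \<oplus>\<^bsub>U\<^esub> w) = b \<odot>\<^bsub>U\<^esub> z \<oplus>\<^bsub>U\<^esub> b \<odot>\<^bsub>U\<^esub> w" for b
    using xc yc by (simp add: z w S A.smult_distrib distrib_left)
  show "(b \<odot>\<^bsub>U\<^esub> z) \<otimes>\<^bsub>U\<^esub> w = b \<odot>\<^bsub>U\<^esub> (z \<otimes>\<^bsub>U\<^esub> w)" for b
    using xc yc by (simp add: z w S expand mult.commute mult.left_commute)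
  show "z \<otimes>\<^bsub>U\<^esub> (b \<odot>\<^bsub>U\<^esub> w) = b \<odot>\<^bsub>U\<^esub> (z \<otimes>\<^bsub>U\<^esub> w)" for b
    using xc yc by (simp add: z w S expand mult.commute mult.left_commute)
  show "star U (z \<oplus>\<^bsub>U\<^esub> w) = star U z \<oplus>\<^bsub>U\<^esub> star U w"
    using xc yc by (simp add: z w S A.star_add)
  show "star U (z \<otimes>\<^bsub>U\<^esub> w) = star U w \<otimes>\<^bsub>U\<^esub> star U z"
    using xc yc by (simp add: z w S A.star_add A.star_mult A.star_smult AC mult.commute)
  show "cnorm U (z \<oplus>\<^bsub>U\<^esub> w) \<le> cnorm U z + cnorm U w"
    unfolding cnorm_unitization z w using act_norm_add[OF x y, of c d] norm_triangle_ineq[of c d]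
    by (simp add: S) linarith
  show "cnorm U (z \<otimes>\<^bsub>U\<^esub> w) \<le> cnorm U z * cnorm U w"
  proof -
    have T: "0 \<le> act_norm (x, c)" "0 \<le> act_norm (y, d)" using x y by (intro act_norm_nonneg; simp)+
    have "act_norm ((x, c) \<otimes>\<^bsub>U\<^esub> (y, d)) \<le> cnorm U z * cnorm U w"
      unfolding cnorm_unitization z w
      by (rule order_trans[OF act_norm_mult[OF x y]]) (intro mult_mono; simp add: T le_max_iff_disj)
    moreover have "cmod (c * d) \<le> cnorm U z * cnorm U w"
      unfolding cnorm_unitization z w norm_mult by (intro mult_mono; simp add: le_max_iff_disj)
    ultimately show ?thesis unfolding cnorm_unitization[of "z \<otimes>\<^bsub>U\<^esub> w"] by (simp add: z w S)
  qed
  fix v assume "v \<in> I \<times> (UNIV :: complex set)"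
  then obtain u e where v: "v = (u, e)" and u: "u \<in> I" by auto
  have uc: "u \<in> carrier A" by (rule I_carrier[OF u])
  show "(z \<oplus>\<^bsub>U\<^esub> w) \<oplus>\<^bsub>U\<^esub> v = z \<oplus>\<^bsub>U\<^esub> (w \<oplus>\<^bsub>U\<^esub> v)"
    using xc yc uc by (simp add: z w v S A.add_assoc add.assoc)
  show "(z \<otimes>\<^bsub>U\<^esub> w) \<otimes>\<^bsub>U\<^esub> v = z \<otimes>\<^bsub>U\<^esub> (w \<otimes>\<^bsub>U\<^esub> v)"
    using xc yc uc by (simp add: z w v S expand AC mult_ac)
  show "(z \<oplus>\<^bsub>U\<^esub> w) \<otimes>\<^bsub>U\<^esub> v = z \<otimes>\<^bsub>U\<^esub> v \<oplus>\<^bsub>U\<^esub> w \<otimes>\<^bsub>U\<^esub> v"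
    using xc yc uc by (simp add: z w v S expand AC distrib_right)
  show "v \<otimes>\<^bsub>U\<^esub> (z \<oplus>\<^bsub>U\<^esub> w) = v \<otimes>\<^bsub>U\<^esub> z \<oplus>\<^bsub>U\<^esub> v \<otimes>\<^bsub>U\<^esub> w"
    using xc yc uc by (simp add: z w v S expand AC distrib_left)
next
  note S = unitization_simps
  fix \<sigma> :: "nat \<Rightarrow> 'a \<times> complex"
  assume \<sigma>: "\<And>n. \<sigma> n \<in> I \<times> UNIV"
    and C: "\<And>e. 0 < e \<Longrightarrow> \<exists>N. \<forall>m\<ge>N. \<forall>n\<ge>N. cnorm U (\<sigma> m \<oplus>\<^bsub>U\<^esub> (-1) \<odot>\<^bsub>U\<^esub> \<sigma> n) < e"
  define x where "x = (\<lambda>n. fst (\<sigma> n))"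
  define c where "c = (\<lambda>n. snd (\<sigma> n))"
  have \<sigma>_eq: "\<sigma> n = (x n, c n)" for n by (simp add: x_def c_def)
  have x: "x n \<in> I" for n using \<sigma>[of n] by (simp add: \<sigma>_eq)
  have xc: "x n \<in> carrier A" for n by (rule I_carrier[OF x])
  have diff: "(x', c') \<oplus>\<^bsub>U\<^esub> (-1) \<odot>\<^bsub>U\<^esub> (y', d') = (x' \<ominus> y', c' - d')"
    if "x' \<in> carrier A" "y' \<in> carrier A" for x' y' c' d'
    using that by (simp add: S A.diff_eq_smult)
  have I_diff: "x' \<ominus> y' \<in> I" if "x' \<in> I" "y' \<in> I" for x' y'
    using that by (simp add: A.diff_eq_smult I_carrier I_add I_smult)
  have c_le: "cmod (c m - c n) \<le> cnorm U (\<sigma> m \<oplus>\<^bsub>U\<^esub> (-1) \<odot>\<^bsub>U\<^esub> \<sigma> n)" for m n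
    unfolding cnorm_unitization \<sigma>_eq diff[OF xc xc] by simp
  \<comment> \<open>From \<open>(x, 0) = (x, c) + (0, -c)\<close> the norm of \<open>x\<close> is at most twice that of \<open>(x, c)\<close>, so that a
    Cauchy sequence in the unitization has Cauchy components.\<close>
  have x_le: "cnorm A (x m \<ominus> x n) \<le> 2 * cnorm U (\<sigma> m \<oplus>\<^bsub>U\<^esub> (-1) \<odot>\<^bsub>U\<^esub> \<sigma> n)" for m n
  proof -
    let ?d = "x m \<ominus> x n" and ?k = "c m - c n"
    have d: "?d \<in> I" by (intro I_diff x)
    have "(?d, ?k) \<oplus>\<^bsub>U\<^esub> (\<zero>, - ?k) = (?d, 0)"
      using I_carrier[OF d] by (simp add: S)
    then have "act_norm (?d, 0) \<le> act_norm (?d, ?k) + act_norm (\<zero>, - ?k)"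
      using act_norm_add[OF d I_zero, of ?k "- ?k"] by simp
    moreover have "act_norm (\<zero>, - ?k) \<le> cmod ?k"
      using act_norm_le[OF I_zero, of "- ?k"] by (simp add: norm_minus_commute)
    moreover have "act_norm (?d, ?k) \<le> cnorm U (\<sigma> m \<oplus>\<^bsub>U\<^esub> (-1) \<odot>\<^bsub>U\<^esub> \<sigma> n)"
      unfolding cnorm_unitization \<sigma>_eq diff[OF xc xc] by simp
    ultimately show ?thesis using cnorm_le_act_norm[OF d] c_le[of m n] by linarith
  qed
  have "Cauchy c"
  proof (rule CauchyI)
    fix e :: real assume "0 < e"
    then show "\<exists>M. \<forall>m\<ge>M. \<forall>n\<ge>M. norm (c m - c n) < e"
      using C[of e] c_le by (meson order.strict_trans1)
  qed
  then obtain c0 where c0: "c \<longlonglongrightarrow> c0" using convergent_eq_Cauchy by blast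
  have "\<exists>x0\<in>carrier A. (\<lambda>n. cnorm A (x n \<ominus> x0)) \<longlonglongrightarrow> 0"
  proof (rule A.Cauchy_seq_limit[OF xc])
    fix e :: real assume "0 < e"
    then obtain N where N: "\<forall>m\<ge>N. \<forall>n\<ge>N. cnorm U (\<sigma> m \<oplus>\<^bsub>U\<^esub> (-1) \<odot>\<^bsub>U\<^esub> \<sigma> n) < e / 2"
      using C[of "e / 2"] by auto
    have "cnorm A (x m \<ominus> x n) < e" if "m \<ge> N" "n \<ge> N" for m n
    proof -
      have "cnorm U (\<sigma> m \<oplus>\<^bsub>U\<^esub> (-1) \<odot>\<^bsub>U\<^esub> \<sigma> n) < e / 2" using N that by blast
      then show ?thesis using x_le[of m n] by linarith
    qed
    then show "\<exists>N. \<forall>m\<ge>N. \<forall>n\<ge>N. cnorm A (x m \<ominus> x n) < e" by blast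
  qed
  then obtain x0 where x0: "x0 \<in> carrier A" "(\<lambda>n. cnorm A (x n \<ominus> x0)) \<longlonglongrightarrow> 0" by blast
  have x0I: "x0 \<in> I" by (rule I_limit[OF x x0])
  have "(\<lambda>n. cnorm A (x n \<ominus> x0) + cmod (c n - c0)) \<longlonglongrightarrow> 0 + cmod (c0 - c0)"
    by (intro tendsto_add x0(2) tendsto_norm tendsto_diff c0 tendsto_const)
  then have lim: "(\<lambda>n. cnorm A (x n \<ominus> x0) + cmod (c n - c0)) \<longlonglongrightarrow> 0" by simp
  have le: "cnorm U (\<sigma> n \<oplus>\<^bsub>U\<^esub> (-1) \<odot>\<^bsub>U\<^esub> (x0, c0)) \<le> cnorm A (x n \<ominus> x0) + cmod (c n - c0)" for n
    unfolding cnorm_unitization \<sigma>_eq diff[OF xc x0(1)]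
    using act_norm_le[OF I_diff[OF x x0I], of n "c n - c0"] A.cnorm_nonneg[OF A.diff_in[OF xc x0(1)], of n] by simp
  have "\<exists>N. \<forall>n\<ge>N. cnorm U (\<sigma> n \<oplus>\<^bsub>U\<^esub> (-1) \<odot>\<^bsub>U\<^esub> (x0, c0)) < e" if e: "0 < e" for e
  proof -
    obtain N where "\<And>n. n \<ge> N \<Longrightarrow> cnorm A (x n \<ominus> x0) + cmod (c n - c0) < e"
      using order_tendstoD(2)[OF lim e] by (auto simp: eventually_sequentially)
    then show ?thesis using le by (meson order.strict_trans1)
  qed
  then show "\<exists>x\<in>I \<times> UNIV. \<forall>e>0. \<exists>N. \<forall>n\<ge>N. cnorm U (\<sigma> n \<oplus>\<^bsub>U\<^esub> (-1) \<odot>\<^bsub>U\<^esub> x) < e"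
    using x0I by blast
qed

end

section \<open>A decomposition of the unitization\<close>

lemma continuous_map_closed_cases:
  assumes A: "closedin X A" and B: "closedin X B"
    and f: "continuous_map (subtopology X A) Y f" and g: "continuous_map (subtopology X B) Y g"
    and eq: "\<And>x. x \<in> A \<Longrightarrow> x \<in> B \<Longrightarrow> f x = g x"
  shows "continuous_map (subtopology X (A \<union> B)) Y (\<lambda>x. if x \<in> A then f x else g x)"
proof (rule pasting_lemma_closed[where I = UNIV and T = "\<lambda>b. if b then A else B" and f = "\<lambda>b. if b then f else g"])
  have clo: "closedin (subtopology X (A \<union> B)) S" if "closedin X S" "S \<subseteq> A \<union> B" for S
    using that unfolding closedin_subtopology by blast
  show "closedin (subtopology X (A \<union> B)) (if b then A else B)" for b
    using clo[OF A] clo[OF B] by simp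
  have sub: "subtopology (subtopology X (A \<union> B)) S = subtopology X S" if "S \<subseteq> A \<union> B" for S
    using that by (simp add: subtopology_subtopology Int_absorb1)
  show "continuous_map (subtopology (subtopology X (A \<union> B)) (if b then A else B)) Y (if b then f else g)" for b
    using f g sub[of A] sub[of B] by simp
  show "(if b then f else g) x = (if b' then f else g) x"
    if "x \<in> topspace (subtopology X (A \<union> B)) \<inter> (if b then A else B) \<inter> (if b' then A else B)" for b b' x
    using that eq[of x] by (cases b; cases b') auto
  show "\<exists>b. b \<in> UNIV \<and> x \<in> (if b then A else B) \<and> (if x \<in> A then f x else g x) = (if b then f else g) x"
    if "x \<in> topspace (subtopology X (A \<union> B))" for x
    using that by (intro exI[of _ "x \<in> A"]) auto
qed simp

text \<open>The point of the added one-point space is \<open>undefined\<close>, an arbitrary point of the type that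
carries the spaces \<open>X\<^sub>k\<close>; this keeps the type of the data unchanged.\<close>

definition scalar_entry :: "(nat \<Rightarrow> 'x \<Rightarrow> complex mat) \<Rightarrow> complex" where
  "scalar_entry b = b 0 undefined $$ (0, 0)"

definition shifted :: "(nat \<Rightarrow> 'x \<Rightarrow> complex mat) \<Rightarrow> nat \<Rightarrow> nat \<Rightarrow> 'x \<Rightarrow> complex mat" where
  "shifted b k = (\<lambda>i\<in>{..k}. b (Suc i))"

lemma shifted_extensional: "shifted b k \<in> extensional {..k}"
  unfolding shifted_def by (rule restrict_extensional)

text \<open>Level 0 is the added point and level \<open>k + 1\<close> is level \<open>k\<close> of \<open>D\<close>. The attaching map of level \<open>k + 1\<close>
takes a family on \<open>{..k}\<close>, which consists of the scalar and \<open>k\<close> components for \<open>D\<close>, hence the index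
\<open>k - 1\<close>. For \<open>k = 0\<close> that branch is vacuous, as the attached part is empty; likewise level 0 has no
attaching map.\<close>

definition unitization_data :: "'x rsh_data \<Rightarrow> (nat \<Rightarrow> 'x \<Rightarrow> complex mat) set \<Rightarrow> 'x rsh_data" where
  "unitization_data D I =
    \<lparr>len = Suc (len D),
     space_at = case_nat (discrete_topology {undefined}) (space_at D),
     msize = case_nat 1 (msize D),
     attach_set = case_nat {} (\<lambda>k. zero_set D I k \<union> attached_part D k),
     attach_hom = case_nat undefined (\<lambda>k b. \<lambda>x\<in>zero_set D I k \<union> attached_part D k.
       if x \<in> zero_set D I k then scalar_entry b \<cdot>\<^sub>m 1\<^sub>m (msize D k)
       else attach_hom D k (shifted b (k - 1)) x)\<rparr>"

lemma unitization_data_simps [simp]: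
  "len (unitization_data D I) = Suc (len D)"
  "space_at (unitization_data D I) 0 = discrete_topology {undefined}"
  "space_at (unitization_data D I) (Suc k) = space_at D k"
  "msize (unitization_data D I) 0 = 1"
  "msize (unitization_data D I) (Suc k) = msize D k"
  "attach_set (unitization_data D I) (Suc k) = zero_set D I k \<union> attached_part D k"
  by (simp_all add: unitization_data_def)

lemma attach_hom_unitization_data:
  "attach_hom (unitization_data D I) (Suc k) b = (\<lambda>x\<in>zero_set D I k \<union> attached_part D k.
     if x \<in> zero_set D I k then scalar_entry b \<cdot>\<^sub>m 1\<^sub>m (msize D k) else attach_hom D k (shifted b (k - 1)) x)"
  by (simp add: unitization_data_def)

lemma C_at_unitization_data: "C_at (unitization_data D I) (Suc k) = C_at D k"
  by (simp add: C_at_def)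

lemma scalar_entry_ops:
  fixes D :: "'x rsh_data"
  assumes b: "b \<in> carrier (stage (unitization_data D I) k)" and b': "b' \<in> carrier (stage (unitization_data D I) k)"
  shows "scalar_entry (b \<oplus>\<^bsub>stage (unitization_data D I) k\<^esub> b') = scalar_entry b + scalar_entry b'"
    and "scalar_entry (b \<otimes>\<^bsub>stage (unitization_data D I) k\<^esub> b') = scalar_entry b * scalar_entry b'"
    and "scalar_entry (c \<odot>\<^bsub>stage (unitization_data D I) k\<^esub> b) = c * scalar_entry b"
    and "scalar_entry (star (stage (unitization_data D I) k) b) = cnj (scalar_entry b)"
proof -
  have m: "b 0 undefined \<in> carrier_mat 1 1" "b' 0 undefined \<in> carrier_mat 1 1"
    using C_mat_carrierD(1)[OF stage_at[OF b le0, unfolded C_at_def]]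
      C_mat_carrierD(1)[OF stage_at[OF b' le0, unfolded C_at_def]] by simp_all
  note S = scalar_entry_def stage_index_ops C_at_def C_mat_simps(2-7)
  show "scalar_entry (b \<oplus>\<^bsub>stage (unitization_data D I) k\<^esub> b') = scalar_entry b + scalar_entry b'"
    using m by (simp add: S)
  show "scalar_entry (b \<otimes>\<^bsub>stage (unitization_data D I) k\<^esub> b') = scalar_entry b * scalar_entry b'"
    using index_mult_mat_sum[OF m, of 0 0] by (simp add: S)
  show "scalar_entry (c \<odot>\<^bsub>stage (unitization_data D I) k\<^esub> b) = c * scalar_entry b"
    using m by (simp add: S)
  show "scalar_entry (star (stage (unitization_data D I) k) b) = cnj (scalar_entry b)"
    using index_mat_adjoint[OF m(1), of 0 0] by (simp add: S)
qed

lemma scalar_entry_one: "scalar_entry \<one>\<^bsub>stage (unitization_data D I) k\<^esub> = 1"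
  by (simp add: scalar_entry_def stage_index_ops C_at_def C_mat_simps(3))

lemma scalar_entry_star_hom:
  "(\<lambda>b. scalar_entry b \<cdot>\<^sub>m 1\<^sub>m n) \<in> star_hom (stage (unitization_data D I) k) (mat_cstar n)"
  by (rule star_homI) (simp_all add: scalar_entry_ops(1-4) scalar_entry_one scalar_mat_ops)

lemma shifted_ops:
  assumes "Suc m \<le> k"
  shows "shifted (b \<oplus>\<^bsub>stage (unitization_data D I) k\<^esub> b') m = shifted b m \<oplus>\<^bsub>stage D m\<^esub> shifted b' m"
    and "shifted (b \<otimes>\<^bsub>stage (unitization_data D I) k\<^esub> b') m = shifted b m \<otimes>\<^bsub>stage D m\<^esub> shifted b' m"
    and "shifted (c \<odot>\<^bsub>stage (unitization_data D I) k\<^esub> b) m = c \<odot>\<^bsub>stage D m\<^esub> shifted b m"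
    and "shifted (star (stage (unitization_data D I) k) b) m = star (stage D m) (shifted b m)"
    and "shifted \<one>\<^bsub>stage (unitization_data D I) k\<^esub> m = \<one>\<^bsub>stage D m\<^esub>"
  unfolding shifted_def stage_simps(2-7)
  using assms by (intro restrict_ext, simp add: C_at_unitization_data)+

context rsh_ideal
begin

abbreviation D' where "D' \<equiv> unitization_data D I"

lemma zero_set_subset: "zero_set D I k \<subseteq> topspace (space_at D k)"
  by (auto simp: zero_set_def)

lemma closedin_zero_set:
  assumes k: "k \<le> len D"
  shows "closedin (space_at D k) (zero_set D I k)"
proof -
  let ?n = "msize D k" and ?X = "space_at D k"
  have aC: "a k \<in> carrier (C_mat ?X ?n)" if "a \<in> I" for a
    using I_stage[OF that k] unfolding C_at_def .
  have one: "{x \<in> topspace ?X. mat_opnorm (a k x) \<in> {0}} = {x \<in> topspace ?X. a k x = 0\<^sub>m ?n ?n}" if "a \<in> I" for a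
    using mat_opnorm_eq_0[OF C_mat_carrierD(1)[OF aC[OF that]]] by blast
  have clo: "closedin ?X {x \<in> topspace ?X. a k x = 0\<^sub>m ?n ?n}" if a: "a \<in> I" for a
    unfolding one[OF a, symmetric]
    by (rule closedin_continuous_map_preimage[OF continuous_map_mat_opnorm[OF aC[OF a]]]) simp
  have "zero_set D I k = (\<Inter>a\<in>I. {x \<in> topspace ?X. a k x = 0\<^sub>m ?n ?n})"
    using I_zero unfolding zero_set_def by blast
  then show ?thesis
    using clo I_zero by (simp only:) (intro closedin_Inter; blast)
qed

text \<open>The two prescriptions for the new attaching map agree where they overlap. After subtracting \<open>c 1\<close>
the element \<open>b\<close> vanishes on the zero sets up to level \<open>k\<close>, so it is a limit of restrictions of elements
\<open>a\<close> of the ideal; the attaching map sends such a restriction to the restriction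
of \<open>a\<^sub>k\<^sub>+\<^sub>1\<close>, which vanishes at \<open>x\<close>.\<close>

lemma attach_hom_scalar_on_zero_set:
  assumes k: "Suc k \<le> len D" and b: "b \<in> carrier (stage D k)"
    and bc: "\<And>i x. i \<le> k \<Longrightarrow> x \<in> zero_set D I i \<Longrightarrow> b i x = c \<cdot>\<^sub>m 1\<^sub>m (msize D i)"
    and x: "x \<in> attach_set D (Suc k)" "x \<in> zero_set D I (Suc k)"
  shows "attach_hom D (Suc k) b x = c \<cdot>\<^sub>m 1\<^sub>m (msize D (Suc k))"
proof -
  let ?S = "stage D k" and ?C0 = "C0_at D (Suc k)" and ?\<phi> = "attach_hom D (Suc k)" and ?n = "msize D (Suc k)"
  have k': "k \<le> len D" using k by simp
  interpret S: unital_cstar_algebra ?S by (rule stage_cstar[OF k'])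
  interpret C0: unital_cstar_algebra ?C0 by (rule C0_at_cstar[OF k])
  note \<phi> = star_homD[OF attach_hom[OF k]]
  have top: "topspace (subtopology (space_at D (Suc k)) (attach_set D (Suc k))) = attach_set D (Suc k)"
    using attach_subset[OF k] by auto
  have compact: "compact_space (subtopology (space_at D (Suc k)) (attach_set D (Suc k)))"
    by (intro compact_space_subtopology closedin_compact_space compact_at closedin_attach k)
  have val: "f x \<in> carrier_mat ?n ?n" if "f \<in> carrier ?C0" for f
    using C_mat_carrierD(1)[OF that[unfolded C0_at_def]] x(1) top by blast
  define d where "d = b \<oplus>\<^bsub>?S\<^esub> (- c) \<odot>\<^bsub>?S\<^esub> \<one>\<^bsub>?S\<^esub>"
  have d: "d \<in> carrier ?S" unfolding d_def by (intro S.ring_simps(1) S.smult_in b S.one_closed)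
  have d0: "d i y = 0\<^sub>m (msize D i) (msize D i)" if "i \<le> k" "y \<in> zero_set D I i" for i y
  proof -
    have y: "y \<in> topspace (space_at D i)" using that(2) zero_set_subset by blast
    have "d i y = c \<cdot>\<^sub>m 1\<^sub>m (msize D i) + (- c) \<cdot>\<^sub>m 1\<^sub>m (msize D i)"
      using that(1) y bc[OF that] by (simp add: d_def stage_index_ops C_at_def C_mat_simps(3,5,6))
    then show ?thesis by (intro eq_matI) simp_all
  qed
  have in0: "?\<phi> d \<in> carrier ?C0" by (rule \<phi>(1)[OF d])
  have small: "mat_opnorm (?\<phi> d x) \<le> e" if e: "0 < e" for e
  proof -
    have "\<exists>a\<in>I. cnorm ?S (d \<ominus>\<^bsub>?S\<^esub> restrict a {..k}) \<le> e"
      by (rule ideal_approximation[OF k' d _ e]) (rule d0)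
    then obtain a where a: "a \<in> I" "cnorm ?S (d \<ominus>\<^bsub>?S\<^esub> restrict a {..k}) \<le> e"
      by (elim bexE)
    have ra: "restrict a {..k} \<in> carrier ?S" by (rule I_restrict[OF a(1) k'])
    have in1: "?\<phi> (restrict a {..k}) \<in> carrier ?C0" by (rule \<phi>(1)[OF ra])
    have "?\<phi> (restrict a {..k}) x = 0\<^sub>m ?n ?n"
      unfolding I_attach[OF a(1) k] using x a(1) by (simp add: zero_set_def)
    then have "(?\<phi> d \<ominus>\<^bsub>?C0\<^esub> ?\<phi> (restrict a {..k})) x = ?\<phi> d x"
      unfolding C0.diff_eq_smult[OF in0 in1] unfolding C0_at_def C_mat_simps(5,6) top
      using x(1) val[OF in0] by (simp add: eq_matI)
    then have "mat_opnorm (?\<phi> d x) \<le> cnorm ?C0 (?\<phi> d \<ominus>\<^bsub>?C0\<^esub> ?\<phi> (restrict a {..k}))"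
      using mat_opnorm_le_cnorm_C_mat[OF compact C0.diff_in[OF in0 in1, unfolded C0_at_def], of x] x(1)
      unfolding top C0_at_def by simp
    also have "\<dots> \<le> cnorm ?S (d \<ominus>\<^bsub>?S\<^esub> restrict a {..k})"
      by (rule star_hom_dist_le[OF S.unital_cstar_algebra_axioms C0.unital_cstar_algebra_axioms attach_hom[OF k] d ra])
    finally show ?thesis using a(2) by simp
  qed
  have "mat_opnorm (?\<phi> d x) \<le> 0" by (rule field_le_epsilon) (use small in simp)
  then have z: "?\<phi> d x = 0\<^sub>m ?n ?n"
    using mat_opnorm_eq_0[OF val[OF in0]] mat_opnorm_nonneg[OF val[OF in0]] by linarith
  have "?\<phi> d = ?\<phi> b \<oplus>\<^bsub>?C0\<^esub> (- c) \<odot>\<^bsub>?C0\<^esub> \<one>\<^bsub>?C0\<^esub>"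
    unfolding d_def \<phi>(2)[OF b S.smult_in[OF S.one_closed]] \<phi>(5)[OF S.one_closed] \<phi>(4) ..
  then have "?\<phi> b x + (- c) \<cdot>\<^sub>m 1\<^sub>m ?n = 0\<^sub>m ?n ?n"
    using z x(1) unfolding C0_at_def C_mat_simps(3,5,6) top by simp
  then have "(?\<phi> b x + (- c) \<cdot>\<^sub>m 1\<^sub>m ?n) + c \<cdot>\<^sub>m 1\<^sub>m ?n = 0\<^sub>m ?n ?n + c \<cdot>\<^sub>m 1\<^sub>m ?n"
    by (simp only:)
  moreover have "(?\<phi> b x + (- c) \<cdot>\<^sub>m 1\<^sub>m ?n) + c \<cdot>\<^sub>m 1\<^sub>m ?n = ?\<phi> b x"
    using val[OF \<phi>(1)[OF b]] by (intro eq_matI) auto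
  moreover have "0\<^sub>m ?n ?n + c \<cdot>\<^sub>m 1\<^sub>m ?n = c \<cdot>\<^sub>m 1\<^sub>m ?n"
    by (intro eq_matI) auto
  ultimately show ?thesis by simp
qed

text \<open>At points of the zero sets the new gluing condition is the assertion about scalars. The old gluing
condition is part of the new one outside the zero sets, and at the points of the zero sets it follows
from the agreement of the two prescriptions.\<close>

lemma stage_unitization_dataD:
  assumes "k \<le> len D" "b \<in> carrier (stage D' (Suc k))"
  shows "shifted b k \<in> carrier (stage D k) \<and>
    (\<forall>i\<le>k. \<forall>x\<in>zero_set D I i. b (Suc i) x = scalar_entry b \<cdot>\<^sub>m 1\<^sub>m (msize D i))"
proof -
  have zero: "b (Suc i) x = scalar_entry b \<cdot>\<^sub>m 1\<^sub>m (msize D i)"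
    if k: "k \<le> len D" and b: "b \<in> carrier (stage D' (Suc k))" and i: "i \<le> k" and x: "x \<in> zero_set D I i"
    for b k i x
  proof -
    have "attach_hom D' (Suc i) (restrict b {..i}) x = restrict (b (Suc i)) (attach_set D' (Suc i)) x"
      using stage_attach[OF b, of i] i by simp
    then show ?thesis using x by (simp add: attach_hom_unitization_data scalar_entry_def)
  qed
  have "shifted b k \<in> carrier (stage D k)" if "k \<le> len D" "b \<in> carrier (stage D' (Suc k))" for k b
    using that
  proof (induction k arbitrary: b)
    case 0
    have "b (Suc 0) \<in> carrier (C_at D' (Suc 0))" by (rule stage_at[OF 0(2)]) simp
    then have "shifted b 0 0 \<in> carrier (C_at D 0)" by (simp add: shifted_def C_at_unitization_data)
    then show ?case
      unfolding stage_simps(1) stage_carrier.simps(1) using shifted_extensional by blast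
  next
    case (Suc k)
    have k: "k \<le> len D" using Suc.prems by simp
    have rb: "restrict b {..Suc k} \<in> carrier (stage D' (Suc k))"
      using stage_carrier_restrict[of "Suc k" "Suc (Suc k)" b D'] Suc.prems(2) by (simp add: stage_simps(1))
    have "shifted (restrict b {..Suc k}) k = shifted b k"
      unfolding shifted_def by (intro restrict_ext) simp
    with Suc.IH[OF k rb] have s: "shifted b k \<in> carrier (stage D k)" by (simp only:)
    have bk: "b (Suc (Suc k)) \<in> carrier (C_at D (Suc k))"
      using stage_at[OF Suc.prems(2) order_refl] by (simp only: C_at_unitization_data)
    have rs: "restrict (shifted b (Suc k)) {..k} = shifted b k"
      unfolding shifted_def by (auto intro!: ext)
    have top: "topspace (subtopology (space_at D (Suc k)) (attach_set D (Suc k))) = attach_set D (Suc k)"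
      using attach_subset[OF Suc.prems(1)] by auto
    have att: "attach_hom D (Suc k) (shifted b k) = restrict (b (Suc (Suc k))) (attach_set D (Suc k))"
    proof (rule extensionalityI[of _ "attach_set D (Suc k)"])
      have "attach_hom D (Suc k) (shifted b k) \<in> carrier (C0_at D (Suc k))"
        by (rule star_homD(1)[OF attach_hom[OF Suc.prems(1)] s])
      from C_mat_carrierD(3)[OF this[unfolded C0_at_def]]
      show "attach_hom D (Suc k) (shifted b k) \<in> extensional (attach_set D (Suc k))" by (simp only: top)
      fix x assume x: "x \<in> attach_set D (Suc k)"
      show "attach_hom D (Suc k) (shifted b k) x = restrict (b (Suc (Suc k))) (attach_set D (Suc k)) x"
      proof (cases "x \<in> zero_set D I (Suc k)")
        case True
        have "attach_hom D (Suc k) (shifted b k) x = scalar_entry b \<cdot>\<^sub>m 1\<^sub>m (msize D (Suc k))"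
        proof (rule attach_hom_scalar_on_zero_set[OF Suc.prems(1) s _ x True])
          show "shifted b k i y = scalar_entry b \<cdot>\<^sub>m 1\<^sub>m (msize D i)" if "i \<le> k" "y \<in> zero_set D I i" for i y
            using zero[OF Suc.prems _ that(2)] that(1) by (simp add: shifted_def)
        qed
        also have "\<dots> = b (Suc (Suc k)) x" by (rule zero[OF Suc.prems order_refl True, symmetric])
        finally show ?thesis using x by simp
      next
        case False
        have "attach_hom D' (Suc (Suc k)) (restrict b {..Suc k}) x
            = restrict (b (Suc (Suc k))) (attach_set D' (Suc (Suc k))) x"
          using stage_attach[OF Suc.prems(2) order_refl] by (rule fun_cong)
        moreover have "shifted (restrict b {..Suc k}) k = shifted b k"
          unfolding shifted_def by (intro restrict_ext) simp
        ultimately show ?thesis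
          using x False by (simp add: attach_hom_unitization_data attached_part_def)
      qed
    qed (rule restrict_extensional)
    show ?case
    proof (rule stage_closed_Suc[OF Suc.prems(1)])
      show "shifted b (Suc k) \<in> extensional {..Suc k}" by (rule shifted_extensional)
      show "restrict (shifted b (Suc k)) {..k} \<in> carrier (stage D k)" unfolding rs by (rule s)
      have last: "shifted b (Suc k) (Suc k) = b (Suc (Suc k))" by (simp add: shifted_def)
      show "shifted b (Suc k) (Suc k) \<in> carrier (C_at D (Suc k))" unfolding last by (rule bk)
      show "attach_hom D (Suc k) (restrict (shifted b (Suc k)) {..k})
          = restrict (shifted b (Suc k) (Suc k)) (attach_set D (Suc k))"
        unfolding rs last by (rule att)
    qed
  qed
  then show ?thesis using assms zero[OF assms] by blast
qed

lemma stage_unitization_dataI: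
  assumes ext: "b \<in> extensional {..Suc (len D)}" and b0: "b 0 \<in> carrier (C_at D' 0)"
    and s: "shifted b (len D) \<in> carrier (stage D (len D))"
    and z: "\<And>i x. i \<le> len D \<Longrightarrow> x \<in> zero_set D I i \<Longrightarrow> b (Suc i) x = scalar_entry b \<cdot>\<^sub>m 1\<^sub>m (msize D i)"
  shows "b \<in> carrier (stage D' (Suc (len D)))"
  unfolding stage_simps(1) stage_carrier_iff
proof (intro conjI allI impI ext)
  show "b i \<in> carrier (C_at D' i)" if "i \<le> Suc (len D)" for i
  proof (cases i)
    case (Suc j)
    then show ?thesis using stage_at[OF s, of j] that by (simp add: C_at_unitization_data shifted_def)
  qed (use b0 in simp)
  show "attach_hom D' (Suc i) (restrict b {..i}) = restrict (b (Suc i)) (attach_set D' (Suc i))"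
    if "i < Suc (len D)" for i
    unfolding attach_hom_unitization_data unitization_data_simps
  proof (rule restrict_ext)
    fix x assume x: "x \<in> zero_set D I i \<union> attached_part D i"
    have i: "i \<le> len D" using that by simp
    show "(if x \<in> zero_set D I i then scalar_entry (restrict b {..i}) \<cdot>\<^sub>m 1\<^sub>m (msize D i)
        else attach_hom D i (shifted (restrict b {..i}) (i - 1)) x) = b (Suc i) x"
    proof (cases "x \<in> zero_set D I i")
      case True
      then show ?thesis using z[OF i True] by (simp add: scalar_entry_def)
    next
      case False
      then obtain m where m: "i = Suc m" "x \<in> attach_set D (Suc m)"
        using x by (cases i) (auto simp: attached_part_def)
      have "attach_hom D (Suc m) (restrict (shifted b (len D)) {..m}) x
          = restrict (shifted b (len D) (Suc m)) (attach_set D (Suc m)) x"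
        using stage_attach[OF s, of m] i m(1) by simp
      moreover have "restrict (shifted b (len D)) {..m} = shifted (restrict b {..Suc m}) m"
        using i m(1) unfolding shifted_def by (auto intro!: ext)
      moreover have "shifted b (len D) (Suc m) = b (Suc (Suc m))"
        using i m(1) by (simp add: shifted_def)
      ultimately show ?thesis using False m by simp
    qed
  qed
qed

text \<open>At each point the map is a *-homomorphism into matrices, by whichever case applies; its values are
continuous by pasting along the two closed sets.\<close>

lemma attach_hom_unitization_star_hom:
  assumes k: "k \<le> len D"
  shows "attach_hom D' (Suc k) \<in> star_hom (stage D' k) (C0_at D' (Suc k))"
proof -
  let ?Z = "zero_set D I k" and ?Y = "attached_part D k" and ?n = "msize D k" and ?X = "space_at D k"
  let ?\<Phi> = "attach_hom D' (Suc k)"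
  have sub: "?Z \<union> ?Y \<subseteq> topspace ?X"
    using zero_set_subset closedin_subset[OF closedin_attached_part[OF k]] by blast
  have top: "topspace (subtopology ?X (?Z \<union> ?Y)) = ?Z \<union> ?Y" using sub by auto
  have C0: "C0_at D' (Suc k) = C_mat (subtopology ?X (?Z \<union> ?Y)) ?n" by (simp add: C0_at_def)
  have \<Phi>Z: "?\<Phi> b x = scalar_entry b \<cdot>\<^sub>m 1\<^sub>m ?n" if "x \<in> ?Z" for b x
    using that by (simp add: attach_hom_unitization_data)
  have \<Phi>Y: "?\<Phi> b x = attach_hom D k (shifted b (k - 1)) x" if "x \<in> ?Y" "x \<notin> ?Z" for b x
    using that by (simp add: attach_hom_unitization_data)
  have Y: "\<exists>m. k = Suc m \<and> x \<in> attach_set D (Suc m)" if "x \<in> ?Y" for x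
    using that by (cases k) (auto simp: attached_part_def)
  have sh: "shifted b m \<in> carrier (stage D m)"
    if "k = Suc m" "b \<in> carrier (stage D' k)" for b m
    using stage_unitization_dataD[of m b] that k by simp
  have top': "topspace (subtopology (space_at D (Suc m)) (attach_set D (Suc m))) = attach_set D (Suc m)"
    if "k = Suc m" for m
    using attach_subset[of m] that k by auto
  have \<phi>: "attach_hom D (Suc m) \<in> star_hom (stage D m) (C0_at D (Suc m))" if "k = Suc m" for m
    using attach_hom[of m] that k by simp
  show ?thesis
    unfolding C0
  proof (rule star_hom_C_matI)
    show "?\<Phi> b \<in> extensional (topspace (subtopology ?X (?Z \<union> ?Y)))" for b
      unfolding top attach_hom_unitization_data by (rule restrict_extensional)
    show "?\<Phi> b \<in> carrier (C_mat (subtopology ?X (?Z \<union> ?Y)) ?n)" if b: "b \<in> carrier (stage D' k)" for b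
    proof -
      have Y_in: "attach_hom D k (shifted b (k - 1)) \<in> carrier (C_mat (subtopology ?X ?Y) ?n)" if nz: "k \<noteq> 0"
      proof -
        obtain m where m: "k = Suc m" using nz by (cases k) auto
        show ?thesis
          using star_homD(1)[OF \<phi>[OF m] sh[OF m b]] m by (simp add: C0_at_def attached_part_def)
      qed
      have "(\<lambda>x\<in>topspace (subtopology ?X (?Z \<union> ?Y)). if x \<in> ?Z then scalar_entry b \<cdot>\<^sub>m 1\<^sub>m ?n
          else attach_hom D k (shifted b (k - 1)) x) \<in> carrier (C_mat (subtopology ?X (?Z \<union> ?Y)) ?n)"
      proof (rule C_mat_carrierI)
        fix x assume "x \<in> topspace (subtopology ?X (?Z \<union> ?Y))"
        then have x: "x \<in> ?Z \<union> ?Y" "x \<in> topspace ?X" using top sub by auto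
        show "(if x \<in> ?Z then scalar_entry b \<cdot>\<^sub>m 1\<^sub>m ?n else attach_hom D k (shifted b (k - 1)) x) \<in> carrier_mat ?n ?n"
        proof (cases "x \<in> ?Z")
          case False
          then have xY: "x \<in> ?Y" using x by blast
          then have "k \<noteq> 0" using Y by blast
          then show ?thesis using C_mat_carrierD(1)[OF Y_in, of x] xY x False by simp
        qed simp
      next
        fix i j assume ij: "i < ?n" "j < ?n"
        have "continuous_map (subtopology ?X (?Z \<union> ?Y)) euclidean (\<lambda>x. if x \<in> ?Z then (scalar_entry b \<cdot>\<^sub>m 1\<^sub>m ?n) $$ (i, j)
            else attach_hom D k (shifted b (k - 1)) x $$ (i, j))"
        proof (rule continuous_map_closed_cases[OF closedin_zero_set[OF k] closedin_attached_part[OF k]])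
          show "continuous_map (subtopology ?X ?Y) euclidean (\<lambda>x. attach_hom D k (shifted b (k - 1)) x $$ (i, j))"
          proof (cases "k = 0")
            case True
            then have "topspace (subtopology ?X ?Y) = {}" by (simp add: attached_part_def)
            then show ?thesis unfolding continuous_map_euclidean_atin by blast
          next
            case False
            then show ?thesis by (rule C_mat_carrierD(2)[OF Y_in ij])
          qed
          fix x assume xZ: "x \<in> ?Z" and xY: "x \<in> ?Y"
          obtain m where m: "k = Suc m" "x \<in> attach_set D (Suc m)" using Y[OF xY] by blast
          have "attach_hom D (Suc m) (shifted b m) x = scalar_entry b \<cdot>\<^sub>m 1\<^sub>m (msize D (Suc m))"
          proof (rule attach_hom_scalar_on_zero_set[OF _ sh[OF m(1) b] _ m(2)])
            show "Suc m \<le> len D" using k m by simp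
            show "x \<in> zero_set D I (Suc m)" using xZ m by simp
            show "shifted b m i y = scalar_entry b \<cdot>\<^sub>m 1\<^sub>m (msize D i)" if "i \<le> m" "y \<in> zero_set D I i" for i y
              using stage_unitization_dataD[of m b] that k m b by (simp add: shifted_def)
          qed
          then show "(scalar_entry b \<cdot>\<^sub>m 1\<^sub>m ?n) $$ (i, j) = attach_hom D k (shifted b (k - 1)) x $$ (i, j)"
            using m by simp
        qed simp
        then show "continuous_map (subtopology ?X (?Z \<union> ?Y)) euclidean (\<lambda>x. (if x \<in> ?Z then scalar_entry b \<cdot>\<^sub>m 1\<^sub>m ?n
            else attach_hom D k (shifted b (k - 1)) x) $$ (i, j))"
          by (simp only: if_distrib[of "\<lambda>M. M $$ (i, j)"])
      qed
      then show ?thesis unfolding attach_hom_unitization_data top .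
    qed
    fix x assume "x \<in> topspace (subtopology ?X (?Z \<union> ?Y))"
    then have x: "x \<in> ?Z \<union> ?Y" unfolding top .
    show "(\<lambda>b. ?\<Phi> b x) \<in> star_hom (stage D' k) (mat_cstar ?n)"
    proof (cases "x \<in> ?Z")
      case True
      then show ?thesis by (simp only: \<Phi>Z[OF True] scalar_entry_star_hom)
    next
      case False
      then have xY: "x \<in> ?Y" using x by blast
      obtain m where m: "k = Suc m" "x \<in> attach_set D (Suc m)" using Y[OF xY] by blast
      have "(\<lambda>b. shifted b m) \<in> star_hom (stage D' k) (stage D m)"
        by (rule star_homI) (simp_all add: sh m(1) shifted_ops)
      from star_hom_comp[OF this star_hom_comp[OF \<phi>[OF m(1), unfolded C0_at_def] C_mat_evaluation]]
      have "(\<lambda>b. attach_hom D (Suc m) (shifted b m) x) \<in> star_hom (stage D' k) (mat_cstar (msize D (Suc m)))"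
        using m(2) unfolding top'[OF m(1)] .
      moreover have "(\<lambda>b. ?\<Phi> b x) = (\<lambda>b. attach_hom D (Suc m) (shifted b m) x)"
        unfolding \<Phi>Y[OF xY False] using m(1) by simp
      ultimately show ?thesis using m(1) by simp
    qed
  qed
qed

lemma valid_unitization_data: "valid_rsh_data D'"
  unfolding valid_rsh_data_def
proof (intro conjI allI impI ballI)
  fix k assume k: "k \<le> len D'"
  show "compact_space (space_at D' k)" "Hausdorff_space (space_at D' k)" "1 \<le> msize D' k"
    using k compact_at Hausdorff_at msize_ge_1
    by (cases k; simp add: compact_space_discrete_topology)+
next
  fix k assume "k \<in> {1..len D'}"
  then obtain j where j: "k = Suc j" "j \<le> len D" by (cases k) auto
  show "closedin (space_at D' k) (attach_set D' k)"
    unfolding j(1) unitization_data_simps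
    by (intro closedin_Un closedin_zero_set closedin_attached_part j(2))
  show "attach_hom D' k \<in> star_hom (stage D' (k - 1)) (C0_at D' k)"
    using attach_hom_unitization_star_hom[OF j(2)] by (simp add: j(1))
qed

end

section \<open>The isomorphism with the unitization\<close>

locale rsh_closed_ideal = rsh_ideal +
  assumes I_closed: "b \<in> carrier (stage D (len D)) \<Longrightarrow>
    (\<And>e. 0 < e \<Longrightarrow> \<exists>a\<in>I. cnorm (stage D (len D)) (b \<ominus>\<^bsub>stage D (len D)\<^esub> a) \<le> e) \<Longrightarrow> b \<in> I"
begin

lemma mem_ideal_iff_vanishes_on_zero_sets:
  "b \<in> I \<longleftrightarrow> b \<in> carrier (stage D (len D)) \<and>
    (\<forall>i\<le>len D. \<forall>x\<in>zero_set D I i. b i x = 0\<^sub>m (msize D i) (msize D i))"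
proof
  assume "b \<in> I"
  then show "b \<in> carrier (stage D (len D)) \<and>
      (\<forall>i\<le>len D. \<forall>x\<in>zero_set D I i. b i x = 0\<^sub>m (msize D i) (msize D i))"
    using I_sub by (auto simp: zero_set_def)
next
  assume b: "b \<in> carrier (stage D (len D)) \<and>
      (\<forall>i\<le>len D. \<forall>x\<in>zero_set D I i. b i x = 0\<^sub>m (msize D i) (msize D i))"
  show "b \<in> I"
  proof (rule I_closed)
    show bR: "b \<in> carrier (stage D (len D))" using b by blast
    fix e :: real assume e: "0 < e"
    have "\<exists>a\<in>I. cnorm (stage D (len D)) (b \<ominus>\<^bsub>stage D (len D)\<^esub> restrict a {..len D}) \<le> e"
      by (rule ideal_approximation[OF order_refl bR _ e]) (use b in blast)
    then obtain a where a: "a \<in> I" "cnorm (stage D (len D)) (b \<ominus>\<^bsub>stage D (len D)\<^esub> restrict a {..len D}) \<le> e"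
      by (elim bexE)
    have "restrict a {..len D} = a"
      using subsetD[OF I_sub a(1)] unfolding stage_simps(1) stage_carrier_iff
      by (intro extensional_restrict) (elim conjE)
    with a show "\<exists>a\<in>I. cnorm (stage D (len D)) (b \<ominus>\<^bsub>stage D (len D)\<^esub> a) \<le> e"
      by (intro bexI[of _ a]) (simp_all only:)
  qed
qed

text \<open>Vanishing at a point is preserved by adjoints. Thus closed ideals are self-adjoint, which is what
gives \<open>I\<^sup>+\<close> its involution.\<close>

lemma star_mem_ideal:
  assumes b: "b \<in> I" shows "star (stage D (len D)) b \<in> I"
  unfolding mem_ideal_iff_vanishes_on_zero_sets
proof (intro conjI allI impI ballI)
  interpret R: unital_cstar_algebra "stage D (len D)" by (rule stage_cstar[OF order_refl])
  show "star (stage D (len D)) b \<in> carrier (stage D (len D))"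
    by (rule R.star_in[OF subsetD[OF I_sub b]])
  fix i x assume i: "i \<le> len D" and x: "x \<in> zero_set D I i"
  have "b i x = 0\<^sub>m (msize D i) (msize D i)" using x b by (simp add: zero_set_def)
  moreover have "x \<in> topspace (space_at D i)" using x zero_set_subset by blast
  ultimately have "star (stage D (len D)) b i x = mat_adjoint (0\<^sub>m (msize D i) (msize D i))"
    using i by (simp add: stage_index_ops C_at_def C_mat_simps(7))
  also have "\<dots> = 0\<^sub>m (msize D i) (msize D i)"
    by (intro eq_matI) (auto simp: mat_adjoint_eq[of _ "msize D i" "msize D i"])
  finally show "star (stage D (len D)) b i x = 0\<^sub>m (msize D i) (msize D i)" .
qed

end

definition adjoin_scalar :: "'x rsh_data \<Rightarrow> complex \<Rightarrow> (nat \<Rightarrow> 'x \<Rightarrow> complex mat) \<Rightarrow> nat \<Rightarrow> 'x \<Rightarrow> complex mat" where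
  "adjoin_scalar D c r = (\<lambda>i\<in>{..Suc (len D)}. case i of 0 \<Rightarrow> (\<lambda>x\<in>{undefined}. c \<cdot>\<^sub>m 1\<^sub>m 1) | Suc j \<Rightarrow> r j)"

lemma adjoin_scalar_index [simp]:
  "adjoin_scalar D c r 0 = (\<lambda>x\<in>{undefined}. c \<cdot>\<^sub>m 1\<^sub>m 1)"
  "j \<le> len D \<Longrightarrow> adjoin_scalar D c r (Suc j) = r j"
  by (simp_all add: adjoin_scalar_def)

lemma adjoin_scalar_eqI:
  assumes "b \<in> extensional {..Suc (len D)}" "b 0 \<in> extensional {undefined}" "b 0 undefined = c \<cdot>\<^sub>m 1\<^sub>m 1"
    and "\<And>j. j \<le> len D \<Longrightarrow> b (Suc j) = r j"
  shows "b = adjoin_scalar D c r"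
proof (rule extensionalityI[of _ "{..Suc (len D)}"])
  show "b \<in> extensional {..Suc (len D)}" by fact
  show "adjoin_scalar D c r \<in> extensional {..Suc (len D)}"
    unfolding adjoin_scalar_def by (rule restrict_extensional)
  show "b i = adjoin_scalar D c r i" if "i \<in> {..Suc (len D)}" for i
  proof (cases i)
    case 0
    have "b 0 = (\<lambda>x\<in>{undefined}. c \<cdot>\<^sub>m 1\<^sub>m 1)"
    proof (rule extensionalityI[of _ "{undefined}"])
      show "b 0 x = (\<lambda>x\<in>{undefined}. c \<cdot>\<^sub>m 1\<^sub>m 1) x" if "x \<in> {undefined}" for x
        using that assms(3) by simp
    qed (rule assms(2) restrict_extensional)+
    then show ?thesis unfolding 0 by (simp only: adjoin_scalar_index)
  next
    case (Suc j)
    then show ?thesis using that assms(4) by simp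
  qed
qed

lemma adjoin_scalar_ops:
  fixes D :: "'x rsh_data" and I :: "(nat \<Rightarrow> 'x \<Rightarrow> complex mat) set"
  defines "S \<equiv> stage (unitization_data D I) (Suc (len D))" and "R \<equiv> stage D (len D)"
  shows "adjoin_scalar D c r \<oplus>\<^bsub>S\<^esub> adjoin_scalar D c' r' = adjoin_scalar D (c + c') (r \<oplus>\<^bsub>R\<^esub> r')"
    and "adjoin_scalar D c r \<otimes>\<^bsub>S\<^esub> adjoin_scalar D c' r' = adjoin_scalar D (c * c') (r \<otimes>\<^bsub>R\<^esub> r')"
    and "d \<odot>\<^bsub>S\<^esub> adjoin_scalar D c r = adjoin_scalar D (d * c) (d \<odot>\<^bsub>R\<^esub> r)"
    and "star S (adjoin_scalar D c r) = adjoin_scalar D (cnj c) (star R r)"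
    and "\<one>\<^bsub>S\<^esub> = adjoin_scalar D 1 \<one>\<^bsub>R\<^esub>"
proof -
  have ext: "(\<lambda>i\<in>{..Suc (len D)}. f i) \<in> extensional {..Suc (len D)}" for f :: "nat \<Rightarrow> 'x \<Rightarrow> complex mat"
    by (rule restrict_extensional)
  have C0: "C_at (unitization_data D I) 0 = C_mat (discrete_topology {undefined}) 1" by (simp add: C_at_def)
  note simps = C0 C_mat_simps(2-7) topspace_discrete_topology restrict_extensional
  show "adjoin_scalar D c r \<oplus>\<^bsub>S\<^esub> adjoin_scalar D c' r' = adjoin_scalar D (c + c') (r \<oplus>\<^bsub>R\<^esub> r')"
  proof (rule adjoin_scalar_eqI)
    show "(adjoin_scalar D c r \<oplus>\<^bsub>S\<^esub> adjoin_scalar D c' r') 0 undefined = (c + c') \<cdot>\<^sub>m 1\<^sub>m 1"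
      unfolding S_def stage_index_ops[OF le0] simps by (simp add: scalar_mat_ops)
  qed (unfold S_def R_def stage_simps(5) C_at_unitization_data[symmetric, of D _ I], rule ext,
      simp only: restrict_apply' atMost_iff le0 simps, simp)
  show "adjoin_scalar D c r \<otimes>\<^bsub>S\<^esub> adjoin_scalar D c' r' = adjoin_scalar D (c * c') (r \<otimes>\<^bsub>R\<^esub> r')"
  proof (rule adjoin_scalar_eqI)
    show "(adjoin_scalar D c r \<otimes>\<^bsub>S\<^esub> adjoin_scalar D c' r') 0 undefined = (c * c') \<cdot>\<^sub>m 1\<^sub>m 1"
      unfolding S_def stage_index_ops[OF le0] simps by (simp add: scalar_mat_ops)
  qed (unfold S_def R_def stage_simps(2) C_at_unitization_data[symmetric, of D _ I], rule ext,
      simp only: restrict_apply' atMost_iff le0 simps, simp)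
  show "d \<odot>\<^bsub>S\<^esub> adjoin_scalar D c r = adjoin_scalar D (d * c) (d \<odot>\<^bsub>R\<^esub> r)"
  proof (rule adjoin_scalar_eqI)
    show "(d \<odot>\<^bsub>S\<^esub> adjoin_scalar D c r) 0 undefined = (d * c) \<cdot>\<^sub>m 1\<^sub>m 1"
      unfolding S_def stage_index_ops[OF le0] simps by (simp add: scalar_mat_ops)
  qed (unfold S_def R_def stage_simps(6) C_at_unitization_data[symmetric, of D _ I], rule ext,
      simp only: restrict_apply' atMost_iff le0 simps, simp)
  show "star S (adjoin_scalar D c r) = adjoin_scalar D (cnj c) (star R r)"
  proof (rule adjoin_scalar_eqI)
    show "star S (adjoin_scalar D c r) 0 undefined = cnj c \<cdot>\<^sub>m 1\<^sub>m 1"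
      unfolding S_def stage_index_ops[OF le0] simps by (simp add: scalar_mat_ops)
  qed (unfold S_def R_def stage_simps(7) C_at_unitization_data[symmetric, of D _ I], rule ext,
      simp only: restrict_apply' atMost_iff le0 simps, simp)
  show "\<one>\<^bsub>S\<^esub> = adjoin_scalar D 1 \<one>\<^bsub>R\<^esub>"
  proof (rule adjoin_scalar_eqI)
    show "\<one>\<^bsub>S\<^esub> 0 undefined = 1 \<cdot>\<^sub>m 1\<^sub>m 1"
      unfolding S_def stage_index_ops[OF le0] simps by (simp add: scalar_mat_ops)
  qed (unfold S_def R_def stage_simps(3) C_at_unitization_data[symmetric, of D _ I], rule ext,
      simp only: restrict_apply' atMost_iff le0 simps, simp)
qed

context rsh_closed_ideal
begin

lemma adjoin_scalar_in_stage:
  assumes r: "r \<in> carrier (stage D (len D))"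
    and z: "\<And>i x. i \<le> len D \<Longrightarrow> x \<in> zero_set D I i \<Longrightarrow> r i x = c \<cdot>\<^sub>m 1\<^sub>m (msize D i)"
  shows "adjoin_scalar D c r \<in> carrier (stage D' (Suc (len D)))"
proof (rule stage_unitization_dataI)
  show "adjoin_scalar D c r \<in> extensional {..Suc (len D)}"
    unfolding adjoin_scalar_def by (rule restrict_extensional)
  have "(\<lambda>x\<in>topspace (discrete_topology {undefined :: 'a}). c \<cdot>\<^sub>m 1\<^sub>m 1) \<in> carrier (C_mat (discrete_topology {undefined}) 1)"
    by (intro C_mat_carrierI) simp_all
  then show "adjoin_scalar D c r 0 \<in> carrier (C_at D' 0)" by (simp add: C_at_def)
  have "shifted (adjoin_scalar D c r) (len D) = restrict r {..len D}"
    unfolding shifted_def by (intro restrict_ext) simp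
  also have "\<dots> = r"
    using r unfolding stage_simps(1) stage_carrier_iff by (intro extensional_restrict) (elim conjE)
  finally show "shifted (adjoin_scalar D c r) (len D) \<in> carrier (stage D (len D))" using r by (simp only:)
  have "scalar_entry (adjoin_scalar D c r) = c" by (simp add: scalar_entry_def)
  then show "adjoin_scalar D c r (Suc i) x = scalar_entry (adjoin_scalar D c r) \<cdot>\<^sub>m 1\<^sub>m (msize D i)"
    if "i \<le> len D" "x \<in> zero_set D I i" for i x
    using z[OF that] that by simp
qed

lemma adjoin_scalar_surj:
  assumes b: "b \<in> carrier (stage D' (Suc (len D)))"
  shows "b = adjoin_scalar D (scalar_entry b) (shifted b (len D))"
proof (rule adjoin_scalar_eqI)
  show "b \<in> extensional {..Suc (len D)}"
    using b unfolding stage_simps(1) stage_carrier_iff by (elim conjE)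
  have b0: "b 0 \<in> carrier (C_mat (discrete_topology {undefined}) 1)"
    using stage_at[OF b le0] by (simp add: C_at_def)
  show "b 0 \<in> extensional {undefined}" using C_mat_carrierD(3)[OF b0] by simp
  show "b 0 undefined = scalar_entry b \<cdot>\<^sub>m 1\<^sub>m 1"
    using C_mat_carrierD(1)[OF b0, of undefined] by (intro eq_matI) (auto simp: scalar_entry_def)
  show "b (Suc j) = shifted b (len D) j" if "j \<le> len D" for j
    using that by (simp add: shifted_def)
qed

text \<open>Surjectivity is where the description of the ideal by its zero sets enters: an element of the new
pullback with scalar \<open>c\<close> equals \<open>c 1\<close> on all the zero sets, so that subtracting \<open>c 1\<close> from its
remaining components gives an element of the ideal.\<close>

theorem unitization_star_iso:
  assumes A: "unital_cstar_algebra A" and h: "h \<in> star_iso A (stage D (len D))"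
    and J: "J \<subseteq> carrier A" "h ` J = I" and z: "\<zero>\<^bsub>A\<^esub> \<in> J"
    and closed: "\<And>x y. x \<in> J \<Longrightarrow> y \<in> J \<Longrightarrow> x \<oplus>\<^bsub>A\<^esub> y \<in> J" "\<And>x y. x \<in> J \<Longrightarrow> y \<in> J \<Longrightarrow> x \<otimes>\<^bsub>A\<^esub> y \<in> J"
      "\<And>c x. x \<in> J \<Longrightarrow> c \<odot>\<^bsub>A\<^esub> x \<in> J" "\<And>x. x \<in> J \<Longrightarrow> star A x \<in> J"
  shows "(\<lambda>(x, c). adjoin_scalar D c (h x \<oplus>\<^bsub>stage D (len D)\<^esub> c \<odot>\<^bsub>stage D (len D)\<^esub> \<one>\<^bsub>stage D (len D)\<^esub>))
    \<in> star_iso (unitization A J) (stage D' (Suc (len D)))"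
proof -
  let ?R = "stage D (len D)" and ?S = "stage D' (Suc (len D))"
  interpret A: unital_cstar_algebra A by fact
  interpret R: unital_cstar_algebra ?R by (rule stage_cstar[OF order_refl])
  have hh: "h \<in> star_hom A ?R" and bij: "bij_betw h (carrier A) (carrier ?R)"
    using h by (auto simp: star_iso_def)
  note hD = star_homD[OF hh]
  define \<rho> where "\<rho> = (\<lambda>x c. h x \<oplus>\<^bsub>?R\<^esub> c \<odot>\<^bsub>?R\<^esub> \<one>\<^bsub>?R\<^esub>)"
  define H where "H = (\<lambda>(x, c). adjoin_scalar D c (\<rho> x c))"
  have Jc: "x \<in> carrier A" if "x \<in> J" for x using J(1) that by blast
  have hR: "h x \<in> carrier ?R" if "x \<in> J" for x by (rule hD(1)[OF Jc[OF that]])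
  have \<rho>R: "\<rho> x c \<in> carrier ?R" if "x \<in> J" for x c
    unfolding \<rho>_def by (intro R.ring_simps(1) hR that R.smult_in R.one_closed)
  have H_in: "H (x, c) \<in> carrier ?S" if x: "x \<in> J" for x c
    unfolding H_def prod.case
  proof (rule adjoin_scalar_in_stage[OF \<rho>R[OF x]])
    fix i u assume i: "i \<le> len D" and u: "u \<in> zero_set D I i"
    have "u \<in> topspace (space_at D i)" using u zero_set_subset by blast
    moreover have "h x i u = 0\<^sub>m (msize D i) (msize D i)" using u x J(2) by (auto simp: zero_set_def)
    ultimately have "\<rho> x c i u = 0\<^sub>m (msize D i) (msize D i) + c \<cdot>\<^sub>m 1\<^sub>m (msize D i)"
      using i by (simp add: \<rho>_def stage_index_ops C_at_def C_mat_simps(3,5,6))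
    then show "\<rho> x c i u = c \<cdot>\<^sub>m 1\<^sub>m (msize D i)" by (simp add: left_add_zero_mat[of _ "msize D i" "msize D i"])
  qed
  have \<rho>_add: "\<rho> (x \<oplus>\<^bsub>A\<^esub> y) (c + d) = \<rho> x c \<oplus>\<^bsub>?R\<^esub> \<rho> y d" if "x \<in> J" "y \<in> J" for x y c d
    using hR[OF that(1)] hR[OF that(2)] Jc[OF that(1)] Jc[OF that(2)]
    by (simp add: \<rho>_def hD(2) R.smult_add R.add_assoc R.add_comm R.ring_simps(22))
  have \<rho>_mult: "\<rho> (x \<otimes>\<^bsub>A\<^esub> y \<oplus>\<^bsub>A\<^esub> d \<odot>\<^bsub>A\<^esub> x \<oplus>\<^bsub>A\<^esub> c \<odot>\<^bsub>A\<^esub> y) (c * d) = \<rho> x c \<otimes>\<^bsub>?R\<^esub> \<rho> y d"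
    if "x \<in> J" "y \<in> J" for x y c d
    using hR[OF that(1)] hR[OF that(2)] Jc[OF that(1)] Jc[OF that(2)]
    by (simp add: \<rho>_def hD(2,3,5) R.distrib_left R.distrib_right R.smult_mult_left R.smult_mult_right R.smult_distrib
        R.smult_smult R.add_assoc R.add_comm R.ring_simps(22) mult.commute[of c d])
  have \<rho>_smult: "\<rho> (d \<odot>\<^bsub>A\<^esub> x) (d * c) = d \<odot>\<^bsub>?R\<^esub> \<rho> x c" if "x \<in> J" for x c d
    using hR[OF that] Jc[OF that] by (simp add: \<rho>_def hD(5) R.smult_distrib R.smult_smult)
  have \<rho>_star: "\<rho> (star A x) (cnj c) = star ?R (\<rho> x c)" if "x \<in> J" for x c
    using hR[OF that] Jc[OF that] by (simp add: \<rho>_def hD(6) R.star_add R.star_smult)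
  have h_zero: "h \<zero>\<^bsub>A\<^esub> = \<zero>\<^bsub>?R\<^esub>"
    using hD(5)[OF A.zero_closed, of 0] hD(1)[OF A.zero_closed] by simp
  have \<rho>_one: "\<rho> \<zero>\<^bsub>A\<^esub> 1 = \<one>\<^bsub>?R\<^esub>" by (simp add: \<rho>_def h_zero)
  note U = unitization_simps
  have hom: "H \<in> star_hom (unitization A J) ?S"
  proof (rule star_homI)
    fix p assume "p \<in> carrier (unitization A J)"
    then obtain x c where p: "p = (x, c)" and x: "x \<in> J" by (auto simp: U)
    show "H p \<in> carrier ?S" unfolding p by (rule H_in[OF x])
    show "H (d \<odot>\<^bsub>unitization A J\<^esub> p) = d \<odot>\<^bsub>?S\<^esub> H p" for d
      unfolding p U H_def prod.case adjoin_scalar_ops \<rho>_smult[OF x] ..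
    show "H (star (unitization A J) p) = star ?S (H p)"
      unfolding p U H_def prod.case adjoin_scalar_ops \<rho>_star[OF x] ..
    fix q assume "q \<in> carrier (unitization A J)"
    then obtain y d where q: "q = (y, d)" and y: "y \<in> J" by (auto simp: U)
    show "H (p \<oplus>\<^bsub>unitization A J\<^esub> q) = H p \<oplus>\<^bsub>?S\<^esub> H q"
      unfolding p q U H_def prod.case adjoin_scalar_ops \<rho>_add[OF x y] ..
    show "H (p \<otimes>\<^bsub>unitization A J\<^esub> q) = H p \<otimes>\<^bsub>?S\<^esub> H q"
      unfolding p q U H_def prod.case adjoin_scalar_ops \<rho>_mult[OF x y] ..
  next
    show "H \<one>\<^bsub>unitization A J\<^esub> = \<one>\<^bsub>?S\<^esub>"
      unfolding U H_def prod.case adjoin_scalar_ops \<rho>_one ..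
  qed
  have h_eq: "h x = \<rho> x c \<oplus>\<^bsub>?R\<^esub> (- c) \<odot>\<^bsub>?R\<^esub> \<one>\<^bsub>?R\<^esub>" if "x \<in> J" for x c
  proof -
    have "\<rho> x c \<oplus>\<^bsub>?R\<^esub> (- c) \<odot>\<^bsub>?R\<^esub> \<one>\<^bsub>?R\<^esub> = h x \<oplus>\<^bsub>?R\<^esub> (c + - c) \<odot>\<^bsub>?R\<^esub> \<one>\<^bsub>?R\<^esub>"
      unfolding \<rho>_def R.smult_add[OF R.one_closed] using hR[OF that] by (intro R.add_assoc) simp_all
    then show ?thesis using hR[OF that] by simp
  qed
  have "inj_on H (J \<times> UNIV)"
  proof (rule inj_onI)
    fix p q assume "p \<in> J \<times> (UNIV :: complex set)" "q \<in> J \<times> (UNIV :: complex set)" and eq: "H p = H q"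
    then obtain x c y d where p: "p = (x, c)" "x \<in> J" and q: "q = (y, d)" "y \<in> J" by auto
    have ent: "scalar_entry (adjoin_scalar D c' r) = c'" for c' r by (simp add: scalar_entry_def)
    have "scalar_entry (H p) = scalar_entry (H q)" by (simp only: eq)
    then have cd: "c = d" unfolding p q H_def prod.case ent .
    have sh: "shifted (H (x', c')) (len D) = \<rho> x' c'" if "x' \<in> J" for x' c'
    proof -
      have "shifted (H (x', c')) (len D) = restrict (\<rho> x' c') {..len D}"
        unfolding shifted_def H_def prod.case by (intro restrict_ext) simp
      also have "\<dots> = \<rho> x' c'"
        using \<rho>R[OF that, of c'] unfolding stage_simps(1) stage_carrier_iff by (intro extensional_restrict) (elim conjE)
      finally show ?thesis .
    qed
    have "\<rho> x c = \<rho> y d" using sh[OF p(2), of c] sh[OF q(2), of d] eq p(1) q(1) by (simp only:)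
    then have "h x = h y" using h_eq[OF p(2), of c] h_eq[OF q(2), of d] cd by (simp only:)
    then have "x = y" using bij Jc[OF p(2)] Jc[OF q(2)] by (auto simp: bij_betw_def dest: inj_onD)
    then show "p = q" using p q cd by simp
  qed
  moreover have "H ` (J \<times> UNIV) = carrier ?S"
  proof
    show "H ` (J \<times> UNIV) \<subseteq> carrier ?S" using H_in by auto
    show "carrier ?S \<subseteq> H ` (J \<times> UNIV)"
    proof
      fix b assume b: "b \<in> carrier ?S"
      define c where "c = scalar_entry b"
      define s where "s = shifted b (len D)"
      have s: "s \<in> carrier ?R" "\<And>i x. i \<le> len D \<Longrightarrow> x \<in> zero_set D I i \<Longrightarrow> s i x = c \<cdot>\<^sub>m 1\<^sub>m (msize D i)"
        using stage_unitization_dataD[OF order_refl b] by (simp_all add: s_def c_def shifted_def)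
      define r where "r = s \<oplus>\<^bsub>?R\<^esub> (- c) \<odot>\<^bsub>?R\<^esub> \<one>\<^bsub>?R\<^esub>"
      have "r \<in> I"
        unfolding mem_ideal_iff_vanishes_on_zero_sets
      proof (intro conjI allI impI ballI)
        show "r \<in> carrier ?R" unfolding r_def by (intro R.ring_simps(1) R.smult_in s(1) R.one_closed)
        fix i x assume i: "i \<le> len D" and x: "x \<in> zero_set D I i"
        have "x \<in> topspace (space_at D i)" using x zero_set_subset by blast
        then have "r i x = c \<cdot>\<^sub>m 1\<^sub>m (msize D i) + (- c) \<cdot>\<^sub>m 1\<^sub>m (msize D i)"
          using i s(2)[OF i x] by (simp add: r_def stage_index_ops C_at_def C_mat_simps(3,5,6))
        then show "r i x = 0\<^sub>m (msize D i) (msize D i)" by (intro eq_matI) simp_all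
      qed
      then obtain x where x: "x \<in> J" "h x = r" using J(2) by blast
      have "\<rho> x c = s \<oplus>\<^bsub>?R\<^esub> (- c + c) \<odot>\<^bsub>?R\<^esub> \<one>\<^bsub>?R\<^esub>"
        unfolding \<rho>_def x(2) r_def R.smult_add[OF R.one_closed] using s(1) by (intro R.add_assoc) simp_all
      then have "\<rho> x c = s" using s(1) by simp
      then have "H (x, c) = b" using adjoin_scalar_surj[OF b] unfolding H_def prod.case c_def[symmetric] s_def[symmetric] by simp
      then show "b \<in> H ` (J \<times> UNIV)" using x(1) by blast
    qed
  qed
  ultimately have "bij_betw H (carrier (unitization A J)) (carrier ?S)"
    unfolding U bij_betw_def by blast
  then have "H \<in> star_iso (unitization A J) ?S" using hom by (simp add: star_iso_def)
  then show ?thesis unfolding H_def \<rho>_def .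
qed

end

section \<open>Dimension, matrix size and conclusion\<close>

lemma covering_dim_point: "covering_dim (discrete_topology {a}) = 0"
proof -
  have "covering_dim_le (discrete_topology {a}) 0"
    unfolding covering_dim_le_def
  proof (intro allI impI)
    fix \<U> assume \<U>: "finite \<U> \<and> (\<forall>U\<in>\<U>. openin (discrete_topology {a}) U) \<and> \<Union>\<U> = topspace (discrete_topology {a})"
    then have "a \<in> \<Union>\<U>" by simp
    then obtain U where "U \<in> \<U>" "a \<in> U" by (rule UnionE)
    moreover have "card {V \<in> {{a}}. x \<in> V} \<le> 1" for x
      using card_mono[of "{{a}}" "{V \<in> {{a}}. x \<in> V}"] by auto
    ultimately show "\<exists>\<V>. finite \<V> \<and> (\<forall>V\<in>\<V>. openin (discrete_topology {a}) V) \<and> \<Union>\<V> = topspace (discrete_topology {a}) \<and>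
        (\<forall>V\<in>\<V>. \<exists>U\<in>\<U>. V \<subseteq> U) \<and> (\<forall>x\<in>topspace (discrete_topology {a}). card {V \<in> \<V>. x \<in> V} \<le> 0 + 1)"
      by (intro exI[of _ "{{a}}"]) auto
  qed
  then have "covering_dim (discrete_topology {a}) \<le> enat 0"
    unfolding covering_dim_def by (intro Inf_lower) simp
  then show ?thesis by (simp add: zero_enat_def[symmetric])
qed

lemma topological_dim_unitization_data: "topological_dim (unitization_data D I) \<le> topological_dim D"
  unfolding topological_dim_def
proof (rule Max.boundedI)
  fix d assume "d \<in> (\<lambda>k. covering_dim (space_at (unitization_data D I) k)) ` {..len (unitization_data D I)}"
  then obtain k where k: "k \<le> Suc (len D)" "d = covering_dim (space_at (unitization_data D I) k)" by auto
  show "d \<le> Max ((\<lambda>k. covering_dim (space_at D k)) ` {..len D})"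
  proof (cases k)
    case 0
    then show ?thesis using k by (simp add: covering_dim_point)
  next
    case (Suc j)
    then show ?thesis using k by (intro Max_ge) auto
  qed
qed auto

lemma (in rsh) max_matrix_size_unitization_data: "max_matrix_size (unitization_data D I) \<le> max_matrix_size D"
  unfolding max_matrix_size_def
proof (rule Max.boundedI)
  fix n assume "n \<in> msize (unitization_data D I) ` {..len (unitization_data D I)}"
  then obtain k where k: "k \<le> Suc (len D)" "n = msize (unitization_data D I) k" by auto
  show "n \<le> Max (msize D ` {..len D})"
  proof (cases k)
    case 0
    have "1 \<le> msize D 0" by (rule msize_ge_1) simp
    also have "\<dots> \<le> Max (msize D ` {..len D})" by (intro Max_ge) auto
    finally show ?thesis using k 0 by simp
  next
    case (Suc j)
    then show ?thesis using k by (intro Max_ge) auto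
  qed
qed auto

text \<open>The ideal is transported along the given isomorphism \<open>h\<close> of \<open>A\<close> with the last stage. Its image is
closed because the inverse of \<open>h\<close> is contractive, and it is self-adjoint, hence so is \<open>I\<close>.\<close>

theorem corollary3p3:
  fixes A :: "'a cstar" and D :: "'x rsh_data" and I :: "'a set"
  assumes "rsh_decomposition A D"
    and "separable_cstar A"
    and "closed_ideal I A"
  shows "\<exists>D' :: 'x rsh_data. rsh_decomposition (unitization A I) D' \<and>
           topological_dim D' \<le> topological_dim D \<and>
           max_matrix_size D' \<le> max_matrix_size D"
proof -
  let ?R = "stage D (len D)"
  have A: "unital_cstar_algebra A" and valid: "valid_rsh_data D"
    using assms(1) by (simp_all add: rsh_decomposition_def)
  obtain h where h: "h \<in> star_iso A ?R" using assms(1) by (auto simp: rsh_decomposition_def)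
  interpret rsh D by (rule rsh.intro[OF valid])
  have R: "unital_cstar_algebra ?R" by (rule stage_cstar[OF order_refl])
  interpret A: unital_cstar_algebra A by (rule A)
  interpret I: cstar_closed_ideal A I by (rule cstar_closed_ideal.intro[OF A]) (unfold_locales, rule assms(3))
  have hh: "h \<in> star_hom A ?R" and bij: "bij_betw h (carrier A) (carrier ?R)"
    using h by (auto simp: star_iso_def)
  note hD = star_homD[OF hh]
  let ?g = "inv_into (carrier A) h"
  have g: "?g \<in> star_hom ?R A" by (rule star_iso_inv[OF A h])
  have hg: "h (?g b) = b" "?g b \<in> carrier A" if "b \<in> carrier ?R" for b
    using bij that by (auto simp: bij_betw_def f_inv_into_f inv_into_into)
  have gh: "?g (h x) = x" if "x \<in> carrier A" for x
    using bij that by (simp add: bij_betw_inv_into_left)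
  have ideal: "rsh_ideal D (h ` I)"
  proof
    show "h ` I \<subseteq> carrier ?R" using hD(1) I.I_carrier by blast
    have "h \<zero>\<^bsub>A\<^esub> = \<zero>\<^bsub>?R\<^esub>"
      using hD(5)[OF A.zero_closed, of 0] hD(1)[OF A.zero_closed] unital_cstar_algebra.zero_smult[OF R] by simp
    then show "\<zero>\<^bsub>?R\<^esub> \<in> h ` I" by (rule image_eqI[OF sym I.I_zero])
    show "a \<oplus>\<^bsub>?R\<^esub> b \<in> h ` I" if ab: "a \<in> h ` I" "b \<in> h ` I" for a b
    proof -
      obtain x y where xy: "x \<in> I" "y \<in> I" "a = h x" "b = h y" using ab by blast
      have "a \<oplus>\<^bsub>?R\<^esub> b = h (x \<oplus>\<^bsub>A\<^esub> y)"
        unfolding xy(3,4) by (rule hD(2)[OF I.I_carrier[OF xy(1)] I.I_carrier[OF xy(2)], symmetric])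
      then show ?thesis using I.I_add[OF xy(1,2)] by blast
    qed
    show "b \<otimes>\<^bsub>?R\<^esub> a \<in> h ` I" if b: "b \<in> carrier ?R" and a: "a \<in> h ` I" for a b
    proof -
      obtain x where x: "x \<in> I" "a = h x" using a by blast
      have "b \<otimes>\<^bsub>?R\<^esub> a = h (?g b \<otimes>\<^bsub>A\<^esub> x)"
        using hD(3)[OF hg(2)[OF b] I.I_carrier[OF x(1)]] hg(1)[OF b] x(2) by simp
      moreover have "?g b \<otimes>\<^bsub>A\<^esub> x \<in> I" by (rule ideal.I_l_closed[OF I.I_ideal x(1) hg(2)[OF b]])
      ultimately show ?thesis by blast
    qed
    show "a \<otimes>\<^bsub>?R\<^esub> b \<in> h ` I" if b: "b \<in> carrier ?R" and a: "a \<in> h ` I" for a b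
    proof -
      obtain x where x: "x \<in> I" "a = h x" using a by blast
      have "a \<otimes>\<^bsub>?R\<^esub> b = h (x \<otimes>\<^bsub>A\<^esub> ?g b)"
        using hD(3)[OF I.I_carrier[OF x(1)] hg(2)[OF b]] hg(1)[OF b] x(2) by simp
      moreover have "x \<otimes>\<^bsub>A\<^esub> ?g b \<in> I" by (rule ideal.I_r_closed[OF I.I_ideal x(1) hg(2)[OF b]])
      ultimately show ?thesis by blast
    qed
  qed
  have closed: "b \<in> h ` I"
    if b: "b \<in> carrier ?R" and approx: "\<And>e. 0 < e \<Longrightarrow> \<exists>a\<in>h ` I. cnorm ?R (b \<ominus>\<^bsub>?R\<^esub> a) \<le> e" for b
  proof -
    have "\<exists>x. x \<in> I \<and> cnorm ?R (b \<ominus>\<^bsub>?R\<^esub> h x) \<le> inverse (real (Suc n))" for n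
    proof -
      have "\<exists>a\<in>h ` I. cnorm ?R (b \<ominus>\<^bsub>?R\<^esub> a) \<le> inverse (real (Suc n))"
        by (rule approx) simp
      then obtain a where a: "a \<in> h ` I" "cnorm ?R (b \<ominus>\<^bsub>?R\<^esub> a) \<le> inverse (real (Suc n))"
        by (elim bexE)
      obtain x where "a = h x" "x \<in> I" using a(1) by (rule imageE)
      then show ?thesis using a(2) by (intro exI[of _ x] conjI) simp_all
    qed
    then have "\<forall>n. \<exists>x. x \<in> I \<and> cnorm ?R (b \<ominus>\<^bsub>?R\<^esub> h x) \<le> inverse (real (Suc n))" by (rule allI)
    from choice[OF this] obtain \<sigma> where \<sigma>': "\<forall>n. \<sigma> n \<in> I \<and> cnorm ?R (b \<ominus>\<^bsub>?R\<^esub> h (\<sigma> n)) \<le> inverse (real (Suc n))"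
      by (rule exE)
    have \<sigma>: "\<sigma> n \<in> I" "cnorm ?R (b \<ominus>\<^bsub>?R\<^esub> h (\<sigma> n)) \<le> inverse (real (Suc n))" for n
      using spec[OF \<sigma>', of n] by simp_all
    have "cnorm A (\<sigma> n \<ominus>\<^bsub>A\<^esub> ?g b) \<le> inverse (real (Suc n))" for n
    proof -
      have \<sigma>c: "\<sigma> n \<in> carrier A" by (rule I.I_carrier[OF \<sigma>(1)])
      have "cnorm A (?g b \<ominus>\<^bsub>A\<^esub> ?g (h (\<sigma> n))) \<le> cnorm ?R (b \<ominus>\<^bsub>?R\<^esub> h (\<sigma> n))"
        by (rule star_hom_dist_le[OF R A g b hD(1)[OF \<sigma>c]])
      then show ?thesis
        using \<sigma>(2)[of n] A.cnorm_diff_commute[OF \<sigma>c hg(2)[OF b]] gh[OF \<sigma>c] by simp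
    qed
    then have "(\<lambda>n. cnorm A (\<sigma> n \<ominus>\<^bsub>A\<^esub> ?g b)) \<longlonglongrightarrow> 0"
      using A.cnorm_nonneg[OF A.diff_in[OF I.I_carrier[OF \<sigma>(1)] hg(2)[OF b]]]
      by (intro tendsto_sandwich[OF _ _ tendsto_const LIMSEQ_inverse_real_of_nat]) simp_all
    then have "?g b \<in> I" by (rule I.I_limit[OF \<sigma>(1) hg(2)[OF b]])
    then have "h (?g b) \<in> h ` I" by (rule imageI)
    then show ?thesis by (simp only: hg(1)[OF b])
  qed
  interpret J: rsh_closed_ideal D "h ` I"
    by (rule rsh_closed_ideal.intro[OF ideal]) (unfold_locales, rule closed)
  have star: "star A x \<in> I" if x: "x \<in> I" for x
  proof -
    have "h (star A x) \<in> h ` I"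
      using J.star_mem_ideal[of "h x"] x hD(6)[OF I.I_carrier[OF x]] by simp
    then obtain y where y: "h (star A x) = h y" "y \<in> I" by (rule imageE)
    have "?g (h (star A x)) = ?g (h y)" by (simp only: y(1))
    then have "star A x = y"
      unfolding gh[OF A.star_in[OF I.I_carrier[OF x]]] gh[OF I.I_carrier[OF y(2)]] .
    then show ?thesis using y(2) by simp
  qed
  have SI: "cstar_closed_star_ideal A I"
    by (rule cstar_closed_star_ideal.intro[OF I.cstar_closed_ideal_axioms cstar_closed_star_ideal_axioms.intro])
      (rule star)
  have "(\<lambda>(x, c). adjoin_scalar D c (h x \<oplus>\<^bsub>?R\<^esub> c \<odot>\<^bsub>?R\<^esub> \<one>\<^bsub>?R\<^esub>))
      \<in> star_iso (unitization A I) (stage J.D' (Suc (len D)))"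
    by (rule J.unitization_star_iso[OF A h _ refl I.I_zero])
      (rule subsetI, erule I.I_carrier | erule (1) I.I_add | erule (1) I.I_mult | erule I.I_smult | erule star)+
  then have iso: "star_iso (unitization A I) (stage J.D' (Suc (len D))) \<noteq> {}"
    by (rule ex_in_conv[THEN iffD1, OF exI])
  have "rsh_decomposition (unitization A I) J.D'"
    unfolding rsh_decomposition_def unitization_data_simps
    by (intro conjI cstar_closed_star_ideal.unitization_cstar_algebra[OF SI] J.valid_unitization_data iso)
  then show ?thesis
    by (intro exI[of _ J.D'] conjI topological_dim_unitization_data max_matrix_size_unitization_data)
qed

end
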